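(* Let $\mathbf{C}$ be a locally finitely presentable category, and let $$d_{X,Y}\colon\Gamma(\Sigma X,Y)\to ST\bigl(\Gamma(X,STY)+X+Y\bigr)$$ be an incremental structural law over a distributive law $\delta\colon TS\to ST$, with $S=\Sigma^*$. Let $T'$ be the free monad on the endofunctor $\Gamma_S\Delta\colon X\mapsto\Gamma(X,SX)$, and let $T\oplus T'$ be the coproduct of $T$ and $T'$ in the category of monads on $\mathbf{C}$, with injections $in_1\colon T\to T\oplus T'$ and $in_2\colon T'\to T\oplus T'$. Then $d$ induces a monad distributive law $$d_{/\delta}\colon(T\oplus T')S\to S(T\oplus T')$$ such that, for every object $X$, the composite $$\Gamma(\Sigma X,X)\xrightarrow{\Gamma(\eta_{\Sigma,X},\eta^S_X)}\Gamma(SX,SX)\xrightarrow{\Gamma(SX,\eta^S_{SX})}\Gamma(SX,SSX)\xrightarrow{\eta_{\Gamma_S,SX}}T'SX\xrightarrow{in_2}(T\oplus T')SX\xrightarrow{(d_{/\delta})_X}S(T\oplus T')X$$ equals the composite of the following morphisms, in order: $d_{X,X}\colon\Gamma(\Sigma X,X)\to ST(\Gamma(X,STX)+X+X)$; $ST(\Gamma(\eta^T_X,STX)+[\mathrm{id}_X,\mathrm{id}_X])$, with codomain $ST(\Gamma(TX,STX)+X)$; $ST(\eta_{\Gamma_S,TX}+X)$, with codomain $ST(T'TX+X)$; $ST(in_2\,in_1+X)$, with codomain $ST((T\oplus T')(T\oplus T')X+X)$; $S\bigl(in_1[\mu^{T\oplus T'}_X,\eta^{T\oplus T'}_X]\bigr)$,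 with codomain $S(T\oplus T')(T\oplus T')X$; $S\mu^{T\oplus T'}_X$, with codomain $S(T\oplus T')X$. Furthermore, $T\oplus T'$ is constant-free, hence the monad morphism $S\eta^{T\oplus T'}\colon S\to S(T\oplus T')$ (for the composite monad structure given by $d_{/\delta}$) is admissible.
   Context: An incremental structural law on a locally finitely presentable category $\mathbf{C}$ consists of: a monad distributive law $\delta\colon TS\to ST$ with $S=\Sigma^*$ the free monad on a finitary endofunctor $\Sigma$ and $T$ a constant-free monad; a functor $\Gamma\colon\mathbf{C}^2\to\mathbf{C}$ cocontinuous in its first argument and finitary in its second; and a natural transformation (in $X$ and $Y$) $d_{X,Y}\colon\Gamma(\Sigma X,Y)\to ST(\Gamma(X,STY)+X+Y)$. It is assumed that the monad coproduct $T\oplus T'$ exists (this is automatic if $T$ is finitary). For an endofunctor $F$ generating a free monad $F^*$, $\eta_F\colon F\to F^*$ is the canonical natural transformation; in particular $\eta_\Sigma\colon\Sigma\to S$ and $\eta_{\Gamma_S,X}\colon\Gamma(X,SX)\to T'X$. $\eta^M,\mu^M$ are the unit and multiplication of a monad $M$. Juxtaposition of natural transformations is horizontal composition; e.g. $in_2\,in_1\colon T'T\to(T\oplus T')(T\oplus T')$, and $in_1 f\colon TA\to(T\oplus T')B$ for $f\colon A\to B$ is $(in_1)_B\circ Tf$. A monad distributive law is in the sense of Beck. A monad $M$ is constant-free iff $\eta^M_\emptyset\colon\emptyset\to M\emptyset$ is an isomorphism ($\emptyset$ initial). A monad morphism $\alpha$ is admissible iff $\alpha_\emptyset$ is an isomorphism.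 *)

theory Defs
  imports Main "HOL-Library.FuncSet"
begin

unbundle cardinal_syntax

section \<open>Smallness\<close>

text \<open>
  Size is measured against a type \<open>'u\<close> whose cardinality is an uncountable (strongly)
  inaccessible cardinal, i.e. against a Grothendieck universe: a set, of whatever type, is
  small if it has fewer elements than \<open>'u\<close>.  Every small category is isomorphic to one
  whose objects and arrows are elements of \<open>'u\<close>, so small diagrams are indexed by
  categories of type \<open>('u, 'u) cat\<close>.
\<close>

definition universe_type :: "'u itself \<Rightarrow> bool" where
  "universe_type u \<longleftrightarrow>
     natLeq <o |UNIV :: 'u set| \<and>
     regularCard |UNIV :: 'u set| \<and>
     (\<forall>A :: 'u set. |A| <o |UNIV :: 'u set| \<longrightarrow> |Pow A| <o |UNIV :: 'u set| )"

definition small :: "'u itself \<Rightarrow> 'x set \<Rightarrow> bool" where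
  "small u A \<longleftrightarrow> |A| <o |UNIV :: 'u set|"


section \<open>Categories, functors, natural transformations\<close>

record ('o, 'a) cat =
  Obj :: "'o set"
  Arr :: "'a set"
  Dom :: "'a \<Rightarrow> 'o"
  Cod :: "'a \<Rightarrow> 'o"
  Ident :: "'o \<Rightarrow> 'a"
  Comp :: "'a \<Rightarrow> 'a \<Rightarrow> 'a"  (infixr "\<cdot>\<index>" 55)

definition hom :: "('o, 'a) cat \<Rightarrow> 'o \<Rightarrow> 'o \<Rightarrow> 'a set" where
  "hom C X Y = {f \<in> Arr C. Dom C f = X \<and> Cod C f = Y}"

locale category =
  fixes C :: "('o, 'a) cat" (structure)
  assumes Dom_Obj: "f \<in> Arr C \<Longrightarrow> Dom C f \<in> Obj C"
    and Cod_Obj: "f \<in> Arr C \<Longrightarrow> Cod C f \<in> Obj C"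
    and Ident_hom: "X \<in> Obj C \<Longrightarrow> Ident C X \<in> hom C X X"
    and Comp_hom: "f \<in> hom C X Y \<Longrightarrow> g \<in> hom C Y Z \<Longrightarrow> g \<cdot> f \<in> hom C X Z"
    and Comp_Ident: "f \<in> hom C X Y \<Longrightarrow> f \<cdot> Ident C X = f"
    and Ident_Comp: "f \<in> hom C X Y \<Longrightarrow> Ident C Y \<cdot> f = f"
    and Comp_assoc: "f \<in> hom C W X \<Longrightarrow> g \<in> hom C X Y \<Longrightarrow> h \<in> hom C Y Z \<Longrightarrow>
                       (h \<cdot> g) \<cdot> f = h \<cdot> (g \<cdot> f)"

definition iso :: "('o, 'a) cat \<Rightarrow> 'a \<Rightarrow> bool" where
  "iso C f \<longleftrightarrow> f \<in> Arr C \<and>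
     (\<exists>g \<in> hom C (Cod C f) (Dom C f).
        g \<cdot>\<^bsub>C\<^esub> f = Ident C (Dom C f) \<and> f \<cdot>\<^bsub>C\<^esub> g = Ident C (Cod C f))"

definition initial :: "('o, 'a) cat \<Rightarrow> 'o \<Rightarrow> bool" where
  "initial C Z \<longleftrightarrow> Z \<in> Obj C \<and> (\<forall>X \<in> Obj C. \<exists>!f. f \<in> hom C Z X)"

record ('o1, 'a1, 'o2, 'a2) ftor =
  fo :: "'o1 \<Rightarrow> 'o2"
  fa :: "'a1 \<Rightarrow> 'a2"

locale is_functor = A: category A + B: category B
  for A :: "('o1, 'a1) cat" and B :: "('o2, 'a2) cat" +
  fixes F :: "('o1, 'a1, 'o2, 'a2, 'x) ftor_scheme"
  assumes fo_Obj: "X \<in> Obj A \<Longrightarrow> fo F X \<in> Obj B"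
    and fa_hom: "f \<in> hom A X Y \<Longrightarrow> fa F f \<in> hom B (fo F X) (fo F Y)"
    and fa_Ident: "X \<in> Obj A \<Longrightarrow> fa F (Ident A X) = Ident B (fo F X)"
    and fa_Comp: "f \<in> hom A X Y \<Longrightarrow> g \<in> hom A Y Z \<Longrightarrow>
                    fa F (g \<cdot>\<^bsub>A\<^esub> f) = fa F g \<cdot>\<^bsub>B\<^esub> fa F f"

definition id_ftor :: "('o, 'a, 'o, 'a) ftor" where
  "id_ftor = \<lparr>fo = \<lambda>X. X, fa = \<lambda>f. f\<rparr>"

definition comp_ftor ::
    "('o2, 'a2, 'o3, 'a3, 'y) ftor_scheme \<Rightarrow> ('o1, 'a1, 'o2, 'a2, 'x) ftor_scheme \<Rightarrow>
     ('o1, 'a1, 'o3, 'a3) ftor"  (infixr "\<odot>" 75) where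
  "G \<odot> F = \<lparr>fo = \<lambda>X. fo G (fo F X), fa = \<lambda>f. fa G (fa F f)\<rparr>"

text \<open>Families of arrows are total functions; only their values on objects of the
  category matter, and uniqueness of such a family is uniqueness on objects.\<close>

locale nat_trans = F: is_functor A B F + G: is_functor A B G
  for A :: "('o1, 'a1) cat" and B :: "('o2, 'a2) cat"
    and F :: "('o1, 'a1, 'o2, 'a2, 'x) ftor_scheme"
    and G :: "('o1, 'a1, 'o2, 'a2, 'y) ftor_scheme" +
  fixes \<tau> :: "'o1 \<Rightarrow> 'a2"
  assumes component: "X \<in> Obj A \<Longrightarrow> \<tau> X \<in> hom B (fo F X) (fo G X)"
    and natural: "f \<in> hom A X Y \<Longrightarrow> \<tau> Y \<cdot>\<^bsub>B\<^esub> fa F f = fa G f \<cdot>\<^bsub>B\<^esub> \<tau> X"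

definition prod_cat ::
    "('o1, 'a1) cat \<Rightarrow> ('o2, 'a2) cat \<Rightarrow> ('o1 \<times> 'o2, 'a1 \<times> 'a2) cat" where
  "prod_cat A B =
     \<lparr>Obj = Obj A \<times> Obj B,
      Arr = Arr A \<times> Arr B,
      Dom = \<lambda>(f, g). (Dom A f, Dom B g),
      Cod = \<lambda>(f, g). (Cod A f, Cod B g),
      Ident = \<lambda>(X, Y). (Ident A X, Ident B Y),
      Comp = \<lambda>(f', g') (f, g). (f' \<cdot>\<^bsub>A\<^esub> f, g' \<cdot>\<^bsub>B\<^esub> g)\<rparr>"

text \<open>The partial functors \<open>G(_, Y)\<close> and \<open>G(X, _)\<close> of a bifunctor.\<close>

definition fix_snd ::
    "('o2, 'a2) cat \<Rightarrow> ('o1 \<times> 'o2, 'a1 \<times> 'a2, 'o3, 'a3) ftor \<Rightarrow> 'o2 \<Rightarrow>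
     ('o1, 'a1, 'o3, 'a3) ftor" where
  "fix_snd B G Y = \<lparr>fo = \<lambda>X. fo G (X, Y), fa = \<lambda>f. fa G (f, Ident B Y)\<rparr>"

definition fix_fst ::
    "('o1, 'a1) cat \<Rightarrow> ('o1 \<times> 'o2, 'a1 \<times> 'a2, 'o3, 'a3) ftor \<Rightarrow> 'o1 \<Rightarrow>
     ('o2, 'a2, 'o3, 'a3) ftor" where
  "fix_fst A G X = \<lparr>fo = \<lambda>Y. fo G (X, Y), fa = \<lambda>g. fa G (Ident A X, g)\<rparr>"


section \<open>Colimits\<close>

definition cocone ::
    "('o, 'a) cat \<Rightarrow> ('i, 'j) cat \<Rightarrow> ('i, 'j, 'o, 'a) ftor \<Rightarrow> 'o \<Rightarrow> ('i \<Rightarrow> 'a) \<Rightarrow> bool" where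
  "cocone C J D Z c \<longleftrightarrow>
     Z \<in> Obj C \<and>
     (\<forall>j \<in> Obj J. c j \<in> hom C (fo D j) Z) \<and>
     (\<forall>i j u. u \<in> hom J i j \<longrightarrow> c j \<cdot>\<^bsub>C\<^esub> fa D u = c i)"

definition colimit ::
    "('o, 'a) cat \<Rightarrow> ('i, 'j) cat \<Rightarrow> ('i, 'j, 'o, 'a) ftor \<Rightarrow> 'o \<Rightarrow> ('i \<Rightarrow> 'a) \<Rightarrow> bool" where
  "colimit C J D Z c \<longleftrightarrow>
     cocone C J D Z c \<and>
     (\<forall>W w. cocone C J D W w \<longrightarrow>
        (\<exists>!h. h \<in> hom C Z W \<and> (\<forall>j \<in> Obj J. h \<cdot>\<^bsub>C\<^esub> c j = w j)))"

definition small_cat :: "'u itself \<Rightarrow> ('i, 'j) cat \<Rightarrow> bool" where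
  "small_cat u J \<longleftrightarrow> category J \<and> small u (Obj J) \<and> small u (Arr J)"

definition filtered :: "('i, 'j) cat \<Rightarrow> bool" where
  "filtered J \<longleftrightarrow>
     Obj J \<noteq> {} \<and>
     (\<forall>i \<in> Obj J. \<forall>j \<in> Obj J. \<exists>k \<in> Obj J. hom J i k \<noteq> {} \<and> hom J j k \<noteq> {}) \<and>
     (\<forall>i j u v. u \<in> hom J i j \<and> v \<in> hom J i j \<longrightarrow>
        (\<exists>k \<in> Obj J. \<exists>w \<in> hom J j k. w \<cdot>\<^bsub>J\<^esub> u = w \<cdot>\<^bsub>J\<^esub> v))"

definition preserves_colimits ::
    "('i, 'j) cat \<Rightarrow> ('o1, 'a1) cat \<Rightarrow> ('o2, 'a2) cat \<Rightarrow>
     ('o1, 'a1, 'o2, 'a2) ftor \<Rightarrow> bool" where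
  "preserves_colimits J A B F \<longleftrightarrow>
     (\<forall>D Z c. is_functor J A D \<and> colimit A J D Z c \<longrightarrow>
        colimit B J (F \<odot> D) (fo F Z) (\<lambda>j. fa F (c j)))"

definition cocontinuous ::
    "'u itself \<Rightarrow> ('o1, 'a1) cat \<Rightarrow> ('o2, 'a2) cat \<Rightarrow> ('o1, 'a1, 'o2, 'a2) ftor \<Rightarrow> bool" where
  "cocontinuous u A B F \<longleftrightarrow>
     is_functor A B F \<and>
     (\<forall>J :: ('u, 'u) cat. small_cat u J \<longrightarrow> preserves_colimits J A B F)"

definition finitary ::
    "'u itself \<Rightarrow> ('o1, 'a1) cat \<Rightarrow> ('o2, 'a2) cat \<Rightarrow> ('o1, 'a1, 'o2, 'a2) ftor \<Rightarrow> bool" where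
  "finitary u A B F \<longleftrightarrow>
     is_functor A B F \<and>
     (\<forall>J :: ('u, 'u) cat. small_cat u J \<and> filtered J \<longrightarrow> preserves_colimits J A B F)"

definition cocomplete :: "'u itself \<Rightarrow> ('o, 'a) cat \<Rightarrow> bool" where
  "cocomplete u C \<longleftrightarrow>
     (\<forall>(J :: ('u, 'u) cat) D. small_cat u J \<and> is_functor J C D \<longrightarrow> (\<exists>Z c. colimit C J D Z c))"


section \<open>Locally finitely presentable categories\<close>

text \<open>The category of small sets, here the small subsets of a type \<open>'x\<close>.  An arrow is a
  triple of domain, function (extensional on the domain) and codomain.  For \<open>'x = 'a\<close> it
  contains the hom-sets of a locally small category with arrows in \<open>'a\<close>; as soon as \<open>'a\<close>
  has two elements it also contains a two-element set, which is enough to test the universal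
  property of a colimit of sets, so that no generality is lost by restricting to
  subsets of \<open>'a\<close>.\<close>

definition set_cat :: "'u itself \<Rightarrow> ('x set, 'x set \<times> ('x \<Rightarrow> 'x) \<times> 'x set) cat" where
  "set_cat u =
     \<lparr>Obj = {A. small u A},
      Arr = {(A, f, B). small u A \<and> small u B \<and> f \<in> A \<rightarrow>\<^sub>E B},
      Dom = \<lambda>(A, f, B). A,
      Cod = \<lambda>(A, f, B). B,
      Ident = \<lambda>A. (A, \<lambda>x\<in>A. x, A),
      Comp = \<lambda>(A', g, B') (A, f, B). (A, compose A g f, B')\<rparr>"

definition hom_ftor ::
    "('o, 'a) cat \<Rightarrow> 'o \<Rightarrow> ('o, 'a, 'a set, 'a set \<times> ('a \<Rightarrow> 'a) \<times> 'a set) ftor" where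
  "hom_ftor C P =
     \<lparr>fo = \<lambda>X. hom C P X,
      fa = \<lambda>f. (hom C P (Dom C f), \<lambda>g \<in> hom C P (Dom C f). f \<cdot>\<^bsub>C\<^esub> g, hom C P (Cod C f))\<rparr>"

definition locally_small :: "'u itself \<Rightarrow> ('o, 'a) cat \<Rightarrow> bool" where
  "locally_small u C \<longleftrightarrow> (\<forall>X \<in> Obj C. \<forall>Y \<in> Obj C. small u (hom C X Y))"

definition finitely_presentable :: "'u itself \<Rightarrow> ('o, 'a) cat \<Rightarrow> 'o \<Rightarrow> bool" where
  "finitely_presentable u C P \<longleftrightarrow>
     P \<in> Obj C \<and> finitary u C (set_cat u) (hom_ftor C P)"

definition locally_finitely_presentable :: "'u itself \<Rightarrow> ('o, 'a) cat \<Rightarrow> bool" where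
  "locally_finitely_presentable u C \<longleftrightarrow>
     category C \<and> locally_small u C \<and> cocomplete u C \<and>
     (\<exists>G \<subseteq> Obj C. small u G \<and> (\<forall>P \<in> G. finitely_presentable u C P) \<and>
        (\<forall>X \<in> Obj C. \<exists>(J :: ('u, 'u) cat) D c.
           small_cat u J \<and> filtered J \<and> is_functor J C D \<and>
           (\<forall>j \<in> Obj J. fo D j \<in> G) \<and> colimit C J D X c))"


section \<open>Binary coproducts\<close>

record ('o, 'a) coprods =
  csum :: "'o \<Rightarrow> 'o \<Rightarrow> 'o"
  cinl :: "'o \<Rightarrow> 'o \<Rightarrow> 'a"
  cinr :: "'o \<Rightarrow> 'o \<Rightarrow> 'a"

definition binary_coproducts :: "('o, 'a) cat \<Rightarrow> ('o, 'a) coprods \<Rightarrow> bool" where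
  "binary_coproducts C K \<longleftrightarrow>
     (\<forall>A \<in> Obj C. \<forall>B \<in> Obj C.
        csum K A B \<in> Obj C \<and>
        cinl K A B \<in> hom C A (csum K A B) \<and>
        cinr K A B \<in> hom C B (csum K A B) \<and>
        (\<forall>Z \<in> Obj C. \<forall>f \<in> hom C A Z. \<forall>g \<in> hom C B Z.
           \<exists>!h. h \<in> hom C (csum K A B) Z \<and>
                h \<cdot>\<^bsub>C\<^esub> cinl K A B = f \<and> h \<cdot>\<^bsub>C\<^esub> cinr K A B = g))"

text \<open>\<open>[f, g] : A + B \<rightarrow> Z\<close> for \<open>f : A \<rightarrow> Z\<close> and \<open>g : B \<rightarrow> Z\<close>.\<close>

definition copair :: "('o, 'a) cat \<Rightarrow> ('o, 'a) coprods \<Rightarrow> 'a \<Rightarrow> 'a \<Rightarrow> 'a" where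
  "copair C K f g =
     (THE h. h \<in> hom C (csum K (Dom C f) (Dom C g)) (Cod C f) \<and>
             h \<cdot>\<^bsub>C\<^esub> cinl K (Dom C f) (Dom C g) = f \<and>
             h \<cdot>\<^bsub>C\<^esub> cinr K (Dom C f) (Dom C g) = g)"

text \<open>\<open>f + g : A + B \<rightarrow> A' + B'\<close> for \<open>f : A \<rightarrow> A'\<close> and \<open>g : B \<rightarrow> B'\<close>.\<close>

definition csum_arr :: "('o, 'a) cat \<Rightarrow> ('o, 'a) coprods \<Rightarrow> 'a \<Rightarrow> 'a \<Rightarrow> 'a" where
  "csum_arr C K f g =
     copair C K (cinl K (Cod C f) (Cod C g) \<cdot>\<^bsub>C\<^esub> f) (cinr K (Cod C f) (Cod C g) \<cdot>\<^bsub>C\<^esub> g)"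


section \<open>Monads\<close>

record ('o, 'a) monad = "('o, 'a, 'o, 'a) ftor" +
  unit :: "'o \<Rightarrow> 'a"
  mult :: "'o \<Rightarrow> 'a"

locale is_monad = M: is_functor C C M
    + unit: nat_trans C C id_ftor M "unit M"
    + mult: nat_trans C C "M \<odot> M" M "mult M"
  for C :: "('o, 'a) cat" (structure) and M :: "('o, 'a) monad" +
  assumes unit_left: "X \<in> Obj C \<Longrightarrow> mult M X \<cdot> unit M (fo M X) = Ident C (fo M X)"
    and unit_right: "X \<in> Obj C \<Longrightarrow> mult M X \<cdot> fa M (unit M X) = Ident C (fo M X)"
    and mult_assoc: "X \<in> Obj C \<Longrightarrow>
                       mult M X \<cdot> mult M (fo M X) = mult M X \<cdot> fa M (mult M X)"

locale monad_morphism = M: is_monad C M + N: is_monad C N + nat_trans C C M N \<alpha>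
  for C :: "('o, 'a) cat" (structure) and M N :: "('o, 'a) monad" and \<alpha> :: "'o \<Rightarrow> 'a" +
  assumes pres_unit: "X \<in> Obj C \<Longrightarrow> \<alpha> X \<cdot> unit M X = unit N X"
    and pres_mult: "X \<in> Obj C \<Longrightarrow>
                      \<alpha> X \<cdot> mult M X = mult N X \<cdot> \<alpha> (fo N X) \<cdot> fa M (\<alpha> X)"

definition constant_free :: "('o, 'a) cat \<Rightarrow> ('o, 'a) monad \<Rightarrow> bool" where
  "constant_free C M \<longleftrightarrow> (\<forall>Z. initial C Z \<longrightarrow> iso C (unit M Z))"

definition admissible :: "('o, 'a) cat \<Rightarrow> ('o \<Rightarrow> 'a) \<Rightarrow> bool" where
  "admissible C \<alpha> \<longleftrightarrow> (\<forall>Z. initial C Z \<longrightarrow> iso C (\<alpha> Z))"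

text \<open>\<open>M\<close> with \<open>\<eta> : F \<rightarrow> M\<close> is the free monad on the endofunctor \<open>F\<close>.\<close>

definition free_monad ::
    "('o, 'a) cat \<Rightarrow> ('o, 'a, 'o, 'a) ftor \<Rightarrow> ('o, 'a) monad \<Rightarrow> ('o \<Rightarrow> 'a) \<Rightarrow> bool" where
  "free_monad C F M \<eta> \<longleftrightarrow>
     is_monad C M \<and> nat_trans C C F M \<eta> \<and>
     (\<forall>N \<sigma>. is_monad C N \<and> nat_trans C C F N \<sigma> \<longrightarrow>
        (\<exists>\<alpha>. monad_morphism C M N \<alpha> \<and> (\<forall>X \<in> Obj C. \<alpha> X \<cdot>\<^bsub>C\<^esub> \<eta> X = \<sigma> X) \<and>
             (\<forall>\<beta>. monad_morphism C M N \<beta> \<and> (\<forall>X \<in> Obj C. \<beta> X \<cdot>\<^bsub>C\<^esub> \<eta> X = \<sigma> X) \<longrightarrow>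
                  (\<forall>X \<in> Obj C. \<beta> X = \<alpha> X))))"

definition monad_coproduct ::
    "('o, 'a) cat \<Rightarrow> ('o, 'a) monad \<Rightarrow> ('o, 'a) monad \<Rightarrow> ('o, 'a) monad \<Rightarrow>
     ('o \<Rightarrow> 'a) \<Rightarrow> ('o \<Rightarrow> 'a) \<Rightarrow> bool" where
  "monad_coproduct C M\<^sub>1 M\<^sub>2 P i\<^sub>1 i\<^sub>2 \<longleftrightarrow>
     monad_morphism C M\<^sub>1 P i\<^sub>1 \<and> monad_morphism C M\<^sub>2 P i\<^sub>2 \<and>
     (\<forall>N f g. monad_morphism C M\<^sub>1 N f \<and> monad_morphism C M\<^sub>2 N g \<longrightarrow>
        (\<exists>h. monad_morphism C P N h \<and>
             (\<forall>X \<in> Obj C. h X \<cdot>\<^bsub>C\<^esub> i\<^sub>1 X = f X \<and> h X \<cdot>\<^bsub>C\<^esub> i\<^sub>2 X = g X) \<and>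
             (\<forall>k. monad_morphism C P N k \<and>
                  (\<forall>X \<in> Obj C. k X \<cdot>\<^bsub>C\<^esub> i\<^sub>1 X = f X \<and> k X \<cdot>\<^bsub>C\<^esub> i\<^sub>2 X = g X) \<longrightarrow>
                  (\<forall>X \<in> Obj C. k X = h X))))"

text \<open>Distributive laws \<open>\<lambda> : TS \<rightarrow> ST\<close> in the sense of Beck, and the monad structure they
  induce on \<open>ST\<close>.\<close>

locale distributive_law = T: is_monad C T + S: is_monad C S
    + nat_trans C C "T \<odot> S" "S \<odot> T" \<delta>
  for C :: "('o, 'a) cat" (structure) and T S :: "('o, 'a) monad" and \<delta> :: "'o \<Rightarrow> 'a" +
  assumes law_unit_T: "X \<in> Obj C \<Longrightarrow> \<delta> X \<cdot> unit T (fo S X) = fa S (unit T X)"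
    and law_unit_S: "X \<in> Obj C \<Longrightarrow> \<delta> X \<cdot> fa T (unit S X) = unit S (fo T X)"
    and law_mult_T: "X \<in> Obj C \<Longrightarrow>
          \<delta> X \<cdot> mult T (fo S X) = fa S (mult T X) \<cdot> \<delta> (fo T X) \<cdot> fa T (\<delta> X)"
    and law_mult_S: "X \<in> Obj C \<Longrightarrow>
          \<delta> X \<cdot> fa T (mult S X) = mult S (fo T X) \<cdot> fa S (\<delta> X) \<cdot> \<delta> (fo S X)"

definition composite_monad ::
    "('o, 'a) cat \<Rightarrow> ('o, 'a) monad \<Rightarrow> ('o, 'a) monad \<Rightarrow> ('o \<Rightarrow> 'a) \<Rightarrow> ('o, 'a) monad" where
  "composite_monad C S T \<delta> =
     \<lparr>fo = \<lambda>X. fo S (fo T X),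
      fa = \<lambda>f. fa S (fa T f),
      unit = \<lambda>X. unit S (fo T X) \<cdot>\<^bsub>C\<^esub> unit T X,
      mult = \<lambda>X. mult S (fo T X) \<cdot>\<^bsub>C\<^esub> fa S (fa S (mult T X)) \<cdot>\<^bsub>C\<^esub> fa S (\<delta> (fo T X))\<rparr>"


section \<open>Incremental structural laws\<close>

text \<open>The bifunctors \<open>(X, Y) \<mapsto> \<Gamma>(\<Sigma>X, Y)\<close> and \<open>(X, Y) \<mapsto> ST(\<Gamma>(X, STY) + (X + Y))\<close>.\<close>

definition law_source ::
    "('o, 'a, 'o, 'a) ftor \<Rightarrow> ('o \<times> 'o, 'a \<times> 'a, 'o, 'a) ftor \<Rightarrow>
     ('o \<times> 'o, 'a \<times> 'a, 'o, 'a) ftor" where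
  "law_source \<Sigma> \<Gamma> =
     \<lparr>fo = \<lambda>(X, Y). fo \<Gamma> (fo \<Sigma> X, Y),
      fa = \<lambda>(f, g). fa \<Gamma> (fa \<Sigma> f, g)\<rparr>"

definition law_target ::
    "('o, 'a) cat \<Rightarrow> ('o, 'a) coprods \<Rightarrow> ('o, 'a) monad \<Rightarrow> ('o, 'a) monad \<Rightarrow>
     ('o \<times> 'o, 'a \<times> 'a, 'o, 'a) ftor \<Rightarrow> ('o \<times> 'o, 'a \<times> 'a, 'o, 'a) ftor" where
  "law_target C K S T \<Gamma> =
     \<lparr>fo = \<lambda>(X, Y). fo S (fo T (csum K (fo \<Gamma> (X, fo S (fo T Y))) (csum K X Y))),
      fa = \<lambda>(f, g). fa S (fa T
             (csum_arr C K (fa \<Gamma> (f, fa S (fa T g))) (csum_arr C K f g)))\<rparr>"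

locale incremental_structural_law =
  \<delta>: distributive_law C T S \<delta> +
  \<Gamma>: is_functor "prod_cat C C" C \<Gamma> +
  d: nat_trans "prod_cat C C" C "law_source \<Sigma> \<Gamma>" "law_target C K S T \<Gamma>" d
  for u :: "'u itself" and C :: "('o, 'a) cat" and K :: "('o, 'a) coprods"
    and \<Sigma> :: "('o, 'a, 'o, 'a) ftor"
    and S :: "('o, 'a) monad" and \<eta>\<^sub>\<Sigma> :: "'o \<Rightarrow> 'a"
    and T :: "('o, 'a) monad" and \<delta> :: "'o \<Rightarrow> 'a"
    and \<Gamma> :: "('o \<times> 'o, 'a \<times> 'a, 'o, 'a) ftor" and d :: "'o \<times> 'o \<Rightarrow> 'a" +
  assumes \<Sigma>_finitary: "finitary u C C \<Sigma>"
    and S_free: "free_monad C \<Sigma> S \<eta>\<^sub>\<Sigma>"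
    and T_constant_free: "constant_free C T"
    and \<Gamma>_cocontinuous: "Y \<in> Obj C \<Longrightarrow> cocontinuous u C C (fix_snd C \<Gamma> Y)"
    and \<Gamma>_finitary: "X \<in> Obj C \<Longrightarrow> finitary u C C (fix_fst C \<Gamma> X)"

text \<open>\<open>\<Gamma>\<^sub>S\<Delta> : X \<mapsto> \<Gamma>(X, SX)\<close>\<close>

definition diagonal_ftor ::
    "('o \<times> 'o, 'a \<times> 'a, 'o, 'a) ftor \<Rightarrow> ('o, 'a) monad \<Rightarrow> ('o, 'a, 'o, 'a) ftor" where
  "diagonal_ftor \<Gamma> S =
     \<lparr>fo = \<lambda>X. fo \<Gamma> (X, fo S X), fa = \<lambda>f. fa \<Gamma> (f, fa S f)\<rparr>"

end

theory Submission
  imports Defs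
begin

text \<open>
  In a locally finitely presentable category every continuous presheaf is representable.  This
  yields, for each arrow \<open>f\<close>, a monad whose incoming monad morphisms are the pairs of algebra
  structures making \<open>f\<close> a homomorphism.  Hence free monads and coproducts of monads, given by
  universal properties among monads only, have the expected algebras: a \<open>T \<oplus> T'\<close>-algebra on
  \<open>A\<close> is a \<open>T\<close>-algebra on \<open>A\<close> together with an arrow \<open>\<Gamma>(A, SA) \<rightarrow> A\<close>, and \<open>SA\<close> is the free
  \<open>\<Sigma>\<close>-algebra.  As \<open>\<Gamma>\<close> is cocontinuous in its first argument, arrows out of \<open>\<Gamma>(SA, Y)\<close> can be
  defined by recursion along \<open>d\<close>.  This extends the \<open>T\<close>-algebra \<open>SA\<close> obtained from \<open>\<delta>\<close> to a
  \<open>T \<oplus> T'\<close>-algebra, and uniqueness of recursively defined arrows shows that the monad \<open>S\<close>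
  lifts to \<open>T \<oplus> T'\<close>-algebras; by Beck's theorem such a lifting is a distributive law.
\<close>

section \<open>Small sets\<close>

text \<open>\<open>free_monad\<close> and \<open>monad_coproduct\<close> quantify over monads only,
  so nothing in them says what their algebras are. Monads of endo-operations give access to
  algebras; an object alone would not capture homomorphisms, hence the version for an arrow, with an
  object treated through its identity. Such a monad is a limit, while only colimits are given:
  representability supplies it, and supplies a second time a right adjoint that trades arrows out of
  \<Gamma>(SA, Y), which have no recursion principle of their own, for \<Sigma>-homomorphisms out of
  SA. A further obstacle is that the recursive arguments of \<open>d\<close> lie in \<Gamma>(X, STY)
  and not in \<Gamma>(X, Y). The recursion therefore keeps Y fixed and feeds back along an arrow STY
  -> Y; for Y = SA with A a T-algebra, evaluation of terms is such an arrow. Lifting to all algebras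
  is preferred to a direct construction because one axiom of the law concerns the multiplication of
  a coproduct monad, for which no formula is available; among algebras it becomes the statement that
  an arrow is a homomorphism.\<close>

lemma small_mono: "A \<subseteq> B \<Longrightarrow> small u B \<Longrightarrow> small u A"
  unfolding small_def using card_of_mono1 ordLeq_ordLess_trans by blast

lemma small_image: "small u A \<Longrightarrow> small u (f ` A)"
  unfolding small_def using card_of_image ordLeq_ordLess_trans by blast

lemma small_inj_on:
  assumes "inj_on f A" "small u (f ` A)"
  shows "small u A"
proof -
  have "|A| \<le>o |f ` A|"
    using assms(1) card_of_ordLeq by blast
  then show ?thesis
    using assms(2) unfolding small_def using ordLeq_ordLess_trans by blast
qed

lemma small_code:
  assumes "small (u :: 'u itself) A"
  obtains \<iota> :: "'x \<Rightarrow> 'u" where "inj_on \<iota> (A :: 'x set)"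
  using assms ordLess_imp_ordLeq[of "|A|" "|UNIV :: 'u set|"]
    card_of_ordLeq[of A "UNIV :: 'u set"] unfolding small_def by blast

context
  fixes u :: "'u itself"
  assumes universe: "universe_type u"
begin

lemma universe_infinite: "infinite (UNIV :: 'u set)"
proof
  assume "finite (UNIV :: 'u set)"
  then have "|UNIV :: 'u set| <o natLeq"
    using finite_iff_ordLess_natLeq by blast
  moreover have "natLeq <o |UNIV :: 'u set|"
    using universe unfolding universe_type_def by blast
  ultimately show False
    using ordLess_transitive ordLess_irreflexive by blast
qed

lemma small_finite: "finite A \<Longrightarrow> small u A"
  unfolding small_def
  using universe_infinite
    finite_ordLess_infinite[OF card_of_Well_order card_of_Well_order, of A "UNIV :: 'u set"]
  by (simp add: Field_card_of)

text \<open>This is where regularity of the cardinal of \<open>'u\<close> enters: an infinite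
  regular cardinal is stable under indexed disjoint unions.\<close>

lemma small_Sigma:
  assumes "small u A" "\<And>a. a \<in> A \<Longrightarrow> small u (F a)"
  shows "small u (Sigma A F)"
proof -
  have "stable |UNIV :: 'u set|"
    using universe universe_infinite unfolding universe_type_def
    by (intro regularCard_stable[OF card_of_Card_order]) (auto simp: Field_card_of)
  then show ?thesis
    unfolding small_def using assms stable_elim unfolding small_def by blast
qed

lemma small_Times: "small u A \<Longrightarrow> small u B \<Longrightarrow> small u (A \<times> B)"
  by (rule small_Sigma)

text \<open>The power set condition in \<open>universe_type\<close> speaks of subsets of
  \<open>'u\<close>; an injection of \<open>A\<close> into \<open>'u\<close> transports it to
  arbitrary types.\<close>

lemma small_Pow:
  assumes "small u (A :: 'x set)"
  shows "small u (Pow A)"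
proof -
  obtain \<iota> :: "'x \<Rightarrow> 'u" where i: "inj_on \<iota> A"
    using small_code[OF assms] by blast
  have "|\<iota> ` A| <o |UNIV :: 'u set|"
    using small_image[OF assms] unfolding small_def by blast
  then have "|Pow (\<iota> ` A)| <o |UNIV :: 'u set|"
    using universe unfolding universe_type_def by blast
  then have "small u ((`) \<iota> ` Pow A)"
    by (simp add: small_def image_Pow_surj)
  then show ?thesis
    using small_inj_on inj_on_image_Pow[OF i] by blast
qed

text \<open>An extensional function is determined by its graph, so the function set embeds into the
  power set of \<open>A \<times> B\<close>.\<close>

lemma small_PiE:
  assumes "small u A" "small u B"
  shows "small u (A \<rightarrow>\<^sub>E B)"
proof (rule small_inj_on)
  let ?graph = "\<lambda>f. (\<lambda>a. (a, f a)) ` A"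
  show "inj_on ?graph (A \<rightarrow>\<^sub>E B)"
  proof (rule inj_onI)
    fix f g assume "f \<in> A \<rightarrow>\<^sub>E B" "g \<in> A \<rightarrow>\<^sub>E B" "?graph f = ?graph g"
    then show "f = g"
      by (intro PiE_ext[of f A "\<lambda>_. B" g]) auto
  qed
  have "?graph ` (A \<rightarrow>\<^sub>E B) \<subseteq> Pow (A \<times> B)"
    by auto
  then show "small u (?graph ` (A \<rightarrow>\<^sub>E B))"
    using small_mono small_Pow small_Times assms by metis
qed

end


section \<open>Typing by domain and codomain\<close>

text \<open>Membership in a hom-set is replaced by equations for domain and codomain, so that the
  simplifier can discharge composability conditions without guessing objects.\<close>

lemma hom_iff: "f \<in> hom C X Y \<longleftrightarrow> f \<in> Arr C \<and> Dom C f = X \<and> Cod C f = Y"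
  unfolding hom_def by blast

lemma homD:
  assumes "f \<in> hom C X Y"
  shows "f \<in> Arr C" "Dom C f = X" "Cod C f = Y"
  using assms unfolding hom_def by auto

context category
begin

lemma Dom_in [simp]: "f \<in> Arr C \<Longrightarrow> Dom C f \<in> Obj C"
  by (rule Dom_Obj)

lemma Cod_in [simp]: "f \<in> Arr C \<Longrightarrow> Cod C f \<in> Obj C"
  by (rule Cod_Obj)

lemma Ident_arr [simp]:
  assumes "X \<in> Obj C"
  shows "Ident C X \<in> Arr C" "Dom C (Ident C X) = X" "Cod C (Ident C X) = X"
  using Ident_hom[OF assms] by (auto dest: homD)

lemma Comp_arr [simp]:
  assumes "f \<in> Arr C" "g \<in> Arr C" "Dom C g = Cod C f"
  shows "g \<cdot> f \<in> Arr C" "Dom C (g \<cdot> f) = Dom C f" "Cod C (g \<cdot> f) = Cod C g"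
  using Comp_hom[of f "Dom C f" "Cod C f" g "Cod C g"] assms by (auto simp: hom_iff)

lemma Comp_id [simp]: "f \<in> Arr C \<Longrightarrow> Dom C f = X \<Longrightarrow> f \<cdot> Ident C X = f"
  using Comp_Ident[of f X "Cod C f"] by (auto simp: hom_iff)

lemma id_Comp [simp]: "f \<in> Arr C \<Longrightarrow> Cod C f = X \<Longrightarrow> Ident C X \<cdot> f = f"
  using Ident_Comp[of f "Dom C f" X] by (auto simp: hom_iff)

lemma assoc [simp]:
  assumes "f \<in> Arr C" "g \<in> Arr C" "h \<in> Arr C" "Dom C g = Cod C f" "Dom C h = Cod C g"
  shows "(h \<cdot> g) \<cdot> f = h \<cdot> (g \<cdot> f)"
  using Comp_assoc[of f "Dom C f" "Cod C f" g "Cod C g" h "Cod C h"] assms by (simp add: hom_iff)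

lemma Comp_reassoc:
  assumes "g \<cdot> f = k" "f \<in> Arr C" "g \<in> Arr C" "h \<in> Arr C" "Dom C g = Cod C f" "Dom C f = Cod C h"
  shows "g \<cdot> (f \<cdot> h) = k \<cdot> h"
  using assms by (metis assoc)

end

context is_functor
begin

lemma fo_in [simp]: "X \<in> Obj A \<Longrightarrow> fo F X \<in> Obj B"
  by (rule fo_Obj)

lemma fa_arr [simp]:
  assumes "f \<in> Arr A"
  shows "fa F f \<in> Arr B" "Dom B (fa F f) = fo F (Dom A f)" "Cod B (fa F f) = fo F (Cod A f)"
  using fa_hom[of f "Dom A f" "Cod A f"] assms by (auto simp: hom_iff)

lemma fa_id [simp]: "X \<in> Obj A \<Longrightarrow> fa F (Ident A X) = Ident B (fo F X)"
  by (rule fa_Ident)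

lemma fa_comp:
  "f \<in> Arr A \<Longrightarrow> g \<in> Arr A \<Longrightarrow> Dom A g = Cod A f \<Longrightarrow>
     fa F (g \<cdot>\<^bsub>A\<^esub> f) = fa F g \<cdot>\<^bsub>B\<^esub> fa F f"
  using fa_Comp[of f "Dom A f" "Cod A f" g "Cod A g"] by (simp add: hom_iff)

end

context nat_trans
begin

lemma nat_arr [simp]:
  assumes "X \<in> Obj A"
  shows "\<tau> X \<in> Arr B" "Dom B (\<tau> X) = fo F X" "Cod B (\<tau> X) = fo G X"
  using component[OF assms] by (auto simp: hom_iff)

lemma nat:
  "f \<in> Arr A \<Longrightarrow> \<tau> (Cod A f) \<cdot>\<^bsub>B\<^esub> fa F f = fa G f \<cdot>\<^bsub>B\<^esub> \<tau> (Dom A f)"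
  using natural[of f "Dom A f" "Cod A f"] by (simp add: hom_iff)

end

lemma comp_ftor_simps [simp]:
  "fo (G \<odot> F) X = fo G (fo F X)" "fa (G \<odot> F) f = fa G (fa F f)"
  by (simp_all add: comp_ftor_def)

lemma id_ftor_simps [simp]: "fo id_ftor X = X" "fa id_ftor f = f"
  by (simp_all add: id_ftor_def)

lemma (in category) id_functor: "is_functor C C id_ftor"
  by unfold_locales (auto simp: hom_iff)

lemma comp_functor:
  assumes "is_functor A B F" "is_functor B C G"
  shows "is_functor A C (G \<odot> F)"
proof -
  interpret F: is_functor A B F by fact
  interpret G: is_functor B C G by fact
  show ?thesis
    by unfold_locales (auto simp: hom_iff F.fa_comp G.fa_comp)
qed

lemma nat_transI:
  assumes "is_functor A B F" "is_functor A B G"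
    and "\<And>X. X \<in> Obj A \<Longrightarrow> \<tau> X \<in> hom B (fo F X) (fo G X)"
    and "\<And>f. f \<in> Arr A \<Longrightarrow> \<tau> (Cod A f) \<cdot>\<^bsub>B\<^esub> fa F f = fa G f \<cdot>\<^bsub>B\<^esub> \<tau> (Dom A f)"
  shows "nat_trans A B F G \<tau>"
proof -
  interpret F: is_functor A B F by fact
  interpret G: is_functor A B G by fact
  show ?thesis
    using assms(3,4) by unfold_locales (auto simp: hom_iff)
qed


section \<open>Representability of continuous presheaves\<close>

text \<open>An element of the limit of the sets \<open>\<Phi> (fo D j)\<close>, that is, a matching
  family for the contravariant action.\<close>

definition compatible ::
    "('i, 'j) cat \<Rightarrow> ('i, 'j, 'o, 'a) ftor \<Rightarrow> ('o \<Rightarrow> 'e set) \<Rightarrow> ('a \<Rightarrow> 'e \<Rightarrow> 'e) \<Rightarrow>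
     ('i \<Rightarrow> 'e) \<Rightarrow> bool" where
  "compatible J D \<Phi> act e \<longleftrightarrow>
     (\<forall>j \<in> Obj J. e j \<in> \<Phi> (fo D j)) \<and>
     (\<forall>i j u. u \<in> hom J i j \<longrightarrow> act (fa D u) (e j) = e i)"

locale presheaf = category C
  for C :: "('o, 'a) cat" (structure) +
  fixes \<Phi> :: "'o \<Rightarrow> 'e set" and act :: "'a \<Rightarrow> 'e \<Rightarrow> 'e"
  assumes act_in: "f \<in> Arr C \<Longrightarrow> e \<in> \<Phi> (Cod C f) \<Longrightarrow> act f e \<in> \<Phi> (Dom C f)"
    and act_Ident: "X \<in> Obj C \<Longrightarrow> e \<in> \<Phi> X \<Longrightarrow> act (Ident C X) e = e"
    and act_Comp: "f \<in> Arr C \<Longrightarrow> g \<in> Arr C \<Longrightarrow> Dom C g = Cod C f \<Longrightarrow> e \<in> \<Phi> (Cod C g) \<Longrightarrow>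
                     act (g \<cdot> f) e = act f (act g e)"

text \<open>\<open>glue\<close> is continuity, spelled out without a category of sets: \<Phi> turns
  a small colimit into a limit, so every matching family on the diagram has exactly one
  amalgamation.\<close>

locale continuous_presheaf = presheaf C \<Phi> act
  for u :: "'u itself" and C :: "('o, 'a) cat" (structure)
    and \<Phi> :: "'o \<Rightarrow> 'e set" and act :: "'a \<Rightarrow> 'e \<Rightarrow> 'e" +
  assumes small_values: "X \<in> Obj C \<Longrightarrow> small u (\<Phi> X)"
    and glue: "small_cat u (J :: ('u, 'u) cat) \<Longrightarrow> is_functor J C D \<Longrightarrow> colimit C J D Z c \<Longrightarrow>
                 compatible J D \<Phi> act e \<Longrightarrow>
                 \<exists>!x. x \<in> \<Phi> Z \<and> (\<forall>j \<in> Obj J. act (c j) x = e j)"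

locale lfp_category = category C
  for u :: "'u itself" and C :: "('o, 'a) cat" (structure) +
  assumes universe: "universe_type u"
    and lfp: "locally_finitely_presentable u C"

section \<open>The category of elements of a presheaf\<close>

context continuous_presheaf
begin

definition el_hom :: "'o \<times> 'e \<Rightarrow> 'o \<times> 'e \<Rightarrow> 'a set" where
  "el_hom x y = {f \<in> hom C (fst x) (fst y). act f (snd y) = snd x}"

text \<open>Arrows carry their source and target, since one arrow of C can underlie morphisms
  between many pairs of elements. Only the full subcategory on a set \<open>E\<close> is formed, so
  that it can be kept small.\<close>

definition el_cat :: "('o \<times> 'e) set \<Rightarrow> ('o \<times> 'e, ('o \<times> 'e) \<times> 'a \<times> ('o \<times> 'e)) cat" where
  "el_cat E =
     \<lparr>Obj = E,
      Arr = {(x, f, y). x \<in> E \<and> y \<in> E \<and> f \<in> el_hom x y},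
      Dom = \<lambda>(x, f, y). x,
      Cod = \<lambda>(x, f, y). y,
      Ident = \<lambda>x. (x, Ident C (fst x), x),
      Comp = \<lambda>(y', g, z) (x, f, y). (x, g \<cdot> f, z)\<rparr>"

end

text \<open>Smallness of diagrams is formulated for index categories with objects and arrows in
  \<open>'u\<close>; a small category of another type is first renamed along injections into \<open>'u\<close>.\<close>

definition rename_cat ::
    "('i \<Rightarrow> 'k) \<Rightarrow> ('j \<Rightarrow> 'l) \<Rightarrow> ('i, 'j) cat \<Rightarrow> ('k, 'l) cat" where
  "rename_cat \<iota> \<kappa> J = (let io = inv_into (Obj J) \<iota>; ia = inv_into (Arr J) \<kappa> in
     \<lparr>Obj = \<iota> ` Obj J,
      Arr = \<kappa> ` Arr J,
      Dom = \<lambda>f. \<iota> (Dom J (ia f)),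
      Cod = \<lambda>f. \<iota> (Cod J (ia f)),
      Ident = \<lambda>X. \<kappa> (Ident J (io X)),
      Comp = \<lambda>g f. \<kappa> (ia g \<cdot>\<^bsub>J\<^esub> ia f)\<rparr>)"

definition rename_ftor ::
    "('i \<Rightarrow> 'k) \<Rightarrow> ('j \<Rightarrow> 'l) \<Rightarrow> ('i, 'j) cat \<Rightarrow> ('i, 'j, 'o, 'a) ftor \<Rightarrow> ('k, 'l, 'o, 'a) ftor" where
  "rename_ftor \<iota> \<kappa> J D =
     \<lparr>fo = \<lambda>X. fo D (inv_into (Obj J) \<iota> X), fa = \<lambda>f. fa D (inv_into (Arr J) \<kappa> f)\<rparr>"

context
  fixes J :: "('i, 'j) cat" and C :: "('o, 'a) cat"
    and D :: "('i, 'j, 'o, 'a) ftor" and \<iota> :: "'i \<Rightarrow> 'k" and \<kappa> :: "'j \<Rightarrow> 'l"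
  assumes D: "is_functor J C D"
    and inj_obj: "inj_on \<iota> (Obj J)"
    and inj_arr: "inj_on \<kappa> (Arr J)"
begin

interpretation D: is_functor J C D
  by (rule D)

lemma rename_sel:
  "Obj (rename_cat \<iota> \<kappa> J) = \<iota> ` Obj J"
  "Arr (rename_cat \<iota> \<kappa> J) = \<kappa> ` Arr J"
  "f \<in> Arr J \<Longrightarrow> Dom (rename_cat \<iota> \<kappa> J) (\<kappa> f) = \<iota> (Dom J f)"
  "f \<in> Arr J \<Longrightarrow> Cod (rename_cat \<iota> \<kappa> J) (\<kappa> f) = \<iota> (Cod J f)"
  "X \<in> Obj J \<Longrightarrow> Ident (rename_cat \<iota> \<kappa> J) (\<iota> X) = \<kappa> (Ident J X)"
  "f \<in> Arr J \<Longrightarrow> g \<in> Arr J \<Longrightarrow> Comp (rename_cat \<iota> \<kappa> J) (\<kappa> g) (\<kappa> f) = \<kappa> (g \<cdot>\<^bsub>J\<^esub> f)"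
  "X \<in> Obj J \<Longrightarrow> fo (rename_ftor \<iota> \<kappa> J D) (\<iota> X) = fo D X"
  "f \<in> Arr J \<Longrightarrow> fa (rename_ftor \<iota> \<kappa> J D) (\<kappa> f) = fa D f"
  by (simp_all add: rename_cat_def rename_ftor_def Let_def inv_into_f_f inj_obj inj_arr)

lemma rename_obj_eq:
  "X \<in> Obj J \<Longrightarrow> Y \<in> Obj J \<Longrightarrow> \<iota> X = \<iota> Y \<longleftrightarrow> X = Y"
  using inj_obj by (auto dest: inj_onD)

lemma rename_category: "category (rename_cat \<iota> \<kappa> J)"
  by unfold_locales
    (auto simp: hom_iff rename_sel rename_obj_eq)

lemma rename_functor: "is_functor (rename_cat \<iota> \<kappa> J) C (rename_ftor \<iota> \<kappa> J D)"
proof -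
  interpret R: category "rename_cat \<iota> \<kappa> J"
    by (rule rename_category)
  show ?thesis
    by unfold_locales
      (auto simp: hom_iff rename_sel rename_obj_eq D.fa_comp)
qed

lemma rename_cocone:
  "cocone C (rename_cat \<iota> \<kappa> J) (rename_ftor \<iota> \<kappa> J D) Z c \<longleftrightarrow> cocone C J D Z (c \<circ> \<iota>)"
  unfolding cocone_def
  by (auto simp: hom_iff rename_sel rename_obj_eq)

lemma rename_small: "small u (Obj J) \<Longrightarrow> small u (Arr J) \<Longrightarrow> small_cat u (rename_cat \<iota> \<kappa> J)"
  by (simp add: small_cat_def rename_category rename_sel small_image)

lemma rename_compatible:
  "compatible J D \<Phi> act (e \<circ> \<iota>) \<Longrightarrow>
     compatible (rename_cat \<iota> \<kappa> J) (rename_ftor \<iota> \<kappa> J D) \<Phi> act e"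
  unfolding compatible_def
  by (auto simp: hom_iff rename_sel rename_obj_eq)

end

context lfp_category
begin

lemma hom_small: "X \<in> Obj C \<Longrightarrow> Y \<in> Obj C \<Longrightarrow> small u (hom C X Y)"
  using lfp unfolding locally_finitely_presentable_def locally_small_def by blast

lemma colimit_exists:
  "small_cat u (J :: ('u, 'u) cat) \<Longrightarrow> is_functor J C D \<Longrightarrow> \<exists>Z c. colimit C J D Z c"
  using lfp unfolding locally_finitely_presentable_def cocomplete_def by blast

end

locale lfp_presheaf = lfp_category u C + continuous_presheaf u C \<Phi> act
  for u :: "'u itself" and C :: "('o, 'a) cat" (structure)
    and \<Phi> :: "'o \<Rightarrow> 'e set" and act :: "'a \<Rightarrow> 'e \<Rightarrow> 'e"
begin

definition element :: "'o \<times> 'e \<Rightarrow> bool" where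
  "element x \<longleftrightarrow> fst x \<in> Obj C \<and> snd x \<in> \<Phi> (fst x)"

lemma el_hom_Comp:
  assumes "f \<in> el_hom x y" "g \<in> el_hom y z" "element z"
  shows "g \<cdot> f \<in> el_hom x z"
  using assms act_Comp[of f g "snd z"] unfolding el_hom_def element_def
  by (auto simp: hom_iff)

lemma el_hom_Ident: "element x \<Longrightarrow> Ident C (fst x) \<in> el_hom x x"
  using act_Ident unfolding el_hom_def element_def by (auto simp: hom_iff)

text \<open>The universal property is required of the underlying diagram in C, against all cocones
  in C and not only against those formed by morphisms of elements.\<close>

definition el_colimit :: "('o \<times> 'e) set \<Rightarrow> 'o \<times> 'e \<Rightarrow> ('o \<times> 'e \<Rightarrow> 'a) \<Rightarrow> bool" where
  "el_colimit E q c \<longleftrightarrow>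
     element q \<and> (\<forall>x\<in>E. c x \<in> el_hom x q) \<and>
     (\<forall>x\<in>E. \<forall>y\<in>E. \<forall>f\<in>el_hom x y. c y \<cdot> f = c x) \<and>
     (\<forall>W\<in>Obj C. \<forall>w. (\<forall>x\<in>E. w x \<in> hom C (fst x) W) \<and>
        (\<forall>x\<in>E. \<forall>y\<in>E. \<forall>f\<in>el_hom x y. w y \<cdot> f = w x) \<longrightarrow>
        (\<exists>!h. h \<in> hom C (fst q) W \<and> (\<forall>x\<in>E. h \<cdot> c x = w x)))"

lemma el_colimitD:
  assumes "el_colimit E q c"
  shows "element q" "\<And>x. x \<in> E \<Longrightarrow> c x \<in> el_hom x q"
    "\<And>x y f. x \<in> E \<Longrightarrow> y \<in> E \<Longrightarrow> f \<in> el_hom x y \<Longrightarrow> c y \<cdot> f = c x"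
  using assms by (simp_all add: el_colimit_def)

text \<open>By continuity the projection from elements to C creates small colimits: the colimit is
  formed in C, and the second components of the diagram, a matching family, glue to an element over
  it for which the legs are morphisms of elements.\<close>

lemma el_colimit_exists:
  assumes E: "\<And>x. x \<in> E \<Longrightarrow> element x" and sm: "small u E"
  shows "\<exists>q c. el_colimit E q c"
proof -
  let ?J = "el_cat E"
  let ?D = "\<lparr>fo = fst, fa = \<lambda>(x, f, y). f\<rparr> :: ('o \<times> 'e, _, 'o, 'a) ftor"
  have J: "category ?J"
  proof
    show "\<And>X. X \<in> Obj ?J \<Longrightarrow> Ident ?J X \<in> hom ?J X X"
      using el_hom_Ident E by (auto simp: el_cat_def hom_iff)
    show "g \<cdot>\<^bsub>?J\<^esub> f \<in> hom ?J X Z" if "f \<in> hom ?J X Y" "g \<in> hom ?J Y Z" for f g X Y Z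
      using that el_hom_Comp E by (auto simp: el_cat_def hom_iff)
  qed (auto simp: el_cat_def hom_iff el_hom_def)
  interpret J: category ?J by (rule J)
  have D: "is_functor ?J C ?D"
    using E by unfold_locales (auto simp: el_cat_def hom_iff el_hom_def element_def)
  interpret D: is_functor ?J C ?D by (rule D)
  have objJ: "small u (Obj ?J)"
    using sm by (simp add: el_cat_def)
  have "Arr ?J \<subseteq> Sigma E (\<lambda>x. Sigma (\<Union>y\<in>E. hom C (fst x) (fst y)) (\<lambda>_. E))"
    by (auto simp: el_cat_def el_hom_def)
  moreover have "small u (\<Union>y\<in>E. hom C (fst x) (fst y))" if "x \<in> E" for x
  proof -
    have "small u (SIGMA y:E. hom C (fst x) (fst y))"
      using E that hom_small by (intro small_Sigma[OF universe sm]) (auto simp: element_def)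
    then have "small u (snd ` (SIGMA y:E. hom C (fst x) (fst y)))"
      by (rule small_image)
    moreover have "snd ` (SIGMA y:E. hom C (fst x) (fst y)) = (\<Union>y\<in>E. hom C (fst x) (fst y))"
      by force
    ultimately show ?thesis by simp
  qed
  ultimately have arrJ: "small u (Arr ?J)"
    using small_mono small_Sigma[OF universe] sm by (metis (no_types, lifting))
  obtain \<iota> :: "'o \<times> 'e \<Rightarrow> 'u" where \<iota>: "inj_on \<iota> (Obj ?J)"
    using small_code[OF objJ] by blast
  obtain \<kappa> :: "('o \<times> 'e) \<times> 'a \<times> ('o \<times> 'e) \<Rightarrow> 'u" where \<kappa>: "inj_on \<kappa> (Arr ?J)"
    using small_code[OF arrJ] by blast
  let ?J' = "rename_cat \<iota> \<kappa> ?J" and ?D' = "rename_ftor \<iota> \<kappa> ?J ?D"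
  note ren = D \<iota> \<kappa>
  have J': "small_cat u ?J'"
    by (rule rename_small[OF ren objJ arrJ])
  have D': "is_functor ?J' C ?D'"
    by (rule rename_functor[OF ren])
  obtain Z c where c: "colimit C ?J' ?D' Z c"
    using colimit_exists[OF J' D'] by blast
  have cc: "cocone C ?J ?D Z (c \<circ> \<iota>)"
    using c rename_cocone[OF ren] unfolding colimit_def by blast
  let ?inv = "inv_into (Obj ?J) \<iota>"
  have inv: "?inv (\<iota> x) = x" if "x \<in> E" for x
    using \<iota> that by (simp add: el_cat_def)
  have "compatible ?J ?D \<Phi> act ((snd \<circ> ?inv) \<circ> \<iota>)"
    using E inv unfolding compatible_def
    by (auto simp: el_cat_def hom_iff el_hom_def element_def)
  then have "compatible ?J' ?D' \<Phi> act (snd \<circ> ?inv)"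
    by (rule rename_compatible[OF ren])
  from glue[OF J' D' c this] obtain e
    where e: "e \<in> \<Phi> Z" "\<And>j. j \<in> Obj ?J' \<Longrightarrow> act (c j) e = snd (?inv j)"
    by auto
  have e': "act (c (\<iota> x)) e = snd x" if "x \<in> E" for x
  proof -
    have "\<iota> x \<in> Obj ?J'"
      unfolding rename_sel(1)[OF ren] using that by (simp add: el_cat_def)
    then show ?thesis
      using e(2)[of "\<iota> x"] inv[OF that] by simp
  qed
  have c_hom: "c (\<iota> x) \<in> hom C (fst x) Z" if "x \<in> E" for x
    using cc that unfolding cocone_def by (auto simp: el_cat_def)
  have "el_colimit E (Z, e) (c \<circ> \<iota>)"
    unfolding el_colimit_def
  proof (intro conjI ballI allI impI; (elim conjE)?)
    show "element (Z, e)"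
      using cc e(1) unfolding cocone_def element_def by simp
    show "(c \<circ> \<iota>) x \<in> el_hom x (Z, e)" if "x \<in> E" for x
      using c_hom[OF that] e'[OF that] by (simp add: el_hom_def)
    show "(c \<circ> \<iota>) y \<cdot> f = (c \<circ> \<iota>) x" if "x \<in> E" "y \<in> E" "f \<in> el_hom x y" for x y f
      using cc that unfolding cocone_def
      by (cases x; cases y) (auto simp: el_cat_def hom_iff)
    fix W w
    assume W: "W \<in> Obj C" and w: "\<forall>x\<in>E. w x \<in> hom C (fst x) W"
      and wf: "\<forall>x\<in>E. \<forall>y\<in>E. \<forall>f\<in>el_hom x y. w y \<cdot> f = w x"
    have "cocone C ?J ?D W ((w \<circ> ?inv) \<circ> \<iota>)"
      using W w wf inv unfolding cocone_def by (auto simp: el_cat_def hom_iff)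
    then have "cocone C ?J' ?D' W (w \<circ> ?inv)"
      using rename_cocone[OF ren] by blast
    then have "\<exists>!h. h \<in> hom C Z W \<and> (\<forall>j \<in> Obj ?J'. h \<cdot> c j = (w \<circ> ?inv) j)"
      using c unfolding colimit_def by blast
    moreover have "Obj ?J' = \<iota> ` E"
      unfolding rename_sel(1)[OF ren] by (simp add: el_cat_def)
    ultimately show "\<exists>!h. h \<in> hom C (fst (Z, e)) W \<and> (\<forall>x\<in>E. h \<cdot> (c \<circ> \<iota>) x = w x)"
      using inv by simp
  qed
  then show ?thesis by blast
qed

text \<open>A solution set condition: all elements over the small set of generators have a colimit
  \<open>q\<close>. An arbitrary element is glued from its restrictions along a presentation of its
  object by generators; these restrictions map to \<open>q\<close>, and the induced arrow respects
  elements because amalgamations are unique.\<close>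

lemma weakly_terminal:
  obtains q where "element q" "\<And>x. element x \<Longrightarrow> \<exists>h. h \<in> el_hom x q"
proof -
  obtain G where G: "G \<subseteq> Obj C" "small u G"
    and dense: "\<And>X. X \<in> Obj C \<Longrightarrow> \<exists>(J :: ('u, 'u) cat) D c.
           small_cat u J \<and> filtered J \<and> is_functor J C D \<and>
           (\<forall>j \<in> Obj J. fo D j \<in> G) \<and> colimit C J D X c"
    using lfp unfolding locally_finitely_presentable_def by blast
  let ?E = "Sigma G \<Phi>"
  have "\<And>x. x \<in> ?E \<Longrightarrow> element x"
    using G by (auto simp: element_def)
  moreover have "small u ?E"
    using G small_values by (intro small_Sigma[OF universe]) auto
  ultimately obtain q c where qc: "el_colimit ?E q c"
    using el_colimit_exists[of ?E] by blast
  note q = el_colimitD(1,2)[OF qc] and cf = el_colimitD(3)[OF qc]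
  show thesis
  proof (rule that[OF q(1)])
    fix x assume x: "element x"
    then have "fst x \<in> Obj C" by (simp add: element_def)
    from dense[OF this] obtain J :: "('u, 'u) cat" and D b
      where J: "small_cat u J" and D: "is_functor J C D"
        and DG: "\<And>j. j \<in> Obj J \<Longrightarrow> fo D j \<in> G" and b: "colimit C J D (fst x) b"
      by blast
    interpret D: is_functor J C D by (rule D)
    \<comment> \<open>The restriction of \<open>x\<close> along the leg \<open>b j\<close>. It lies
      over a generator, hence in the diagram whose colimit is \<open>q\<close>.\<close>
    define el where "el j = (fo D j, act (b j) (snd x))" for j
    have b_hom: "b j \<in> hom C (fo D j) (fst x)" if "j \<in> Obj J" for j
      using b that unfolding colimit_def cocone_def by blast
    have b_nat: "b j \<cdot> fa D f = b i" if "f \<in> hom J i j" for i j f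
      using b that unfolding colimit_def cocone_def by blast
    have el: "el j \<in> ?E" if "j \<in> Obj J" for j
      using b_hom[OF that] DG[OF that] act_in[of "b j" "snd x"] x
      by (auto simp: el_def element_def hom_iff)
    have Df: "fa D f \<in> el_hom (el i) (el j)" if f: "f \<in> hom J i j" for i j f
    proof -
      have ij: "i \<in> Obj J" "j \<in> Obj J" "f \<in> Arr J"
        using f by (auto simp: hom_iff)
      have "act (fa D f) (act (b j) (snd x)) = act (b j \<cdot> fa D f) (snd x)"
        using act_Comp[of "fa D f" "b j" "snd x"] b_hom[of j] f x ij
        by (auto simp: hom_iff element_def)
      then show ?thesis
        using D.fa_hom[OF f] b_nat[OF f] by (simp add: el_hom_def el_def)
    qed
    have cj: "c (el j) \<in> hom C (fo D j) (fst q)" "act (c (el j)) (snd q) = act (b j) (snd x)"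
      if "j \<in> Obj J" for j
      using q(2)[OF el[OF that]] by (auto simp: el_hom_def el_def)
    have cc: "cocone C J D (fst q) (c \<circ> el)"
      unfolding cocone_def
    proof (intro conjI ballI allI impI)
      show "fst q \<in> Obj C" using q(1) by (simp add: element_def)
      show "(c \<circ> el) j \<in> hom C (fo D j) (fst q)" if "j \<in> Obj J" for j
        using cj(1)[OF that] by simp
      show "(c \<circ> el) j \<cdot> fa D f = (c \<circ> el) i" if f: "f \<in> hom J i j" for i j f
      proof -
        have "i \<in> Obj J" "j \<in> Obj J"
          using f by (auto simp: hom_iff)
        then show ?thesis
          using cf[OF el el Df[OF f]] by simp
      qed
    qed
    then obtain h where h: "h \<in> hom C (fst x) (fst q)" "\<And>j. j \<in> Obj J \<Longrightarrow> h \<cdot> b j = c (el j)"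
      using b unfolding colimit_def by (metis comp_apply)
    have "compatible J D \<Phi> act (\<lambda>j. act (b j) (snd x))"
      unfolding compatible_def
      using el Df by (auto simp: el_def el_hom_def)
    from glue[OF J D b this]
    have uniq: "\<exists>!y. y \<in> \<Phi> (fst x) \<and> (\<forall>j\<in>Obj J. act (b j) y = act (b j) (snd x))" .
    have "act h (snd q) \<in> \<Phi> (fst x)"
      using act_in[of h "snd q"] h(1) q(1) by (auto simp: hom_iff element_def)
    moreover have "act (b j) (act h (snd q)) = act (b j) (snd x)" if "j \<in> Obj J" for j
      using act_Comp[of "b j" h "snd q"] h(1) b_hom[OF that] h(2)[OF that] cj(2)[OF that] q(1)
      by (auto simp: hom_iff element_def)
    moreover have "snd x \<in> \<Phi> (fst x)"
      using x by (simp add: element_def)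
    ultimately have "act h (snd q) = snd x"
      using uniq by blast
    then show "\<exists>h. h \<in> el_hom x q"
      using h(1) by (auto simp: el_hom_def)
  qed
qed

text \<open>Freyd's argument: the joint coequalizer of all endomorphisms of a weakly terminal
  element is terminal.\<close>

theorem representable:
  obtains W w where "W \<in> Obj C" "w \<in> \<Phi> W"
    "\<And>Z e. Z \<in> Obj C \<Longrightarrow> e \<in> \<Phi> Z \<Longrightarrow> \<exists>!h. h \<in> hom C Z W \<and> act h w = e"
proof -
  obtain p where p: "element p" "\<And>x. element x \<Longrightarrow> \<exists>h. h \<in> el_hom x p"
    using weakly_terminal by blast
  \<comment> \<open>The full subcategory on the single element \<open>p\<close> has exactly the
    endomorphisms of \<open>p\<close> as arrows, so its colimit is their joint coequalizer.\<close>
  have "\<And>x. x \<in> {p} \<Longrightarrow> element x" "small u {p}"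
    using p by (auto simp: small_finite[OF universe])
  from el_colimit_exists[OF this] obtain q c where qc: "el_colimit {p} q c"
    by blast
  have q: "element q" "c p \<in> el_hom p q"
    and c_endo: "\<And>f. f \<in> el_hom p p \<Longrightarrow> c p \<cdot> f = c p"
    using el_colimitD[OF qc] by simp_all
  have c_univ: "\<exists>!h. h \<in> hom C (fst q) W \<and> h \<cdot> c p = k"
    if "W \<in> Obj C" "k \<in> hom C (fst p) W" "\<forall>f \<in> el_hom p p. k \<cdot> f = k" for W k
  proof -
    have "\<exists>!h. h \<in> hom C (fst q) W \<and> (\<forall>x\<in>{p}. h \<cdot> c x = (\<lambda>_. k) x)"
      using qc that unfolding el_colimit_def
      by (elim conjE) (drule bspec[of _ _ W], assumption, drule spec[of _ "\<lambda>_. k"], simp)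
    then show ?thesis by simp
  qed
  have c_arr: "c p \<in> Arr C" "Dom C (c p) = fst p" "Cod C (c p) = fst q"
    using q(2) by (auto simp: el_hom_def hom_iff)
  \<comment> \<open>A coequalizing arrow is epi; this is the instance that cancels it against an
    identity.\<close>
  have c_epi: "h = Ident C (fst q)" if h: "h \<in> hom C (fst q) (fst q)" "h \<cdot> c p = c p" for h
  proof -
    have "\<exists>!h. h \<in> hom C (fst q) (fst q) \<and> h \<cdot> c p = c p"
      using q c_endo c_univ[of "fst q" "c p"] by (simp add: element_def el_hom_def)
    moreover have "Ident C (fst q) \<in> hom C (fst q) (fst q)" "Ident C (fst q) \<cdot> c p = c p"
      using q c_arr by (auto simp: element_def hom_iff)
    ultimately show ?thesis using h by blast
  qed
  show thesis
  proof (rule that[of "fst q" "snd q"])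
    show "fst q \<in> Obj C" "snd q \<in> \<Phi> (fst q)"
      using q(1) by (auto simp: element_def)
    fix Z e assume "Z \<in> Obj C" "e \<in> \<Phi> Z"
    then have z: "element (Z, e)" by (simp add: element_def)
    then obtain k where "k \<in> el_hom (Z, e) p"
      using p(2) by blast
    then have "c p \<cdot> k \<in> el_hom (Z, e) q"
      using el_hom_Comp q by blast
    moreover have "v = v'" if v: "v \<in> el_hom (Z, e) q" and v': "v' \<in> el_hom (Z, e) q" for v v'
    proof -
      \<comment> \<open>The full subcategory on these two elements contains every morphism between
        them, so the leg \<open>b q\<close> coequalizes \<open>v\<close> and
        \<open>v'\<close>.\<close>
      have "\<And>x. x \<in> {(Z, e), q} \<Longrightarrow> element x" "small u {(Z, e), q}"
        using q z by (auto simp: small_finite[OF universe])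
      from el_colimit_exists[OF this] obtain r b where rb: "el_colimit {(Z, e), q} r b"
        by blast
      have r: "element r" "b q \<in> el_hom q r"
        and b: "\<And>f. f \<in> el_hom (Z, e) q \<Longrightarrow> b q \<cdot> f = b (Z, e)"
        using el_colimitD[OF rb] by simp_all
      obtain s where s: "s \<in> el_hom r p"
        using p(2) r(1) by blast
      have arrs: "b q \<in> hom C (fst q) (fst r)" "s \<in> hom C (fst r) (fst p)"
        "v \<in> hom C Z (fst q)" "v' \<in> hom C Z (fst q)"
        using r s v v' by (auto simp: el_hom_def)
      \<comment> \<open>This composite is an endomorphism of \<open>p\<close>, hence absorbed by
        \<open>c p\<close>. Cancelling the epi \<open>c p\<close> makes \<open>b q\<close> a split
        mono, and then \<open>v = v'\<close>.\<close>
      have "s \<cdot> (b q \<cdot> c p) \<in> el_hom p p"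
        using el_hom_Comp q r s p(1) by blast
      then have "(c p \<cdot> (s \<cdot> b q)) \<cdot> c p = c p"
        using c_endo arrs c_arr by (simp add: hom_iff)
      then have id: "c p \<cdot> (s \<cdot> b q) = Ident C (fst q)"
        using arrs c_arr by (intro c_epi) (auto simp: hom_iff)
      have "v = (c p \<cdot> (s \<cdot> b q)) \<cdot> v"
        using id arrs by (simp add: hom_iff)
      also have "\<dots> = c p \<cdot> (s \<cdot> (b q \<cdot> v))"
        using arrs c_arr by (simp add: hom_iff)
      also have "\<dots> = c p \<cdot> (s \<cdot> (b q \<cdot> v'))"
        using b[OF v] b[OF v'] by simp
      also have "\<dots> = (c p \<cdot> (s \<cdot> b q)) \<cdot> v'"
        using arrs c_arr by (simp add: hom_iff)
      also have "\<dots> = v'"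
        using id arrs by (simp add: hom_iff)
      finally show ?thesis .
    qed
    ultimately show "\<exists>!h. h \<in> hom C Z (fst q) \<and> act h (snd q) = e"
      unfolding el_hom_def by auto
  qed
qed

end


section \<open>The endomorphism monad of an arrow\<close>

text \<open>The monad below represents the natural endo-operations of an arrow \<open>f : D True \<rightarrow> D False\<close>:
  arrows \<open>Z \<rightarrow> codensity_ob X\<close> are pairs of maps \<open>hom X (D i) \<rightarrow> hom Z (D i)\<close> compatible with
  composition with \<open>f\<close>.  Monad morphisms from \<open>M\<close> into it are pairs of \<open>M\<close>-algebra structures
  on \<open>D True\<close> and \<open>D False\<close> for which \<open>f\<close> is a homomorphism.\<close>

locale codensity = lfp_category u C
  for u :: "'u itself" and C :: "('o, 'a) cat" (structure) +
  fixes D :: "bool \<Rightarrow> 'o" and f :: 'a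
  assumes f_hom: "f \<in> hom C (D True) (D False)"
begin

lemma f_arr [simp]: "f \<in> Arr C" "Dom C f = D True" "Cod C f = D False"
  using f_hom by (auto simp: hom_iff)

lemma D_obj [simp]: "D i \<in> Obj C"
  using Dom_in[of f] Cod_in[of f] by (cases i) auto

definition probe :: "'o \<Rightarrow> (bool \<times> 'a) set" where
  "probe X = (SIGMA i:UNIV. hom C X (D i))"

text \<open>Families are extensional outside \<open>probe X\<close>, so that families with the same
  values are equal, as uniqueness of amalgamations demands. Over a diagram consisting of one arrow
  \<open>f\<close> there is a single naturality condition to impose.\<close>

definition ops :: "'o \<Rightarrow> 'o \<Rightarrow> (bool \<times> 'a \<Rightarrow> 'a) set" where
  "ops X Z = {p \<in> PiE (probe X) (\<lambda>x. hom C Z (D (fst x))).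
     \<forall>l \<in> hom C X (D True). p (False, f \<cdot> l) = f \<cdot> p (True, l)}"

definition ops_act :: "'o \<Rightarrow> 'a \<Rightarrow> (bool \<times> 'a \<Rightarrow> 'a) \<Rightarrow> (bool \<times> 'a \<Rightarrow> 'a)" where
  "ops_act X k p = (\<lambda>x \<in> probe X. p x \<cdot> k)"

lemma opsD:
  assumes "p \<in> ops X Z" "l \<in> Arr C" "Dom C l = X" "Cod C l = D i"
  shows "p (i, l) \<in> Arr C" "Dom C (p (i, l)) = Z" "Cod C (p (i, l)) = D i"
proof -
  have "(i, l) \<in> probe X"
    using assms by (auto simp: probe_def hom_iff)
  then have "p (i, l) \<in> hom C Z (D i)"
    using assms(1) by (auto simp: ops_def dest: PiE_mem)
  then show "p (i, l) \<in> Arr C" "Dom C (p (i, l)) = Z" "Cod C (p (i, l)) = D i"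
    by (auto simp: hom_iff)
qed

lemma ops_f:
  assumes "p \<in> ops X Z" "l \<in> Arr C" "Dom C l = X" "Cod C l = D True"
  shows "p (False, f \<cdot> l) = f \<cdot> p (True, l)"
  using assms by (auto simp: ops_def hom_iff)

lemma ops_eqI:
  assumes "p \<in> ops X Z" "q \<in> ops X Z'"
    and "\<And>i l. l \<in> Arr C \<Longrightarrow> Dom C l = X \<Longrightarrow> Cod C l = D i \<Longrightarrow> p (i, l) = q (i, l)"
  shows "p = q"
proof (rule PiE_ext)
  show "p \<in> PiE (probe X) (\<lambda>_. UNIV)" "q \<in> PiE (probe X) (\<lambda>_. UNIV)"
    using assms(1,2) by (auto simp: ops_def PiE_def)
qed (use assms(3) in \<open>auto simp: probe_def hom_iff\<close>)

lemma opsI: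
  assumes "\<And>i l. l \<in> Arr C \<Longrightarrow> Dom C l = X \<Longrightarrow> Cod C l = D i \<Longrightarrow> p i l \<in> hom C Z (D i)"
    and "\<And>l. l \<in> Arr C \<Longrightarrow> Dom C l = X \<Longrightarrow> Cod C l = D True \<Longrightarrow>
           p False (f \<cdot> l) = f \<cdot> p True l"
  shows "(\<lambda>(i, l) \<in> probe X. p i l) \<in> ops X Z"
  using assms by (auto simp: ops_def probe_def hom_iff)

lemma ops_act_apply:
  "l \<in> Arr C \<Longrightarrow> Dom C l = X \<Longrightarrow> Cod C l = D i \<Longrightarrow> ops_act X k p (i, l) = p (i, l) \<cdot> k"
  by (auto simp: ops_act_def probe_def hom_iff)

lemma ops_act_in:
  assumes "k \<in> Arr C" "p \<in> ops X (Cod C k)"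
  shows "ops_act X k p \<in> ops X (Dom C k)"
proof -
  have "(\<lambda>(i, l) \<in> probe X. p (i, l) \<cdot> k) \<in> ops X (Dom C k)"
    using assms opsD[OF assms(2)] ops_f[OF assms(2)] by (intro opsI) (auto simp: hom_iff)
  moreover have "(\<lambda>(i, l) \<in> probe X. p (i, l) \<cdot> k) = ops_act X k p"
    by (auto simp: ops_act_def restrict_def)
  ultimately show ?thesis by simp
qed

lemma ops_small:
  assumes "X \<in> Obj C" "Z \<in> Obj C"
  shows "small u (ops X Z)"
proof (rule small_mono)
  show "ops X Z \<subseteq> probe X \<rightarrow>\<^sub>E (\<Union>i. hom C Z (D i))"
    by (auto simp: ops_def PiE_def Pi_def)
  have "small u (SIGMA i:UNIV. hom C Z (D i))"
    if "Z \<in> Obj C" for Z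
    using that hom_small by (intro small_Sigma[OF universe]) (auto simp: small_finite[OF universe])
  moreover from this have "small u (snd ` (SIGMA i:UNIV. hom C Z (D i)))"
    using assms small_image by blast
  moreover have "snd ` (SIGMA i:UNIV. hom C Z (D i)) = (\<Union>i. hom C Z (D i))"
    by force
  ultimately show "small u (probe X \<rightarrow>\<^sub>E (\<Union>i. hom C Z (D i)))"
    using assms unfolding probe_def by (intro small_PiE[OF universe]) auto
qed

text \<open>Each coordinate is a representable presheaf \<open>hom C _ (D i)\<close>, which turns
  colimits into limits. The condition involving \<open>f\<close> passes to the amalgamation because
  arrows out of a colimit are determined on its legs.\<close>

lemma ops_presheaf:
  assumes "X \<in> Obj C"
  shows "continuous_presheaf u C (ops X) (ops_act X)"
proof
  show "ops_act X k p \<in> ops X (Dom C k)" if "k \<in> Arr C" "p \<in> ops X (Cod C k)" for k p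
    using ops_act_in that by blast
  show "ops_act X (Ident C Z) p = p" if "Z \<in> Obj C" "p \<in> ops X Z" for Z p
    using that ops_act_in[of "Ident C Z" p X]
    by (intro ops_eqI[of _ X Z _ Z]) (auto simp: ops_act_apply opsD)
  show "ops_act X (k' \<cdot> k) p = ops_act X k (ops_act X k' p)"
    if "k \<in> Arr C" "k' \<in> Arr C" "Dom C k' = Cod C k" "p \<in> ops X (Cod C k')" for k k' p
    using that ops_act_in[of "k' \<cdot> k" p X] ops_act_in[of k' p X] ops_act_in[of k "ops_act X k' p" X]
    by (intro ops_eqI[of _ X "Dom C k" _ "Dom C k"]) (auto simp: ops_act_apply opsD)
  show "small u (ops X Z)" if "Z \<in> Obj C" for Z
    using assms that ops_small by blast
next
  fix J :: "('u, 'u) cat" and Dg Z c e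
  assume J: "small_cat u J" and Dg: "is_functor J C Dg" and c: "colimit C J Dg Z c"
    and e: "compatible J Dg (ops X) (ops_act X) e"
  interpret Dg: is_functor J C Dg by (rule Dg)
  have e_ops: "e j \<in> ops X (fo Dg j)" if "j \<in> Obj J" for j
    using e that unfolding compatible_def by blast
  have c_hom: "c j \<in> Arr C" "Dom C (c j) = fo Dg j" "Cod C (c j) = Z" if "j \<in> Obj J" for j
    using c that unfolding colimit_def cocone_def by (auto simp: hom_iff)
  have ex1: "\<exists>!h. h \<in> hom C Z (D i) \<and> (\<forall>j \<in> Obj J. h \<cdot> c j = e j (i, l))"
    if l: "l \<in> Arr C" "Dom C l = X" "Cod C l = D i" for i l
  proof -
    have "cocone C J Dg (D i) (\<lambda>j. e j (i, l))"
      unfolding cocone_def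
    proof (intro conjI ballI allI impI)
      show "e j (i, l) \<in> hom C (fo Dg j) (D i)" if "j \<in> Obj J" for j
        using opsD[OF e_ops[OF that] l] by (simp add: hom_iff)
      show "e j (i, l) \<cdot> fa Dg g = e j' (i, l)" if "g \<in> hom J j' j" for g j j'
      proof -
        have "ops_act X (fa Dg g) (e j) = e j'"
          using e that unfolding compatible_def by blast
        then show ?thesis using ops_act_apply[OF l] by metis
      qed
    qed auto
    then show ?thesis
      using c unfolding colimit_def by blast
  qed
  define p where "p i l = (THE h. h \<in> hom C Z (D i) \<and> (\<forall>j \<in> Obj J. h \<cdot> c j = e j (i, l)))" for i l
  have p: "p i l \<in> hom C Z (D i)" "\<And>j. j \<in> Obj J \<Longrightarrow> p i l \<cdot> c j = e j (i, l)"
    if l: "l \<in> Arr C" "Dom C l = X" "Cod C l = D i" for i l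
    using theI'[OF ex1[OF l]] unfolding p_def by auto
  have p_ops: "(\<lambda>(i, l) \<in> probe X. p i l) \<in> ops X Z"
  proof (rule opsI)
    fix l assume l: "l \<in> Arr C" "Dom C l = X" "Cod C l = D True"
    then have fl: "f \<cdot> l \<in> Arr C" "Dom C (f \<cdot> l) = X" "Cod C (f \<cdot> l) = D False"
      by auto
    have "f \<cdot> p True l \<in> hom C Z (D False)"
      using p(1)[OF l] by (auto simp: hom_iff)
    moreover have "(f \<cdot> p True l) \<cdot> c j = e j (False, f \<cdot> l)" if "j \<in> Obj J" for j
      using p[OF l] that c_hom[OF that] ops_f[OF e_ops[OF that] l] by (simp add: hom_iff)
    ultimately show "p False (f \<cdot> l) = f \<cdot> p True l"
      using ex1[OF fl] p[OF fl] by blast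
  qed (rule p(1))
  show "\<exists>!x. x \<in> ops X Z \<and> (\<forall>j\<in>Obj J. ops_act X (c j) x = e j)"
  proof (intro ex1I conjI ballI)
    show "(\<lambda>(i, l) \<in> probe X. p i l) \<in> ops X Z" by (rule p_ops)
    show "ops_act X (c j) (\<lambda>(i, l) \<in> probe X. p i l) = e j" if "j \<in> Obj J" for j
    proof (rule ops_eqI)
      show "ops_act X (c j) (\<lambda>(i, l) \<in> probe X. p i l) \<in> ops X (fo Dg j)"
        using ops_act_in[of "c j" _ X] p_ops c_hom[OF that] by simp
    qed (use that p e_ops in \<open>auto simp: ops_act_def probe_def hom_iff\<close>)
  next
    fix x assume x: "x \<in> ops X Z \<and> (\<forall>j\<in>Obj J. ops_act X (c j) x = e j)"
    show "x = (\<lambda>(i, l) \<in> probe X. p i l)"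
    proof (rule ops_eqI)
      fix i l assume l: "l \<in> Arr C" "Dom C l = X" "Cod C l = D i"
      have "x (i, l) \<in> hom C Z (D i)"
        using opsD[of x X Z l i] l x by (simp add: hom_iff)
      moreover have "x (i, l) \<cdot> c j = e j (i, l)" if "j \<in> Obj J" for j
        using x that ops_act_apply[OF l, of "c j" x] by auto
      ultimately have "x (i, l) = p i l"
        using ex1[OF l] p[OF l] by blast
      then show "x (i, l) = (\<lambda>(i, l) \<in> probe X. p i l) (i, l)"
        using l by (simp add: probe_def hom_iff)
    qed (use x p_ops in auto)
  qed
qed

definition ops_universal :: "'o \<Rightarrow> 'o \<Rightarrow> (bool \<times> 'a \<Rightarrow> 'a) \<Rightarrow> bool" where
  "ops_universal X W w \<longleftrightarrow> W \<in> Obj C \<and> w \<in> ops X W \<and>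
     (\<forall>Z \<in> Obj C. \<forall>e \<in> ops X Z. \<exists>!h. h \<in> hom C Z W \<and> ops_act X h w = e)"

definition codensity_ob :: "'o \<Rightarrow> 'o" where
  "codensity_ob X = fst (SOME x. ops_universal X (fst x) (snd x))"

text \<open>The coordinates of the universal element, from the same choice as
  \<open>codensity_ob\<close>. They are the projections of \<open>codensity_ob X\<close>, seen as a
  limit of copies of \<open>D i\<close> indexed by the arrows from \<open>X\<close> to
  \<open>D i\<close>.\<close>

definition eval_at :: "'o \<Rightarrow> bool \<Rightarrow> 'a \<Rightarrow> 'a" where
  "eval_at X i l = snd (SOME x. ops_universal X (fst x) (snd x)) (i, l)"

lemma ops_universal:
  assumes "X \<in> Obj C"
  shows "ops_universal X (codensity_ob X) (\<lambda>(i, l). eval_at X i l)"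
proof -
  interpret presh: continuous_presheaf u C "ops X" "ops_act X"
    by (rule ops_presheaf[OF assms])
  interpret lfp_presheaf u C "ops X" "ops_act X"
    by unfold_locales
  obtain W w where "W \<in> Obj C" "w \<in> ops X W"
    "\<And>Z e. Z \<in> Obj C \<Longrightarrow> e \<in> ops X Z \<Longrightarrow> \<exists>!h. h \<in> hom C Z W \<and> ops_act X h w = e"
    using representable by blast
  then have "ops_universal X (fst (W, w)) (snd (W, w))"
    by (simp add: ops_universal_def)
  from someI[of "\<lambda>x. ops_universal X (fst x) (snd x)", OF this]
  show ?thesis
    by (simp add: codensity_ob_def eval_at_def)
qed

lemma codensity_ob_in [simp]: "X \<in> Obj C \<Longrightarrow> codensity_ob X \<in> Obj C"
  using ops_universal unfolding ops_universal_def by blast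

lemma eval_at_arr [simp]:
  assumes "l \<in> Arr C" "Dom C l = X" "Cod C l = D i"
  shows "eval_at X i l \<in> Arr C" "Dom C (eval_at X i l) = codensity_ob X"
    "Cod C (eval_at X i l) = D i"
proof -
  have "(\<lambda>(i, l). eval_at X i l) \<in> ops X (codensity_ob X)"
    using ops_universal[of X] Dom_in[of l] assms unfolding ops_universal_def by auto
  from opsD[OF this assms] show "eval_at X i l \<in> Arr C"
    "Dom C (eval_at X i l) = codensity_ob X" "Cod C (eval_at X i l) = D i"
    by auto
qed

lemma eval_at_f:
  assumes "l \<in> Arr C" "Dom C l = X" "Cod C l = D True"
  shows "eval_at X False (f \<cdot> l) = f \<cdot> eval_at X True l"
proof -
  have "(\<lambda>(i, l). eval_at X i l) \<in> ops X (codensity_ob X)"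
    using ops_universal[of X] Dom_in[of l] assms unfolding ops_universal_def by auto
  from ops_f[OF this assms] show ?thesis by simp
qed

lemma lift_ex1:
  assumes X: "X \<in> Obj C" and Z: "Z \<in> Obj C"
    and "\<And>i l. l \<in> Arr C \<Longrightarrow> Dom C l = X \<Longrightarrow> Cod C l = D i \<Longrightarrow> p i l \<in> hom C Z (D i)"
    and "\<And>l. l \<in> Arr C \<Longrightarrow> Dom C l = X \<Longrightarrow> Cod C l = D True \<Longrightarrow>
           p False (f \<cdot> l) = f \<cdot> p True l"
  shows "\<exists>!h. h \<in> hom C Z (codensity_ob X) \<and>
           (\<forall>i. \<forall>l \<in> hom C X (D i). eval_at X i l \<cdot> h = p i l)"
proof -
  let ?e = "\<lambda>(i, l). eval_at X i l" and ?p = "\<lambda>(i, l) \<in> probe X. p i l"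
  have p: "?p \<in> ops X Z"
    by (rule opsI) (use assms in auto)
  have e: "?e \<in> ops X (codensity_ob X)"
    using ops_universal[OF X] unfolding ops_universal_def by blast
  have "\<exists>!h. h \<in> hom C Z (codensity_ob X) \<and> ops_act X h ?e = ?p"
    using ops_universal[OF X] p Z unfolding ops_universal_def by blast
  moreover have "ops_act X h ?e = ?p \<longleftrightarrow> (\<forall>i. \<forall>l \<in> hom C X (D i). eval_at X i l \<cdot> h = p i l)"
    for h
    unfolding ops_act_def probe_def by (auto simp: fun_eq_iff restrict_def)
  ultimately show ?thesis by simp
qed

definition lift :: "'o \<Rightarrow> 'o \<Rightarrow> (bool \<Rightarrow> 'a \<Rightarrow> 'a) \<Rightarrow> 'a" where
  "lift X Z p = (THE h. h \<in> hom C Z (codensity_ob X) \<and>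
           (\<forall>i. \<forall>l \<in> hom C X (D i). eval_at X i l \<cdot> h = p i l))"

lemma lift:
  assumes "X \<in> Obj C" "Z \<in> Obj C"
    and "\<And>i l. l \<in> Arr C \<Longrightarrow> Dom C l = X \<Longrightarrow> Cod C l = D i \<Longrightarrow> p i l \<in> hom C Z (D i)"
    and "\<And>l. l \<in> Arr C \<Longrightarrow> Dom C l = X \<Longrightarrow> Cod C l = D True \<Longrightarrow>
           p False (f \<cdot> l) = f \<cdot> p True l"
  shows "lift X Z p \<in> Arr C" "Dom C (lift X Z p) = Z" "Cod C (lift X Z p) = codensity_ob X"
    "\<And>i l. l \<in> Arr C \<Longrightarrow> Dom C l = X \<Longrightarrow> Cod C l = D i \<Longrightarrow> eval_at X i l \<cdot> lift X Z p = p i l"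
  using theI'[OF lift_ex1[of X Z p]] assms unfolding lift_def by (auto simp: hom_iff)

text \<open>Uniqueness in \<open>lift_ex1\<close>, applied to the family of projections of one of
  the two arrows. Equations between arrows into \<open>codensity_ob X\<close> are all checked this
  way.\<close>

lemma codensity_eqI:
  assumes "X \<in> Obj C" "h \<in> Arr C" "h' \<in> Arr C" "Dom C h = Dom C h'"
    and "Cod C h = codensity_ob X" "Cod C h' = codensity_ob X"
    and eq: "\<And>i l. l \<in> Arr C \<Longrightarrow> Dom C l = X \<Longrightarrow> Cod C l = D i \<Longrightarrow>
           eval_at X i l \<cdot> h = eval_at X i l \<cdot> h'"
  shows "h = h'"
proof -
  have "\<exists>!k. k \<in> hom C (Dom C h) (codensity_ob X) \<and>
           (\<forall>i. \<forall>l \<in> hom C X (D i). eval_at X i l \<cdot> k = eval_at X i l \<cdot> h)"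
    using assms by (intro lift_ex1) (auto simp: hom_iff eval_at_f)
  moreover have "\<forall>i. \<forall>l \<in> hom C X (D i). eval_at X i l \<cdot> h' = eval_at X i l \<cdot> h"
    using eq by (simp add: hom_iff)
  ultimately show ?thesis
    using assms(2-6) by (auto simp: hom_iff)
qed

text \<open>The pattern of a continuation monad: an arrow acts by precomposition on probes, the unit
  returns the probe itself, and the multiplication uses that \<open>eval_at X i l\<close> is again a
  probe, this time of \<open>codensity_ob X\<close>.\<close>

definition codensity_monad :: "('o, 'a) monad" where
  "codensity_monad =
     \<lparr>fo = codensity_ob,
      fa = \<lambda>k. lift (Cod C k) (codensity_ob (Dom C k)) (\<lambda>i l. eval_at (Dom C k) i (l \<cdot> k)),
      unit = \<lambda>X. lift X X (\<lambda>i l. l),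
      mult = \<lambda>X. lift X (codensity_ob (codensity_ob X))
                   (\<lambda>i l. eval_at (codensity_ob X) i (eval_at X i l))\<rparr>"

abbreviation "N \<equiv> codensity_monad"

lemma N_fo [simp]: "fo N = codensity_ob"
  by (simp add: codensity_monad_def)

lemma N_fa:
  assumes "k \<in> Arr C"
  shows "fa N k \<in> Arr C" "Dom C (fa N k) = codensity_ob (Dom C k)"
    "Cod C (fa N k) = codensity_ob (Cod C k)"
    "\<And>i l. l \<in> Arr C \<Longrightarrow> Dom C l = Cod C k \<Longrightarrow> Cod C l = D i \<Longrightarrow>
       eval_at (Cod C k) i l \<cdot> fa N k = eval_at (Dom C k) i (l \<cdot> k)"
proof -
  have eq: "fa N k =
      lift (Cod C k) (codensity_ob (Dom C k)) (\<lambda>i l. eval_at (Dom C k) i (l \<cdot> k))"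
    by (simp add: codensity_monad_def)
  note L = lift[of "Cod C k" "codensity_ob (Dom C k)" "\<lambda>i l. eval_at (Dom C k) i (l \<cdot> k)"]
  show "fa N k \<in> Arr C" "Dom C (fa N k) = codensity_ob (Dom C k)"
    "Cod C (fa N k) = codensity_ob (Cod C k)"
    unfolding eq using assms by (intro L; auto simp: hom_iff eval_at_f)+
  show "\<And>i l. l \<in> Arr C \<Longrightarrow> Dom C l = Cod C k \<Longrightarrow> Cod C l = D i \<Longrightarrow>
       eval_at (Cod C k) i l \<cdot> fa N k = eval_at (Dom C k) i (l \<cdot> k)"
    unfolding eq using assms by (intro L; auto simp: hom_iff eval_at_f)+
qed

lemma N_unit:
  assumes "X \<in> Obj C"
  shows "unit N X \<in> Arr C" "Dom C (unit N X) = X" "Cod C (unit N X) = codensity_ob X"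
    "\<And>i l. l \<in> Arr C \<Longrightarrow> Dom C l = X \<Longrightarrow> Cod C l = D i \<Longrightarrow> eval_at X i l \<cdot> unit N X = l"
proof -
  have eq: "unit N X = lift X X (\<lambda>i l. l)"
    by (simp add: codensity_monad_def)
  note L = lift[of X X "\<lambda>i l. l"]
  show "unit N X \<in> Arr C" "Dom C (unit N X) = X" "Cod C (unit N X) = codensity_ob X"
    unfolding eq using assms by (intro L; auto simp: hom_iff)+
  show "\<And>i l. l \<in> Arr C \<Longrightarrow> Dom C l = X \<Longrightarrow> Cod C l = D i \<Longrightarrow> eval_at X i l \<cdot> unit N X = l"
    unfolding eq using assms by (intro L; auto simp: hom_iff)+
qed

lemma N_mult:
  assumes "X \<in> Obj C"
  shows "mult N X \<in> Arr C" "Dom C (mult N X) = codensity_ob (codensity_ob X)"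
    "Cod C (mult N X) = codensity_ob X"
    "\<And>i l. l \<in> Arr C \<Longrightarrow> Dom C l = X \<Longrightarrow> Cod C l = D i \<Longrightarrow>
       eval_at X i l \<cdot> mult N X = eval_at (codensity_ob X) i (eval_at X i l)"
proof -
  let ?p = "\<lambda>i l. eval_at (codensity_ob X) i (eval_at X i l)"
  have eq: "mult N X = lift X (codensity_ob (codensity_ob X)) ?p"
    by (simp add: codensity_monad_def)
  note L = lift[of X "codensity_ob (codensity_ob X)" ?p]
  show "mult N X \<in> Arr C" "Dom C (mult N X) = codensity_ob (codensity_ob X)"
    "Cod C (mult N X) = codensity_ob X"
    unfolding eq using assms by (intro L; auto simp: hom_iff eval_at_f)+
  show "\<And>i l. l \<in> Arr C \<Longrightarrow> Dom C l = X \<Longrightarrow> Cod C l = D i \<Longrightarrow>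
       eval_at X i l \<cdot> mult N X = eval_at (codensity_ob X) i (eval_at X i l)"
    unfolding eq using assms by (intro L; auto simp: hom_iff eval_at_f)+
qed

lemma eval_reassoc:
  assumes "eval_at X i l \<cdot> k = r" "l \<in> Arr C" "Dom C l = X" "Cod C l = D i"
    "k \<in> Arr C" "Cod C k = codensity_ob X" "h \<in> Arr C" "Cod C h = Dom C k"
  shows "eval_at X i l \<cdot> (k \<cdot> h) = r \<cdot> h"
  using assms by (intro Comp_reassoc) auto

lemma N_is_functor: "is_functor C C N"
proof
  show "fa N (Ident C X) = Ident C (fo N X)" if "X \<in> Obj C" for X
  proof (rule codensity_eqI[OF that])
    note I = N_fa[OF Ident_arr(1)[OF that], unfolded Ident_arr[OF that]]
    show "fa N (Ident C X) \<in> Arr C" "Dom C (fa N (Ident C X)) = Dom C (Ident C (fo N X))"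
      "Cod C (fa N (Ident C X)) = codensity_ob X"
      "\<And>i l. l \<in> Arr C \<Longrightarrow> Dom C l = X \<Longrightarrow> Cod C l = D i \<Longrightarrow>
        eval_at X i l \<cdot> fa N (Ident C X) = eval_at X i l \<cdot> Ident C (fo N X)"
      using that I by simp_all
  qed (use that in auto)
  show "fa N (k' \<cdot> k) = fa N k' \<cdot> fa N k" if "k \<in> hom C X Y" "k' \<in> hom C Y Z" for k k' X Y Z
  proof -
    have k: "k \<in> Arr C" "Dom C k = X" "Cod C k = Y" "k' \<in> Arr C" "Dom C k' = Y" "Cod C k' = Z"
      using that by (auto simp: hom_iff)
    note N_k = N_fa[OF k(1), unfolded k] N_fa[OF k(4), unfolded k]
    note N_kk = N_fa[of "k' \<cdot> k"]
    show ?thesis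
    proof (rule codensity_eqI[of Z])
      fix i l assume l: "l \<in> Arr C" "Dom C l = Z" "Cod C l = D i"
      have "eval_at Z i l \<cdot> (fa N k' \<cdot> fa N k) = eval_at Y i (l \<cdot> k') \<cdot> fa N k"
        using l k N_k by (intro eval_reassoc) auto
      then show "eval_at Z i l \<cdot> fa N (k' \<cdot> k) = eval_at Z i l \<cdot> (fa N k' \<cdot> fa N k)"
        using l k N_k N_kk by simp
    qed (use k N_k N_kk Cod_in[of k'] in auto)
  qed
qed (auto simp: hom_iff N_fa)

lemma N_is_monad: "is_monad C N"
proof -
  interpret N: is_functor C C N by (rule N_is_functor)
  have unit: "nat_trans C C id_ftor N (unit N)"
  proof (rule nat_transI[OF id_functor N_is_functor])
    fix k assume k: "k \<in> Arr C"
    then have X: "Dom C k \<in> Obj C" "Cod C k \<in> Obj C" by auto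
    note U = N_unit[OF X(1)] N_unit[OF X(2)] N_fa[OF k]
    show "unit N (Cod C k) \<cdot> fa id_ftor k = fa N k \<cdot> unit N (Dom C k)"
    proof (rule codensity_eqI[of "Cod C k"])
      fix i l assume l: "l \<in> Arr C" "Dom C l = Cod C k" "Cod C l = D i"
      have "eval_at (Cod C k) i l \<cdot> (unit N (Cod C k) \<cdot> k) = l \<cdot> k"
        using l k U by (intro eval_reassoc) auto
      moreover have "eval_at (Cod C k) i l \<cdot> (fa N k \<cdot> unit N (Dom C k)) =
          eval_at (Dom C k) i (l \<cdot> k) \<cdot> unit N (Dom C k)"
        using l k U by (intro eval_reassoc) auto
      ultimately show "eval_at (Cod C k) i l \<cdot> (unit N (Cod C k) \<cdot> fa id_ftor k) =
          eval_at (Cod C k) i l \<cdot> (fa N k \<cdot> unit N (Dom C k))"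
        using l k U by simp
    qed (use k U in auto)
  qed (auto simp: hom_iff N_unit)
  have mult: "nat_trans C C (N \<odot> N) N (mult N)"
  proof (rule nat_transI[OF comp_functor[OF N_is_functor N_is_functor] N_is_functor])
    fix k assume k: "k \<in> Arr C"
    then have X: "Dom C k \<in> Obj C" "Cod C k \<in> Obj C" by auto
    note U = N_mult[OF X(1)] N_mult[OF X(2)] N_fa[OF k]
    note NN = N_fa[OF N_fa(1)[OF k], unfolded N_fa(2,3)[OF k]]
    show "mult N (Cod C k) \<cdot> fa (N \<odot> N) k = fa N k \<cdot> mult N (Dom C k)"
    proof (rule codensity_eqI[of "Cod C k"])
      fix i l assume l: "l \<in> Arr C" "Dom C l = Cod C k" "Cod C l = D i"
      have "eval_at (Cod C k) i l \<cdot> (mult N (Cod C k) \<cdot> fa N (fa N k)) =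
          eval_at (codensity_ob (Cod C k)) i (eval_at (Cod C k) i l) \<cdot> fa N (fa N k)"
        using l k U NN by (intro eval_reassoc) auto
      moreover have "eval_at (Cod C k) i l \<cdot> (fa N k \<cdot> mult N (Dom C k)) =
          eval_at (Dom C k) i (l \<cdot> k) \<cdot> mult N (Dom C k)"
        using l k U by (intro eval_reassoc) auto
      ultimately show "eval_at (Cod C k) i l \<cdot> (mult N (Cod C k) \<cdot> fa (N \<odot> N) k) =
          eval_at (Cod C k) i l \<cdot> (fa N k \<cdot> mult N (Dom C k))"
        using l k U NN by simp
    qed (use k U NN in auto)
  qed (auto simp: hom_iff N_mult)
  interpret unit: nat_trans C C id_ftor N "unit N" by (rule unit)
  interpret mult: nat_trans C C "N \<odot> N" N "mult N" by (rule mult)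
  show ?thesis
  proof
    fix X assume X: "X \<in> Obj C"
    then have NX: "codensity_ob X \<in> Obj C" by simp
    note U = N_unit[OF X] N_unit[OF NX] N_mult[OF X] N_mult[OF NX]
    have NU: "\<And>i l. l \<in> Arr C \<Longrightarrow> Dom C l = codensity_ob X \<Longrightarrow> Cod C l = D i \<Longrightarrow>
       eval_at (codensity_ob X) i l \<cdot> fa N (unit N X) = eval_at X i (l \<cdot> unit N X)"
      using N_fa(4)[OF U(1)] U by simp
    have NM: "\<And>i l. l \<in> Arr C \<Longrightarrow> Dom C l = codensity_ob X \<Longrightarrow> Cod C l = D i \<Longrightarrow>
       eval_at (codensity_ob X) i l \<cdot> fa N (mult N X) =
       eval_at (codensity_ob (codensity_ob X)) i (l \<cdot> mult N X)"
      using N_fa(4)[OF N_mult(1)[OF X]] U by simp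
    show "mult N X \<cdot> unit N (fo N X) = Ident C (fo N X)"
    proof (rule codensity_eqI[OF X])
      fix i l assume l: "l \<in> Arr C" "Dom C l = X" "Cod C l = D i"
      have "eval_at X i l \<cdot> (mult N X \<cdot> unit N (codensity_ob X)) =
          eval_at (codensity_ob X) i (eval_at X i l) \<cdot> unit N (codensity_ob X)"
        using l X U by (intro eval_reassoc) auto
      then show "eval_at X i l \<cdot> (mult N X \<cdot> unit N (fo N X)) = eval_at X i l \<cdot> Ident C (fo N X)"
        using l X U by simp
    qed (use X U in auto)
    show "mult N X \<cdot> fa N (unit N X) = Ident C (fo N X)"
    proof (rule codensity_eqI[OF X])
      fix i l assume l: "l \<in> Arr C" "Dom C l = X" "Cod C l = D i"
      have "eval_at X i l \<cdot> (mult N X \<cdot> fa N (unit N X)) =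
          eval_at (codensity_ob X) i (eval_at X i l) \<cdot> fa N (unit N X)"
        using l X U by (intro eval_reassoc) auto
      then show "eval_at X i l \<cdot> (mult N X \<cdot> fa N (unit N X)) = eval_at X i l \<cdot> Ident C (fo N X)"
        using l X U NU by simp
    qed (use X U in auto)
    show "mult N X \<cdot> mult N (fo N X) = mult N X \<cdot> fa N (mult N X)"
    proof (rule codensity_eqI[OF X])
      fix i l assume l: "l \<in> Arr C" "Dom C l = X" "Cod C l = D i"
      have "eval_at X i l \<cdot> (mult N X \<cdot> fa N (mult N X)) =
          eval_at (codensity_ob X) i (eval_at X i l) \<cdot> fa N (mult N X)"
        using l X U by (intro eval_reassoc) auto
      moreover have "eval_at X i l \<cdot> (mult N X \<cdot> mult N (codensity_ob X)) =
          eval_at (codensity_ob X) i (eval_at X i l) \<cdot> mult N (codensity_ob X)"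
        using l X U by (intro eval_reassoc) auto
      ultimately show "eval_at X i l \<cdot> (mult N X \<cdot> mult N (fo N X)) =
          eval_at X i l \<cdot> (mult N X \<cdot> fa N (mult N X))"
        using l X U NM by simp
    qed (use X U in auto)
  qed
qed

end


section \<open>Algebras of free monads and of coproducts of monads\<close>

definition algebra :: "('o, 'a) cat \<Rightarrow> ('o, 'a, 'o, 'a, 'x) ftor_scheme \<Rightarrow> 'o \<Rightarrow> 'a \<Rightarrow> bool" where
  "algebra C F A a \<longleftrightarrow> A \<in> Obj C \<and> a \<in> Arr C \<and> Dom C a = fo F A \<and> Cod C a = A"

definition monad_algebra :: "('o, 'a) cat \<Rightarrow> ('o, 'a) monad \<Rightarrow> 'o \<Rightarrow> 'a \<Rightarrow> bool" where
  "monad_algebra C M A a \<longleftrightarrow> algebra C M A a \<and>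
     a \<cdot>\<^bsub>C\<^esub> unit M A = Ident C A \<and> a \<cdot>\<^bsub>C\<^esub> mult M A = a \<cdot>\<^bsub>C\<^esub> fa M a"

definition alg_hom :: "('o, 'a) cat \<Rightarrow> ('o, 'a, 'o, 'a, 'x) ftor_scheme \<Rightarrow> 'a \<Rightarrow> 'a \<Rightarrow> 'a \<Rightarrow> bool" where
  "alg_hom C F a b f \<longleftrightarrow> f \<in> Arr C \<and> Dom C f = Cod C a \<and> Cod C f = Cod C b \<and>
     f \<cdot>\<^bsub>C\<^esub> a = b \<cdot>\<^bsub>C\<^esub> fa F f"

lemma algebraD:
  assumes "algebra C F A a"
  shows "A \<in> Obj C" "a \<in> Arr C" "Dom C a = fo F A" "Cod C a = A"
  using assms unfolding algebra_def by auto

lemma monad_algebraD: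
  assumes "monad_algebra C M A a"
  shows "A \<in> Obj C" "a \<in> Arr C" "Dom C a = fo M A" "Cod C a = A"
    "a \<cdot>\<^bsub>C\<^esub> unit M A = Ident C A" "a \<cdot>\<^bsub>C\<^esub> mult M A = a \<cdot>\<^bsub>C\<^esub> fa M a" "algebra C M A a"
  using assms unfolding monad_algebra_def algebra_def by auto

lemma alg_homD:
  assumes "alg_hom C F a b f"
  shows "f \<in> Arr C" "Dom C f = Cod C a" "Cod C f = Cod C b" "f \<cdot>\<^bsub>C\<^esub> a = b \<cdot>\<^bsub>C\<^esub> fa F f"
  using assms unfolding alg_hom_def by auto

lemma nat_trans_algebra:
  assumes "nat_trans C C F G \<tau>" "algebra C G A a"
  shows "algebra C F A (a \<cdot>\<^bsub>C\<^esub> \<tau> A)"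
proof -
  interpret nat_trans C C F G \<tau> by fact
  show ?thesis
    using assms(2) unfolding algebra_def by auto
qed

lemma nat_trans_alg_hom:
  assumes "nat_trans C C F G \<tau>" "algebra C G A a" "algebra C G B b" "alg_hom C G a b f"
  shows "alg_hom C F (a \<cdot>\<^bsub>C\<^esub> \<tau> A) (b \<cdot>\<^bsub>C\<^esub> \<tau> B) f"
proof -
  interpret nat_trans C C F G \<tau> by fact
  note f = alg_homD[OF assms(4)] and a = algebraD[OF assms(2)] and b = algebraD[OF assms(3)]
  have "f \<cdot>\<^bsub>C\<^esub> (a \<cdot>\<^bsub>C\<^esub> \<tau> A) = (b \<cdot>\<^bsub>C\<^esub> fa G f) \<cdot>\<^bsub>C\<^esub> \<tau> A"
    using f a b by (intro F.A.Comp_reassoc) auto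
  also have "\<dots> = b \<cdot>\<^bsub>C\<^esub> (\<tau> B \<cdot>\<^bsub>C\<^esub> fa F f)"
    using f a b nat[OF f(1)] by simp
  finally show ?thesis
    using f a b unfolding alg_hom_def by simp
qed

lemma monad_morphism_algebra:
  assumes "monad_morphism C M N \<alpha>" "monad_algebra C N A a"
  shows "monad_algebra C M A (a \<cdot>\<^bsub>C\<^esub> \<alpha> A)"
proof -
  interpret monad_morphism C M N \<alpha> by fact
  note a = monad_algebraD[OF assms(2)]
  have \<alpha>a: "\<alpha> A \<cdot>\<^bsub>C\<^esub> fa M a = fa N a \<cdot>\<^bsub>C\<^esub> \<alpha> (fo N A)"
    using nat[of a] a by simp
  have "(a \<cdot>\<^bsub>C\<^esub> \<alpha> A) \<cdot>\<^bsub>C\<^esub> mult M A = a \<cdot>\<^bsub>C\<^esub> (mult N A \<cdot>\<^bsub>C\<^esub> (\<alpha> (fo N A) \<cdot>\<^bsub>C\<^esub> fa M (\<alpha> A)))"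
    using a pres_mult[of A] by simp
  also have "\<dots> = (a \<cdot>\<^bsub>C\<^esub> fa N a) \<cdot>\<^bsub>C\<^esub> (\<alpha> (fo N A) \<cdot>\<^bsub>C\<^esub> fa M (\<alpha> A))"
    using a by (intro M.M.A.Comp_reassoc) auto
  also have "\<dots> = a \<cdot>\<^bsub>C\<^esub> ((fa N a \<cdot>\<^bsub>C\<^esub> \<alpha> (fo N A)) \<cdot>\<^bsub>C\<^esub> fa M (\<alpha> A))"
    using a by simp
  also have "\<dots> = a \<cdot>\<^bsub>C\<^esub> ((\<alpha> A \<cdot>\<^bsub>C\<^esub> fa M a) \<cdot>\<^bsub>C\<^esub> fa M (\<alpha> A))"
    by (simp only: \<alpha>a)
  also have "\<dots> = (a \<cdot>\<^bsub>C\<^esub> \<alpha> A) \<cdot>\<^bsub>C\<^esub> fa M (a \<cdot>\<^bsub>C\<^esub> \<alpha> A)"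
    using a by (simp add: M.M.fa_comp)
  finally show ?thesis
    using nat_trans_algebra[OF nat_trans_axioms a(7)] a pres_unit[of A]
    unfolding monad_algebra_def by (simp add: algebra_def)
qed

section \<open>Monad morphisms into the endomorphism monad as algebras\<close>

context codensity
begin

definition alg_arrow :: "('o, 'a, 'o, 'a, 'x) ftor_scheme \<Rightarrow> (bool \<Rightarrow> 'a) \<Rightarrow> 'o \<Rightarrow> 'a" where
  "alg_arrow F a X = lift X (fo F X) (\<lambda>i l. a i \<cdot> fa F l)"

definition alg_pair :: "('o, 'a, 'o, 'a, 'x) ftor_scheme \<Rightarrow> (bool \<Rightarrow> 'a) \<Rightarrow> bool" where
  "alg_pair F a \<longleftrightarrow> (\<forall>i. algebra C F (D i) (a i)) \<and> alg_hom C F (a True) (a False) f"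

text \<open>The Yoneda reading of \<alpha>: its value on the identity probe of \<open>D i\<close>.
  By \<open>alg_of_arrow\<close> and \<open>alg_of_inj\<close> it inverts
  \<open>alg_arrow\<close>.\<close>

definition alg_of :: "('o \<Rightarrow> 'a) \<Rightarrow> bool \<Rightarrow> 'a" where
  "alg_of \<alpha> i = eval_at (D i) i (Ident C (D i)) \<cdot> \<alpha> (D i)"

lemma alg_pairD:
  assumes "alg_pair F a"
  shows "a i \<in> Arr C" "Dom C (a i) = fo F (D i)" "Cod C (a i) = D i"
    "f \<cdot> a True = a False \<cdot> fa F f"
  using assms unfolding alg_pair_def algebra_def alg_hom_def by auto

lemma alg_arrow:
  assumes "is_functor C C F" "alg_pair F a" "X \<in> Obj C"
  shows "alg_arrow F a X \<in> Arr C" "Dom C (alg_arrow F a X) = fo F X"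
    "Cod C (alg_arrow F a X) = codensity_ob X"
    "\<And>i l. l \<in> Arr C \<Longrightarrow> Dom C l = X \<Longrightarrow> Cod C l = D i \<Longrightarrow>
       eval_at X i l \<cdot> alg_arrow F a X = a i \<cdot> fa F l"
proof -
  interpret F: is_functor C C F by fact
  note a = alg_pairD[OF assms(2)]
  have p: "a i \<cdot> fa F l \<in> hom C (fo F X) (D i)"
    if "l \<in> Arr C" "Dom C l = X" "Cod C l = D i" for i l
    using that a by (auto simp: hom_iff)
  have pf: "a False \<cdot> fa F (f \<cdot> l) = f \<cdot> (a True \<cdot> fa F l)"
    if l: "l \<in> Arr C" "Dom C l = X" "Cod C l = D True" for l
  proof -
    have "f \<cdot> (a True \<cdot> fa F l) = (a False \<cdot> fa F f) \<cdot> fa F l"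
      using l a by (intro Comp_reassoc) auto
    then show ?thesis
      using l a by (simp add: F.fa_comp)
  qed
  note L = lift[of X "fo F X" "\<lambda>i l. a i \<cdot> fa F l", OF assms(3) F.fo_Obj[OF assms(3)] p pf]
  show "alg_arrow F a X \<in> Arr C" "Dom C (alg_arrow F a X) = fo F X"
    "Cod C (alg_arrow F a X) = codensity_ob X"
    "\<And>i l. l \<in> Arr C \<Longrightarrow> Dom C l = X \<Longrightarrow> Cod C l = D i \<Longrightarrow>
       eval_at X i l \<cdot> alg_arrow F a X = a i \<cdot> fa F l"
    unfolding alg_arrow_def using L by blast+
qed

lemma alg_arrow_nat:
  assumes F: "is_functor C C F" and "alg_pair F a"
  shows "nat_trans C C F N (alg_arrow F a)"
proof (rule nat_transI[OF F N_is_functor])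
  interpret F: is_functor C C F by fact
  note a = alg_pairD[OF assms(2)]
  fix k assume k: "k \<in> Arr C"
  then have X: "Dom C k \<in> Obj C" "Cod C k \<in> Obj C" by auto
  note A = alg_arrow[OF F assms(2) X(1)] alg_arrow[OF F assms(2) X(2)] N_fa[OF k]
  show "alg_arrow F a (Cod C k) \<cdot> fa F k = fa N k \<cdot> alg_arrow F a (Dom C k)"
  proof (rule codensity_eqI[OF X(2)])
    fix i l assume l: "l \<in> Arr C" "Dom C l = Cod C k" "Cod C l = D i"
    have "eval_at (Cod C k) i l \<cdot> (alg_arrow F a (Cod C k) \<cdot> fa F k) =
        (a i \<cdot> fa F l) \<cdot> fa F k"
      using l k A by (intro eval_reassoc) auto
    moreover have "eval_at (Cod C k) i l \<cdot> (fa N k \<cdot> alg_arrow F a (Dom C k)) =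
        eval_at (Dom C k) i (l \<cdot> k) \<cdot> alg_arrow F a (Dom C k)"
      using l k A by (intro eval_reassoc) auto
    ultimately show "eval_at (Cod C k) i l \<cdot> (alg_arrow F a (Cod C k) \<cdot> fa F k) =
        eval_at (Cod C k) i l \<cdot> (fa N k \<cdot> alg_arrow F a (Dom C k))"
      using l k a A by (simp add: F.fa_comp)
  qed (use k A in auto)
qed (use alg_arrow[OF assms] in \<open>auto simp: hom_iff\<close>)

text \<open>After evaluation at a probe \<open>l\<close>, preservation of unit and multiplication
  become the unit law and the associativity law of the algebra \<open>a i\<close>.\<close>

lemma alg_arrow_morphism:
  assumes M: "is_monad C M" and a: "\<And>i. monad_algebra C M (D i) (a i)"
    and hom: "alg_hom C M (a True) (a False) f"
  shows "monad_morphism C M N (alg_arrow M a)"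
proof -
  interpret M: is_monad C M by fact
  interpret N: is_monad C N by (rule N_is_monad)
  have pair: "alg_pair M a"
    using a hom unfolding alg_pair_def monad_algebra_def by blast
  interpret nat: nat_trans C C M N "alg_arrow M a"
    by (rule alg_arrow_nat[OF M.M.is_functor_axioms pair])
  note a = monad_algebraD[OF a]
  note A = alg_arrow[OF M.M.is_functor_axioms pair]
  show ?thesis
  proof
    fix X assume X: "X \<in> Obj C"
    show "alg_arrow M a X \<cdot> unit M X = unit N X"
    proof (rule codensity_eqI[OF X])
      fix i l assume l: "l \<in> Arr C" "Dom C l = X" "Cod C l = D i"
      have "eval_at X i l \<cdot> (alg_arrow M a X \<cdot> unit M X) = (a i \<cdot> fa M l) \<cdot> unit M X"
        using l X A by (intro eval_reassoc) auto
      also have "\<dots> = a i \<cdot> (unit M (D i) \<cdot> l)"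
        using l X a M.unit.nat[OF l(1)] by simp
      also have "\<dots> = Ident C (D i) \<cdot> l"
        using l a by (intro Comp_reassoc) auto
      finally show "eval_at X i l \<cdot> (alg_arrow M a X \<cdot> unit M X) = eval_at X i l \<cdot> unit N X"
        using l N_unit(4)[OF X l] by simp
    qed (use X A N_unit in auto)
    let ?NX = "codensity_ob X"
    have NX: "?NX \<in> Obj C" using X by simp
    note AX = A[OF X] A[OF NX] N_mult[OF X]
    show "alg_arrow M a X \<cdot> mult M X =
        mult N X \<cdot> alg_arrow M a (fo N X) \<cdot> fa M (alg_arrow M a X)"
    proof (rule codensity_eqI[OF X])
      fix i l assume l: "l \<in> Arr C" "Dom C l = X" "Cod C l = D i"
      have "eval_at X i l \<cdot> (alg_arrow M a X \<cdot> mult M X) = (a i \<cdot> fa M l) \<cdot> mult M X"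
        using l X AX by (intro eval_reassoc) auto
      also have "\<dots> = a i \<cdot> (mult M (D i) \<cdot> fa M (fa M l))"
        using l X a M.mult.nat[OF l(1)] by simp
      also have "\<dots> = (a i \<cdot> fa M (a i)) \<cdot> fa M (fa M l)"
        using l a by (intro Comp_reassoc) auto
      finally have 1: "eval_at X i l \<cdot> (alg_arrow M a X \<cdot> mult M X) =
          a i \<cdot> (fa M (a i) \<cdot> fa M (fa M l))"
        using l a by simp
      have "eval_at X i l \<cdot> (mult N X \<cdot> (alg_arrow M a ?NX \<cdot> fa M (alg_arrow M a X))) =
          eval_at ?NX i (eval_at X i l) \<cdot> (alg_arrow M a ?NX \<cdot> fa M (alg_arrow M a X))"
        using l X AX by (intro eval_reassoc) auto
      also have "\<dots> = (a i \<cdot> fa M (eval_at X i l)) \<cdot> fa M (alg_arrow M a X)"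
        using l X AX by (intro eval_reassoc) auto
      also have "\<dots> = a i \<cdot> fa M (eval_at X i l \<cdot> alg_arrow M a X)"
        using l X AX a M.M.fa_comp[of "alg_arrow M a X" "eval_at X i l"] by simp
      also have "\<dots> = a i \<cdot> (fa M (a i) \<cdot> fa M (fa M l))"
        using l X AX(4)[OF l] a by (simp add: M.M.fa_comp)
      finally show "eval_at X i l \<cdot> (alg_arrow M a X \<cdot> mult M X) =
          eval_at X i l \<cdot> (mult N X \<cdot> alg_arrow M a (fo N X) \<cdot> fa M (alg_arrow M a X))"
        using 1 by simp
    qed (use X AX in auto)
  qed
qed

lemma eval_id:
  assumes "l \<in> Arr C" "Cod C l = D i"
  shows "eval_at (D i) i (Ident C (D i)) \<cdot> fa N l = eval_at (Dom C l) i l"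
  using N_fa(4)[OF assms(1), of "Ident C (D i)" i] assms by simp

lemma alg_of_arr:
  assumes "nat_trans C C F N \<alpha>"
  shows "alg_of \<alpha> i \<in> Arr C" "Dom C (alg_of \<alpha> i) = fo F (D i)" "Cod C (alg_of \<alpha> i) = D i"
proof -
  interpret nat_trans C C F N \<alpha> by fact
  show "alg_of \<alpha> i \<in> Arr C" "Dom C (alg_of \<alpha> i) = fo F (D i)" "Cod C (alg_of \<alpha> i) = D i"
    by (simp_all add: alg_of_def)
qed

text \<open>Every probe \<open>l\<close> is the identity probe of \<open>D i\<close> pulled back
  along \<open>l\<close>, so naturality of \<alpha> at \<open>l\<close> reduces its values to
  \<open>alg_of\<close>.\<close>

lemma eval_nat:
  assumes "nat_trans C C F N \<alpha>" "l \<in> Arr C" "Cod C l = D i"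
  shows "eval_at (Dom C l) i l \<cdot> \<alpha> (Dom C l) = alg_of \<alpha> i \<cdot> fa F l"
proof -
  interpret nat_trans C C F N \<alpha> by fact
  have "eval_at (D i) i (Ident C (D i)) \<cdot> (fa N l \<cdot> \<alpha> (Dom C l)) =
      eval_at (Dom C l) i l \<cdot> \<alpha> (Dom C l)"
    using assms N_fa[OF assms(2)] eval_id[OF assms(2,3)] by (intro eval_reassoc) auto
  then show ?thesis
    using nat[OF assms(2)] assms(2,3) by (simp add: alg_of_def)
qed

text \<open>The probe \<open>f\<close>, with index \<open>False\<close>, is evaluated in two ways:
  as \<open>f\<close> after the identity probe of \<open>D True\<close>, and by naturality of
  \<alpha>.\<close>

lemma alg_of_hom:
  assumes "nat_trans C C F N \<alpha>"
  shows "alg_hom C F (alg_of \<alpha> True) (alg_of \<alpha> False) f"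
proof -
  interpret nat_trans C C F N \<alpha> by fact
  have ef: "eval_at (D True) False f = f \<cdot> eval_at (D True) True (Ident C (D True))"
    using eval_at_f[of "Ident C (D True)" "D True"] by simp
  have "f \<cdot> alg_of \<alpha> True = eval_at (D True) False f \<cdot> \<alpha> (D True)"
    unfolding alg_of_def ef by simp
  also have "\<dots> = alg_of \<alpha> False \<cdot> fa F f"
    using eval_nat[OF assms, of f False] by simp
  finally show ?thesis
    using alg_of_arr[OF assms] by (simp add: alg_hom_def)
qed

text \<open>Evaluation at the identity probe is itself an algebra for \<open>N\<close>; pulling it
  back along the monad morphism \<alpha> gives \<open>alg_of\<close>.\<close>

lemma alg_of_monad_algebra:
  assumes "monad_morphism C M N \<alpha>"
  shows "monad_algebra C M (D i) (alg_of \<alpha> i)"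
proof -
  interpret \<alpha>: monad_morphism C M N \<alpha> by fact
  let ?e = "eval_at (D i) i (Ident C (D i))"
  have "?e \<cdot> mult N (D i) = ?e \<cdot> fa N ?e"
    using N_mult(4)[of "D i" "Ident C (D i)" i] eval_id[of ?e i] by simp
  then have "monad_algebra C N (D i) ?e"
    using N_unit(4)[of "D i" "Ident C (D i)" i] by (simp add: monad_algebra_def algebra_def)
  from monad_morphism_algebra[OF assms this] show ?thesis
    by (simp add: alg_of_def)
qed

lemma alg_of_arrow:
  assumes "is_functor C C F" "alg_pair F a"
  shows "alg_of (alg_arrow F a) i = a i"
proof -
  interpret is_functor C C F by fact
  show ?thesis
    using alg_arrow(4)[OF assms, of "D i" "Ident C (D i)" i] alg_pairD[OF assms(2)]
    by (simp add: alg_of_def)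
qed

lemma alg_of_inj:
  assumes "nat_trans C C F N \<alpha>" "nat_trans C C F N \<beta>" "\<And>i. alg_of \<alpha> i = alg_of \<beta> i"
    and X: "X \<in> Obj C"
  shows "\<alpha> X = \<beta> X"
proof -
  interpret \<alpha>: nat_trans C C F N \<alpha> by fact
  interpret \<beta>: nat_trans C C F N \<beta> by fact
  show ?thesis
  proof (rule codensity_eqI[OF X])
    fix i l assume l: "l \<in> Arr C" "Dom C l = X" "Cod C l = D i"
    show "eval_at X i l \<cdot> \<alpha> X = eval_at X i l \<cdot> \<beta> X"
      using eval_nat[OF assms(1) l(1,3)] eval_nat[OF assms(2) l(1,3)] assms(3)[of i] l(2) by simp
  qed (use X in auto)
qed

lemma alg_of_comp:
  assumes "nat_trans C C G N \<alpha>" "nat_trans C C F G \<tau>"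
    and "\<And>X. X \<in> Obj C \<Longrightarrow> \<alpha> X \<cdot> \<tau> X = \<beta> X"
  shows "alg_of \<beta> i = alg_of \<alpha> i \<cdot> \<tau> (D i)"
proof -
  interpret \<alpha>: nat_trans C C G N \<alpha> by fact
  interpret \<tau>: nat_trans C C F G \<tau> by fact
  show ?thesis
    using assms(3)[of "D i"] by (simp add: alg_of_def)
qed

end

lemma nat_trans_comp:
  assumes "nat_trans C C F G \<sigma>" "nat_trans C C G H \<tau>"
  shows "nat_trans C C F H (\<lambda>X. \<tau> X \<cdot>\<^bsub>C\<^esub> \<sigma> X)"
proof -
  interpret \<sigma>: nat_trans C C F G \<sigma> by fact
  interpret \<tau>: nat_trans C C G H \<tau> by fact
  show ?thesis
  proof (rule nat_transI[OF \<sigma>.F.is_functor_axioms \<tau>.G.is_functor_axioms])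
    fix f assume f: "f \<in> Arr C"
    then have "fa H f \<cdot>\<^bsub>C\<^esub> (\<tau> (Dom C f) \<cdot>\<^bsub>C\<^esub> \<sigma> (Dom C f)) =
        (\<tau> (Cod C f) \<cdot>\<^bsub>C\<^esub> fa G f) \<cdot>\<^bsub>C\<^esub> \<sigma> (Dom C f)"
      by (intro \<sigma>.F.A.Comp_reassoc \<tau>.nat[symmetric]) auto
    then show "(\<tau> (Cod C f) \<cdot>\<^bsub>C\<^esub> \<sigma> (Cod C f)) \<cdot>\<^bsub>C\<^esub> fa F f =
        fa H f \<cdot>\<^bsub>C\<^esub> (\<tau> (Dom C f) \<cdot>\<^bsub>C\<^esub> \<sigma> (Dom C f))"
      using f \<sigma>.nat[OF f] by simp
  qed (simp add: hom_iff)
qed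

lemma free_monad_exists:
  assumes "free_monad C F M \<eta>" "is_monad C N" "nat_trans C C F N \<sigma>"
  obtains \<alpha> where "monad_morphism C M N \<alpha>" "\<And>X. X \<in> Obj C \<Longrightarrow> \<alpha> X \<cdot>\<^bsub>C\<^esub> \<eta> X = \<sigma> X"
proof -
  have "\<exists>\<alpha>. monad_morphism C M N \<alpha> \<and> (\<forall>X \<in> Obj C. \<alpha> X \<cdot>\<^bsub>C\<^esub> \<eta> X = \<sigma> X)"
    using assms unfolding free_monad_def by blast
  then show ?thesis using that by blast
qed

lemma free_monad_unique:
  assumes "free_monad C F M \<eta>" "nat_trans C C F N (\<lambda>X. \<alpha> X \<cdot>\<^bsub>C\<^esub> \<eta> X)"
    and "monad_morphism C M N \<alpha>" "monad_morphism C M N \<beta>"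
    and eq: "\<And>X. X \<in> Obj C \<Longrightarrow> \<beta> X \<cdot>\<^bsub>C\<^esub> \<eta> X = \<alpha> X \<cdot>\<^bsub>C\<^esub> \<eta> X"
    and X: "X \<in> Obj C"
  shows "\<alpha> X = \<beta> X"
proof -
  have "is_monad C N"
    using assms(3) unfolding monad_morphism_def by blast
  then have "\<exists>\<gamma>. \<forall>\<beta>. monad_morphism C M N \<beta> \<and> (\<forall>X \<in> Obj C. \<beta> X \<cdot>\<^bsub>C\<^esub> \<eta> X = \<alpha> X \<cdot>\<^bsub>C\<^esub> \<eta> X) \<longrightarrow>
      (\<forall>X \<in> Obj C. \<beta> X = \<gamma> X)"
    using assms(1,2) unfolding free_monad_def by blast
  then obtain \<gamma> where \<gamma>: "\<And>\<beta>. monad_morphism C M N \<beta> \<Longrightarrow>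
      (\<forall>X \<in> Obj C. \<beta> X \<cdot>\<^bsub>C\<^esub> \<eta> X = \<alpha> X \<cdot>\<^bsub>C\<^esub> \<eta> X) \<Longrightarrow> (\<forall>X \<in> Obj C. \<beta> X = \<gamma> X)"
    by blast
  show ?thesis
    using \<gamma>[OF assms(3)] \<gamma>[OF assms(4)] eq X by simp
qed

lemma monad_coproduct_exists:
  assumes "monad_coproduct C M\<^sub>1 M\<^sub>2 P i\<^sub>1 i\<^sub>2" "monad_morphism C M\<^sub>1 N f" "monad_morphism C M\<^sub>2 N g"
  obtains h where "monad_morphism C P N h"
    "\<And>X. X \<in> Obj C \<Longrightarrow> h X \<cdot>\<^bsub>C\<^esub> i\<^sub>1 X = f X" "\<And>X. X \<in> Obj C \<Longrightarrow> h X \<cdot>\<^bsub>C\<^esub> i\<^sub>2 X = g X"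
proof -
  have "\<exists>h. monad_morphism C P N h \<and>
      (\<forall>X \<in> Obj C. h X \<cdot>\<^bsub>C\<^esub> i\<^sub>1 X = f X \<and> h X \<cdot>\<^bsub>C\<^esub> i\<^sub>2 X = g X)"
    using assms unfolding monad_coproduct_def by blast
  then show ?thesis using that by blast
qed

lemma monad_coproduct_unique:
  assumes "monad_coproduct C M\<^sub>1 M\<^sub>2 P i\<^sub>1 i\<^sub>2" "monad_morphism C M\<^sub>1 N f" "monad_morphism C M\<^sub>2 N g"
    and "monad_morphism C P N h" "monad_morphism C P N k"
    and eq: "\<And>X. X \<in> Obj C \<Longrightarrow> h X \<cdot>\<^bsub>C\<^esub> i\<^sub>1 X = f X" "\<And>X. X \<in> Obj C \<Longrightarrow> h X \<cdot>\<^bsub>C\<^esub> i\<^sub>2 X = g X"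
      "\<And>X. X \<in> Obj C \<Longrightarrow> k X \<cdot>\<^bsub>C\<^esub> i\<^sub>1 X = f X" "\<And>X. X \<in> Obj C \<Longrightarrow> k X \<cdot>\<^bsub>C\<^esub> i\<^sub>2 X = g X"
    and X: "X \<in> Obj C"
  shows "h X = k X"
proof -
  have "\<exists>h. \<forall>k. monad_morphism C P N k \<and>
      (\<forall>X \<in> Obj C. k X \<cdot>\<^bsub>C\<^esub> i\<^sub>1 X = f X \<and> k X \<cdot>\<^bsub>C\<^esub> i\<^sub>2 X = g X) \<longrightarrow> (\<forall>X \<in> Obj C. k X = h X)"
    using assms(1-3) unfolding monad_coproduct_def by blast
  then obtain r where r: "\<And>k. monad_morphism C P N k \<Longrightarrow>
      (\<forall>X \<in> Obj C. k X \<cdot>\<^bsub>C\<^esub> i\<^sub>1 X = f X \<and> k X \<cdot>\<^bsub>C\<^esub> i\<^sub>2 X = g X) \<Longrightarrow> (\<forall>X \<in> Obj C. k X = r X)"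
    by blast
  show ?thesis
    using r[OF assms(4)] r[OF assms(5)] eq X by simp
qed

section \<open>Algebras read off from universal properties\<close>

context lfp_category
begin

lemma codensityI: "f \<in> hom C (D True) (D False) \<Longrightarrow> codensity u C D f"
  by unfold_locales

text \<open>The universal property is applied to the endomorphism monad of \<open>h\<close>, into
  which a homomorphism of F-algebras is the same as a natural transformation from F. A single
  extension to a monad morphism thus yields both M-algebras and the homomorphism property
  together.\<close>

lemma free_monad_extend:
  assumes free: "free_monad C F M \<eta>"
    and a: "algebra C F A a" and b: "algebra C F B b" and h: "alg_hom C F a b h"
  shows "\<exists>m n. monad_algebra C M A m \<and> monad_algebra C M B n \<and>
           m \<cdot> \<eta> A = a \<and> n \<cdot> \<eta> B = b \<and> alg_hom C M m n h"
proof -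
  let ?D = "\<lambda>i. if i then A else B" and ?a = "\<lambda>i. if i then a else b"
  interpret codensity u C ?D h
    using algebraD[OF a] algebraD[OF b] alg_homD[OF h] by (intro codensityI) (simp add: hom_iff)
  have \<eta>: "nat_trans C C F M \<eta>"
    using free unfolding free_monad_def by blast
  interpret \<eta>: nat_trans C C F M \<eta> by (rule \<eta>)
  have pair: "alg_pair F ?a"
    using a b h unfolding alg_pair_def by simp
  have F: "is_functor C C F" ..
  obtain \<alpha> where \<alpha>: "monad_morphism C M N \<alpha>"
    and eq: "\<And>X. X \<in> Obj C \<Longrightarrow> \<alpha> X \<cdot> \<eta> X = alg_arrow F ?a X"
    using free_monad_exists[OF free N_is_monad alg_arrow_nat[OF F pair]] by blast
  interpret \<alpha>: monad_morphism C M N \<alpha> by (rule \<alpha>)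
  have \<alpha>n: "nat_trans C C M N \<alpha>" ..
  have "?a i = alg_of \<alpha> i \<cdot> \<eta> (?D i)" for i
    using alg_of_comp[OF \<alpha>n \<eta> eq] alg_of_arrow[OF F pair] by simp
  from this[of True] this[of False] show ?thesis
    using alg_of_monad_algebra[OF \<alpha>, of True] alg_of_monad_algebra[OF \<alpha>, of False]
      alg_of_hom[OF \<alpha>n]
    by auto
qed

text \<open>With the identity of \<open>A\<close> as the arrow, M-algebras on \<open>A\<close>
  become monad morphisms into one endomorphism monad, where \<open>free_monad_unique\<close>
  applies.\<close>

lemma free_monad_determined:
  assumes free: "free_monad C F M \<eta>"
    and m: "monad_algebra C M A m" and n: "monad_algebra C M A n"
    and eq: "m \<cdot> \<eta> A = n \<cdot> \<eta> A"
  shows "m = n"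
proof -
  note A = monad_algebraD[OF m] and B = monad_algebraD[OF n]
  interpret codensity u C "\<lambda>_. A" "Ident C A"
    using A by (intro codensityI) (simp add: hom_iff)
  have \<eta>: "nat_trans C C F M \<eta>" and M: "is_monad C M"
    using free unfolding free_monad_def by blast+
  interpret \<eta>: nat_trans C C F M \<eta> by (rule \<eta>)
  interpret M: is_monad C M by (rule M)
  have MF: "is_functor C C M" ..
  let ?\<alpha> = "\<lambda>m. alg_arrow M (\<lambda>_. m)"
  have morph: "monad_morphism C M N (?\<alpha> m)" and of_arr: "alg_of (?\<alpha> m) i = m"
    if "monad_algebra C M A m" for m i
  proof -
    have hom: "alg_hom C M m m (Ident C A)"
      using monad_algebraD[OF that] by (simp add: alg_hom_def)
    then have "alg_pair M (\<lambda>_. m)"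
      using that by (simp add: alg_pair_def monad_algebra_def)
    then show "alg_of (?\<alpha> m) i = m"
      by (rule alg_of_arrow[OF MF])
    show "monad_morphism C M N (?\<alpha> m)"
      using that hom by (intro alg_arrow_morphism[OF M]) auto
  qed
  have nat: "nat_trans C C M N (?\<alpha> m)" if "monad_algebra C M A m" for m
    using morph[OF that] by (simp add: monad_morphism_def)
  have 1: "?\<alpha> m X \<cdot> \<eta> X = ?\<alpha> n X \<cdot> \<eta> X" if X: "X \<in> Obj C" for X
  proof (rule alg_of_inj[OF nat_trans_comp[OF \<eta> nat[OF m]] nat_trans_comp[OF \<eta> nat[OF n]] _ X])
    fix i
    show "alg_of (\<lambda>X. ?\<alpha> m X \<cdot> \<eta> X) i = alg_of (\<lambda>X. ?\<alpha> n X \<cdot> \<eta> X) i"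
      using alg_of_comp[OF nat[OF m] \<eta> refl, of i] alg_of_comp[OF nat[OF n] \<eta> refl, of i]
        of_arr[OF m] of_arr[OF n] eq by simp
  qed
  have "?\<alpha> m A = ?\<alpha> n A"
    using 1 A(1) nat_trans_comp[OF \<eta> nat[OF m]]
    by (intro free_monad_unique[OF free _ morph[OF m] morph[OF n]]) auto
  then show ?thesis
    using of_arr[OF m] of_arr[OF n] by (simp add: alg_of_def)
qed

theorem free_monad_alg:
  assumes free: "free_monad C F M \<eta>" and a: "algebra C F A a"
  shows "\<exists>m. monad_algebra C M A m \<and> m \<cdot> \<eta> A = a"
proof -
  have "is_functor C C F"
    using free unfolding free_monad_def nat_trans_def by blast
  then interpret F: is_functor C C F .
  have "alg_hom C F a a (Ident C A)"
    using algebraD[OF a] by (simp add: alg_hom_def)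
  from free_monad_extend[OF free a a this] show ?thesis by blast
qed

text \<open>\<open>free_monad_extend\<close> makes \<open>h\<close> a homomorphism for some
  extensions of the two F-algebras, and \<open>free_monad_determined\<close> identifies these with
  \<open>m\<close> and \<open>n\<close>.\<close>

theorem free_monad_hom:
  assumes free: "free_monad C F M \<eta>"
    and m: "monad_algebra C M A m" and n: "monad_algebra C M B n"
    and h: "alg_hom C F (m \<cdot> \<eta> A) (n \<cdot> \<eta> B) h"
  shows "alg_hom C M m n h"
proof -
  have \<eta>: "nat_trans C C F M \<eta>"
    using free unfolding free_monad_def by blast
  note a = nat_trans_algebra[OF \<eta> monad_algebraD(7)[OF m]]
    and b = nat_trans_algebra[OF \<eta> monad_algebraD(7)[OF n]]
  obtain m' n' where mn: "monad_algebra C M A m'" "monad_algebra C M B n'"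
    "m' \<cdot> \<eta> A = m \<cdot> \<eta> A" "n' \<cdot> \<eta> B = n \<cdot> \<eta> B" and hom: "alg_hom C M m' n' h"
    using free_monad_extend[OF free a b h] by blast
  have "m' = m" "n' = n"
    using free_monad_determined[OF free] m n mn by blast+
  then show ?thesis using hom by simp
qed

text \<open>Structures of both kinds for which \<open>h\<close> is a homomorphism are two monad
  morphisms into the endomorphism monad of \<open>h\<close>, and the coproduct copairs them.\<close>

lemma monad_coproduct_extend:
  assumes cop: "monad_coproduct C M\<^sub>1 M\<^sub>2 P i\<^sub>1 i\<^sub>2"
    and a: "monad_algebra C M\<^sub>1 A a\<^sub>1" "monad_algebra C M\<^sub>2 A a\<^sub>2"
    and b: "monad_algebra C M\<^sub>1 B b\<^sub>1" "monad_algebra C M\<^sub>2 B b\<^sub>2"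
    and h: "alg_hom C M\<^sub>1 a\<^sub>1 b\<^sub>1 h" "alg_hom C M\<^sub>2 a\<^sub>2 b\<^sub>2 h"
  shows "\<exists>m n. monad_algebra C P A m \<and> monad_algebra C P B n \<and>
           m \<cdot> i\<^sub>1 A = a\<^sub>1 \<and> m \<cdot> i\<^sub>2 A = a\<^sub>2 \<and> n \<cdot> i\<^sub>1 B = b\<^sub>1 \<and> n \<cdot> i\<^sub>2 B = b\<^sub>2 \<and>
           alg_hom C P m n h"
proof -
  let ?D = "\<lambda>i. if i then A else B"
    and ?a\<^sub>1 = "\<lambda>i. if i then a\<^sub>1 else b\<^sub>1" and ?a\<^sub>2 = "\<lambda>i. if i then a\<^sub>2 else b\<^sub>2"
  interpret codensity u C ?D h
    using monad_algebraD[OF a(1)] monad_algebraD[OF b(1)] alg_homD[OF h(1)]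
    by (intro codensityI) (simp add: hom_iff)
  have i1: "monad_morphism C M\<^sub>1 P i\<^sub>1" and i2: "monad_morphism C M\<^sub>2 P i\<^sub>2"
    using cop unfolding monad_coproduct_def by blast+
  interpret i1: monad_morphism C M\<^sub>1 P i\<^sub>1 by (rule i1)
  interpret i2: monad_morphism C M\<^sub>2 P i\<^sub>2 by (rule i2)
  have M: "is_monad C M\<^sub>1" "is_functor C C M\<^sub>1" "is_monad C M\<^sub>2" "is_functor C C M\<^sub>2" ..
  have pair: "alg_pair M\<^sub>1 ?a\<^sub>1" "alg_pair M\<^sub>2 ?a\<^sub>2"
    using a b h unfolding alg_pair_def monad_algebra_def by simp_all
  have "monad_morphism C M\<^sub>1 N (alg_arrow M\<^sub>1 ?a\<^sub>1)"
    using a b h by (intro alg_arrow_morphism[OF M(1)]) auto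
  moreover have "monad_morphism C M\<^sub>2 N (alg_arrow M\<^sub>2 ?a\<^sub>2)"
    using a b h by (intro alg_arrow_morphism[OF M(3)]) auto
  ultimately obtain \<alpha> where \<alpha>: "monad_morphism C P N \<alpha>"
    and eq1: "\<And>X. X \<in> Obj C \<Longrightarrow> \<alpha> X \<cdot> i\<^sub>1 X = alg_arrow M\<^sub>1 ?a\<^sub>1 X"
    and eq2: "\<And>X. X \<in> Obj C \<Longrightarrow> \<alpha> X \<cdot> i\<^sub>2 X = alg_arrow M\<^sub>2 ?a\<^sub>2 X"
    using monad_coproduct_exists[OF cop] by blast
  interpret \<alpha>: monad_morphism C P N \<alpha> by (rule \<alpha>)
  have nats: "nat_trans C C P N \<alpha>" "nat_trans C C M\<^sub>1 P i\<^sub>1" "nat_trans C C M\<^sub>2 P i\<^sub>2" ..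
  have "?a\<^sub>1 i = alg_of \<alpha> i \<cdot> i\<^sub>1 (?D i)" "?a\<^sub>2 i = alg_of \<alpha> i \<cdot> i\<^sub>2 (?D i)" for i
    using alg_of_comp[OF nats(1,2) eq1] alg_of_arrow[OF M(2) pair(1)]
      alg_of_comp[OF nats(1,3) eq2] alg_of_arrow[OF M(4) pair(2)] by simp_all
  from this[of True] this[of False] show ?thesis
    using alg_of_monad_algebra[OF \<alpha>, of True] alg_of_monad_algebra[OF \<alpha>, of False]
      alg_of_hom[OF nats(1)]
    by auto
qed

lemma monad_coproduct_determined:
  assumes cop: "monad_coproduct C M\<^sub>1 M\<^sub>2 P i\<^sub>1 i\<^sub>2"
    and m: "monad_algebra C P A m" and n: "monad_algebra C P A n"
    and eq: "m \<cdot> i\<^sub>1 A = n \<cdot> i\<^sub>1 A" "m \<cdot> i\<^sub>2 A = n \<cdot> i\<^sub>2 A"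
  shows "m = n"
proof -
  note A = monad_algebraD[OF m] and B = monad_algebraD[OF n]
  interpret codensity u C "\<lambda>_. A" "Ident C A"
    using A by (intro codensityI) (simp add: hom_iff)
  have i1: "monad_morphism C M\<^sub>1 P i\<^sub>1" and i2: "monad_morphism C M\<^sub>2 P i\<^sub>2"
    using cop unfolding monad_coproduct_def by blast+
  interpret i1: monad_morphism C M\<^sub>1 P i\<^sub>1 by (rule i1)
  interpret i2: monad_morphism C M\<^sub>2 P i\<^sub>2 by (rule i2)
  have P: "is_monad C P" "is_functor C C P" ..
  let ?\<alpha> = "\<lambda>M m. alg_arrow M (\<lambda>_. m)"
  have morph: "monad_morphism C M N (?\<alpha> M m)" and of_arr: "alg_of (?\<alpha> M m) i = m"
    if "is_monad C M" "monad_algebra C M A m" for M m i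
  proof -
    interpret M: is_monad C M by fact
    have hom: "alg_hom C M m m (Ident C A)"
      using monad_algebraD[OF that(2)] by (simp add: alg_hom_def)
    then have "alg_pair M (\<lambda>_. m)"
      using that by (simp add: alg_pair_def monad_algebra_def)
    then show "alg_of (?\<alpha> M m) i = m"
      by (rule alg_of_arrow[OF M.M.is_functor_axioms])
    show "monad_morphism C M N (?\<alpha> M m)"
      using that hom by (intro alg_arrow_morphism[OF that(1)]) auto
  qed
  have nat: "nat_trans C C M N (?\<alpha> M m)" if "is_monad C M" "monad_algebra C M A m" for M m
    using morph[OF that] by (simp add: monad_morphism_def)
  \<comment> \<open>Precomposing the classifying monad morphism with an injection classifies the
    restricted algebra, since both sides have the same \<open>alg_of\<close>.\<close>
  have restrict: "?\<alpha> P m X \<cdot> \<iota> X = ?\<alpha> M (m \<cdot> \<iota> A) X"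
    if \<iota>: "monad_morphism C M P \<iota>" and m: "monad_algebra C P A m" and X: "X \<in> Obj C" for M \<iota> m X
  proof -
    interpret \<iota>: monad_morphism C M P \<iota> by (rule \<iota>)
    have M: "is_monad C M" and \<iota>n: "nat_trans C C M P \<iota>" ..
    note m' = monad_morphism_algebra[OF \<iota> m]
    show ?thesis
    proof (rule alg_of_inj[OF nat_trans_comp[OF \<iota>n nat[OF P(1) m]] nat[OF M m'] _ X])
      fix i
      show "alg_of (\<lambda>X. ?\<alpha> P m X \<cdot> \<iota> X) i = alg_of (?\<alpha> M (m \<cdot> \<iota> A)) i"
        using alg_of_comp[OF nat[OF P(1) m] \<iota>n refl, of i] of_arr[OF P(1) m]
          of_arr[OF M m'] by simp
    qed
  qed
  have f: "monad_morphism C M\<^sub>1 N (?\<alpha> M\<^sub>1 (m \<cdot> i\<^sub>1 A))"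
    and g: "monad_morphism C M\<^sub>2 N (?\<alpha> M\<^sub>2 (m \<cdot> i\<^sub>2 A))"
    using morph monad_morphism_algebra[OF i1 m] monad_morphism_algebra[OF i2 m]
      i1.M.is_monad_axioms i2.M.is_monad_axioms by blast+
  have "?\<alpha> P m A = ?\<alpha> P n A"
    using restrict[OF i1 m] restrict[OF i2 m] restrict[OF i1 n] restrict[OF i2 n] eq
    by (intro monad_coproduct_unique[OF cop f g morph[OF P(1) m] morph[OF P(1) n] _ _ _ _ A(1)])
      auto
  then show ?thesis
    using of_arr[OF P(1) m] of_arr[OF P(1) n] by (simp add: alg_of_def)
qed

theorem monad_coproduct_alg:
  assumes cop: "monad_coproduct C M\<^sub>1 M\<^sub>2 P i\<^sub>1 i\<^sub>2"
    and a: "monad_algebra C M\<^sub>1 A a\<^sub>1" "monad_algebra C M\<^sub>2 A a\<^sub>2"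
  shows "\<exists>m. monad_algebra C P A m \<and> m \<cdot> i\<^sub>1 A = a\<^sub>1 \<and> m \<cdot> i\<^sub>2 A = a\<^sub>2"
proof -
  have "is_functor C C M\<^sub>1" "is_functor C C M\<^sub>2"
    using cop unfolding monad_coproduct_def monad_morphism_def is_monad_def by blast+
  then interpret M1: is_functor C C M\<^sub>1 + M2: is_functor C C M\<^sub>2 .
  have "alg_hom C M\<^sub>1 a\<^sub>1 a\<^sub>1 (Ident C A)" "alg_hom C M\<^sub>2 a\<^sub>2 a\<^sub>2 (Ident C A)"
    using monad_algebraD[OF a(1)] monad_algebraD[OF a(2)] by (simp_all add: alg_hom_def)
  from monad_coproduct_extend[OF cop a a this] show ?thesis by blast
qed

theorem monad_coproduct_hom:
  assumes cop: "monad_coproduct C M\<^sub>1 M\<^sub>2 P i\<^sub>1 i\<^sub>2"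
    and m: "monad_algebra C P A m" and n: "monad_algebra C P B n"
    and h: "alg_hom C M\<^sub>1 (m \<cdot> i\<^sub>1 A) (n \<cdot> i\<^sub>1 B) h" "alg_hom C M\<^sub>2 (m \<cdot> i\<^sub>2 A) (n \<cdot> i\<^sub>2 B) h"
  shows "alg_hom C P m n h"
proof -
  have i1: "monad_morphism C M\<^sub>1 P i\<^sub>1" and i2: "monad_morphism C M\<^sub>2 P i\<^sub>2"
    using cop unfolding monad_coproduct_def by blast+
  note a = monad_morphism_algebra[OF i1 m] monad_morphism_algebra[OF i2 m]
    and b = monad_morphism_algebra[OF i1 n] monad_morphism_algebra[OF i2 n]
  obtain m' n' where mn: "monad_algebra C P A m'" "monad_algebra C P B n'"
    "m' \<cdot> i\<^sub>1 A = m \<cdot> i\<^sub>1 A" "n' \<cdot> i\<^sub>1 B = n \<cdot> i\<^sub>1 B"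
    "m' \<cdot> i\<^sub>2 A = m \<cdot> i\<^sub>2 A" "n' \<cdot> i\<^sub>2 B = n \<cdot> i\<^sub>2 B" and hom: "alg_hom C P m' n' h"
    using monad_coproduct_extend[OF cop a b h] by blast
  have "m' = m" "n' = n"
    using monad_coproduct_determined[OF cop] m n mn by blast+
  then show ?thesis using hom by simp
qed

end


section \<open>Distributive laws from liftings\<close>

context is_functor
begin

lemma fa_eq:
  assumes "g \<cdot>\<^bsub>A\<^esub> f = k" "f \<in> Arr A" "g \<in> Arr A" "Dom A g = Cod A f"
  shows "fa F g \<cdot>\<^bsub>B\<^esub> fa F f = fa F k"
  using assms fa_comp by metis

end

lemma (in is_monad) free_algebra: "X \<in> Obj C \<Longrightarrow> monad_algebra C M (fo M X) (mult M X)"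
  using unit_left mult_assoc by (simp add: monad_algebra_def algebra_def)

lemma (in is_monad) mult_hom:
  "X \<in> Obj C \<Longrightarrow> monad_algebra C M X a \<Longrightarrow> alg_hom C M (mult M X) a a"
  using monad_algebraD[of C M X a] by (simp add: alg_hom_def)

lemma (in is_monad) free_hom:
  assumes "f \<in> Arr C" "Dom C f = X" "Cod C f = Y"
  shows "alg_hom C M (mult M X) (mult M Y) (fa M f)"
proof -
  have "X \<in> Obj C" "Y \<in> Obj C" using assms by auto
  then show ?thesis using assms mult.nat[OF assms(1)] by (simp add: alg_hom_def)
qed

lemma alg_hom_comp:
  assumes "is_functor C C F" "algebra C F A a" "algebra C F A' b" "algebra C F A'' c"
    "alg_hom C F a b f" "alg_hom C F b c g"
  shows "alg_hom C F a c (g \<cdot>\<^bsub>C\<^esub> f)"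
proof -
  interpret is_functor C C F by fact
  note a = algebraD[OF assms(2)] and b = algebraD[OF assms(3)] and c = algebraD[OF assms(4)]
    and f = alg_homD[OF assms(5)] and g = alg_homD[OF assms(6)]
  have "(g \<cdot>\<^bsub>C\<^esub> f) \<cdot>\<^bsub>C\<^esub> a = g \<cdot>\<^bsub>C\<^esub> (b \<cdot>\<^bsub>C\<^esub> fa F f)"
    using a b c f g by simp
  also have "\<dots> = (c \<cdot>\<^bsub>C\<^esub> fa F g) \<cdot>\<^bsub>C\<^esub> fa F f"
    using a b c f g by (intro A.Comp_reassoc) auto
  finally show ?thesis
    using a b c f g by (simp add: alg_hom_def fa_comp)
qed

text \<open>The lifted monad acts on carriers and on arrows as S does, so only structure arrows need
  a new operation \<Lambda>. The rest of a lifting is the statement that arrows already present are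
  homomorphisms.\<close>

locale monad_lifting = P: is_monad C P + S: is_monad C S
  for C :: "('o, 'a) cat" (structure) and P S :: "('o, 'a) monad" +
  fixes \<Lambda> :: "'a \<Rightarrow> 'a"
  assumes lift_alg: "monad_algebra C P A p \<Longrightarrow> monad_algebra C P (fo S A) (\<Lambda> p)"
    and lift_hom: "monad_algebra C P A p \<Longrightarrow> monad_algebra C P B q \<Longrightarrow> alg_hom C P p q f \<Longrightarrow>
                     alg_hom C P (\<Lambda> p) (\<Lambda> q) (fa S f)"
    and lift_unit: "monad_algebra C P A p \<Longrightarrow> alg_hom C P p (\<Lambda> p) (unit S A)"
    and lift_mult: "monad_algebra C P A p \<Longrightarrow> alg_hom C P (\<Lambda> (\<Lambda> p)) (\<Lambda> p) (mult S A)"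
begin

text \<open>The homomorphism from the free P-algebra on \<open>fo S X\<close> to the lifted free
  algebra that extends \<open>fa S (unit P X)\<close>.\<close>

definition law :: "'o \<Rightarrow> 'a" where
  "law X = \<Lambda> (mult P X) \<cdot> fa P (fa S (unit P X))"

lemma lift_arr:
  assumes "monad_algebra C P A p"
  shows "\<Lambda> p \<in> Arr C" "Dom C (\<Lambda> p) = fo P (fo S A)" "Cod C (\<Lambda> p) = fo S A"
  using monad_algebraD[OF lift_alg[OF assms]] by auto

lemma lift_free [simp]:
  assumes "X \<in> Obj C"
  shows "\<Lambda> (mult P X) \<in> Arr C" "Dom C (\<Lambda> (mult P X)) = fo P (fo S (fo P X))"
    "Cod C (\<Lambda> (mult P X)) = fo S (fo P X)"
  using lift_arr[OF P.free_algebra[OF assms]] by auto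

lemma law_arr [simp]:
  assumes "X \<in> Obj C"
  shows "law X \<in> Arr C" "Dom C (law X) = fo P (fo S X)" "Cod C (law X) = fo S (fo P X)"
  using assms by (simp_all add: law_def)

lemma law_hom:
  assumes X: "X \<in> Obj C"
  shows "alg_hom C P (mult P (fo S X)) (\<Lambda> (mult P X)) (law X)"
proof -
  have "alg_hom C P (mult P (fo S X)) (mult P (fo S (fo P X))) (fa P (fa S (unit P X)))"
    using X by (intro P.free_hom) auto
  moreover have "alg_hom C P (mult P (fo S (fo P X))) (\<Lambda> (mult P X)) (\<Lambda> (mult P X))"
    using X by (intro P.mult_hom lift_alg P.free_algebra) auto
  ultimately show ?thesis
    unfolding law_def
    using X monad_algebraD(7)[OF lift_alg[OF P.free_algebra[OF X]]]
    by (intro alg_hom_comp[where A = "fo P (fo S X)" and A' = "fo P (fo S (fo P X))"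
          and A'' = "fo S (fo P X)", OF P.M.is_functor_axioms]) (auto simp: algebra_def)
qed

lemma law_nat: "nat_trans C C (P \<odot> S) (S \<odot> P) law"
proof (rule nat_transI[OF comp_functor[OF S.M.is_functor_axioms P.M.is_functor_axioms]
      comp_functor[OF P.M.is_functor_axioms S.M.is_functor_axioms]])
  fix f assume f: "f \<in> Arr C"
  let ?X = "Dom C f" and ?Y = "Cod C f"
  have XY: "?X \<in> Obj C" "?Y \<in> Obj C" using f by auto
  have hom: "fa S (fa P f) \<cdot> \<Lambda> (mult P ?X) = \<Lambda> (mult P ?Y) \<cdot> fa P (fa S (fa P f))"
    using alg_homD(4)[OF lift_hom[OF P.free_algebra[OF XY(1)] P.free_algebra[OF XY(2)]
          P.free_hom[OF f refl refl]]] .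
  have u: "unit P ?Y \<cdot> f = fa P f \<cdot> unit P ?X"
    using P.unit.nat[OF f] by simp
  have "fa S (fa P f) \<cdot> law ?X = (\<Lambda> (mult P ?Y) \<cdot> fa P (fa S (fa P f))) \<cdot> fa P (fa S (unit P ?X))"
    unfolding law_def using f by (intro P.M.A.Comp_reassoc hom) auto
  also have "\<dots> = \<Lambda> (mult P ?Y) \<cdot> fa P (fa S (fa P f \<cdot> unit P ?X))"
    using f by (simp add: P.M.fa_comp S.M.fa_comp)
  also have "\<dots> = law ?Y \<cdot> fa P (fa S f)"
    unfolding law_def u[symmetric] using f by (simp add: P.M.fa_comp S.M.fa_comp)
  finally show "law ?Y \<cdot> fa (P \<odot> S) f = fa (S \<odot> P) f \<cdot> law ?X"
    by simp
qed (simp add: hom_iff)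

theorem lifting_distributive_law: "distributive_law C P S law"
proof -
  interpret nat_trans C C "P \<odot> S" "S \<odot> P" law by (rule law_nat)
  show ?thesis
  proof
    fix X assume X: "X \<in> Obj C"
    let ?p = "\<Lambda> (mult P X)" and ?\<eta> = "unit P X"
    note free = P.free_algebra[OF X]
    note p = monad_algebraD[OF lift_alg[OF free]]
    have "law X \<cdot> unit P (fo S X) = ?p \<cdot> (unit P (fo S (fo P X)) \<cdot> fa S ?\<eta>)"
      using X P.unit.nat[of "fa S ?\<eta>"] by (simp add: law_def)
    also have "\<dots> = Ident C (fo S (fo P X)) \<cdot> fa S ?\<eta>"
      using X p by (intro P.M.A.Comp_reassoc) auto
    finally show "law X \<cdot> unit P (fo S X) = fa S ?\<eta>"
      using X by simp
    have "law X \<cdot> fa P (unit S X) = ?p \<cdot> fa P (fa S ?\<eta> \<cdot> unit S X)"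
      using X by (simp add: law_def P.M.fa_comp)
    also have "fa S ?\<eta> \<cdot> unit S X = unit S (fo P X) \<cdot> ?\<eta>"
      using S.unit.nat[of ?\<eta>] X by simp
    also have "?p \<cdot> fa P (unit S (fo P X) \<cdot> ?\<eta>) = (unit S (fo P X) \<cdot> mult P X) \<cdot> fa P ?\<eta>"
      using alg_homD(4)[OF lift_unit[OF free]] X
        P.M.A.Comp_reassoc[of ?p "fa P (unit S (fo P X))" _ "fa P ?\<eta>"]
      by (simp add: P.M.fa_comp)
    also have "\<dots> = unit S (fo P X)"
      using X P.unit_right[OF X] by simp
    finally show "law X \<cdot> fa P (unit S X) = unit S (fo P X)" .
    \<comment> \<open>With this identity, compatibility with \<open>mult P\<close> says exactly that
      \<open>law X\<close> is a homomorphism, which is \<open>law_hom\<close>.\<close>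
    have "fa S (mult P X) \<cdot> law (fo P X) = ?p"
    proof -
      have "fa S (mult P X) \<cdot> law (fo P X) =
          (?p \<cdot> fa P (fa S (mult P X))) \<cdot> fa P (fa S (unit P (fo P X)))"
        unfolding law_def
        using alg_homD(4)[OF lift_hom[OF P.free_algebra[OF P.M.fo_Obj[OF X]] free
              P.mult_hom[OF P.M.fo_Obj[OF X] free]]] X
        by (intro P.M.A.Comp_reassoc) auto
      also have "\<dots> = ?p \<cdot> fa P (fa S (mult P X \<cdot> unit P (fo P X)))"
        using X by (simp add: P.M.fa_comp S.M.fa_comp)
      finally show ?thesis
        using X p P.unit_left[OF X] by simp
    qed
    then have "(fa S (mult P X) \<cdot> law (fo P X)) \<cdot> fa P (law X) = ?p \<cdot> fa P (law X)"
      by simp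
    moreover have "law X \<cdot> mult P (fo S X) = ?p \<cdot> fa P (law X)"
      using alg_homD(4)[OF law_hom[OF X]] .
    ultimately show "law X \<cdot> mult P (fo S X) = fa S (mult P X) \<cdot> law (fo P X) \<cdot> fa P (law X)"
      using X by simp
    let ?q = "\<Lambda> ?p"
    note q = monad_algebraD[OF lift_alg[OF lift_alg[OF free]]]
    have SX: "fo S X \<in> Obj C" using X by simp
    \<comment> \<open>\<open>law X\<close> is itself a homomorphism, from a free algebra to a lifted
      one, so \<open>lift_hom\<close> applies to it and moves \<open>fa S (law X)\<close> past
      \<Lambda>.\<close>
    have "fa S (law X) \<cdot> law (fo S X) =
        (?q \<cdot> fa P (fa S (law X))) \<cdot> fa P (fa S (unit P (fo S X)))"
      unfolding law_def[of "fo S X"]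
      using alg_homD(4)[OF lift_hom[OF P.free_algebra[OF SX] lift_alg[OF free] law_hom[OF X]]] X
      by (intro P.M.A.Comp_reassoc) auto
    also have "\<dots> = ?q \<cdot> fa P (fa S (law X \<cdot> unit P (fo S X)))"
      using X q by (simp add: P.M.fa_comp S.M.fa_comp)
    also have "law X \<cdot> unit P (fo S X) = fa S ?\<eta>"
      by fact
    finally have 1: "fa S (law X) \<cdot> law (fo S X) = ?q \<cdot> fa P (fa S (fa S ?\<eta>))" .
    have "law X \<cdot> fa P (mult S X) = ?p \<cdot> fa P (fa S ?\<eta> \<cdot> mult S X)"
      using X by (simp add: law_def P.M.fa_comp)
    also have "fa S ?\<eta> \<cdot> mult S X = mult S (fo P X) \<cdot> fa S (fa S ?\<eta>)"
      using S.mult.nat[of ?\<eta>] X by simp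
    also have "?p \<cdot> fa P (mult S (fo P X) \<cdot> fa S (fa S ?\<eta>)) =
        (mult S (fo P X) \<cdot> ?q) \<cdot> fa P (fa S (fa S ?\<eta>))"
      using alg_homD(4)[OF lift_mult[OF free]] X q
        P.M.A.Comp_reassoc[of ?p "fa P (mult S (fo P X))" _ "fa P (fa S (fa S ?\<eta>))"]
      by (simp add: P.M.fa_comp)
    also have "\<dots> = mult S (fo P X) \<cdot> fa S (law X) \<cdot> law (fo S X)"
      using X q 1 by simp
    finally show "law X \<cdot> fa P (mult S X) = mult S (fo P X) \<cdot> fa S (law X) \<cdot> law (fo S X)" .
  qed
qed

end

section \<open>The composite monad of a distributive law\<close>

context distributive_law
begin

abbreviation "ST \<equiv> composite_monad C S T \<delta>"

lemma composite_simps [simp]: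
  "fo ST X = fo S (fo T X)" "fa ST f = fa S (fa T f)"
  "unit ST X = unit S (fo T X) \<cdot> unit T X"
  "mult ST X = mult S (fo T X) \<cdot> fa S (fa S (mult T X)) \<cdot> fa S (\<delta> (fo T X))"
  by (simp_all add: composite_monad_def)

lemma composite_functor: "is_functor C C ST"
  by unfold_locales (auto simp: hom_iff T.M.fa_comp S.M.fa_comp)

lemma composite_mult_nat:
  assumes f: "f \<in> Arr C"
  shows "mult ST (Cod C f) \<cdot> fa S (fa T (fa S (fa T f))) = fa S (fa T f) \<cdot> mult ST (Dom C f)"
proof -
  let ?X = "Dom C f" and ?Y = "Cod C f"
  have "\<delta> (fo T ?Y) \<cdot> fa T (fa S (fa T f)) = fa S (fa T (fa T f)) \<cdot> \<delta> (fo T ?X)"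
    using nat[of "fa T f"] f by simp
  from S.M.fa_eq[OF this]
  have 1: "fa S (\<delta> (fo T ?Y)) \<cdot> fa S (fa T (fa S (fa T f))) =
      fa S (fa S (fa T (fa T f))) \<cdot> fa S (\<delta> (fo T ?X))"
    using f by (simp add: S.M.fa_comp)
  have "mult T ?Y \<cdot> fa T (fa T f) = fa T f \<cdot> mult T ?X"
    using T.mult.nat[OF f] by simp
  then have 2: "fa S (fa S (mult T ?Y)) \<cdot> fa S (fa S (fa T (fa T f))) =
      fa S (fa S (fa T f)) \<cdot> fa S (fa S (mult T ?X))"
    using f by (simp add: S.M.fa_comp[symmetric])
  have 3: "mult S (fo T ?Y) \<cdot> fa S (fa S (fa T f)) = fa S (fa T f) \<cdot> mult S (fo T ?X)"
    using S.mult.nat[of "fa T f"] f by simp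
  show ?thesis
    using f by (simp add: 1 2 3 T.M.A.Comp_reassoc[OF 2] T.M.A.Comp_reassoc[OF 3])
qed

lemma composite_unit_nat: "nat_trans C C id_ftor ST (unit ST)"
proof (rule nat_transI[OF T.M.A.id_functor composite_functor])
  fix f assume f: "f \<in> Arr C"
  have 1: "unit T (Cod C f) \<cdot> f = fa T f \<cdot> unit T (Dom C f)"
    using T.unit.nat[OF f] by simp
  have 2: "unit S (fo T (Cod C f)) \<cdot> fa T f = fa S (fa T f) \<cdot> unit S (fo T (Dom C f))"
    using S.unit.nat[of "fa T f"] f by simp
  show "unit ST (Cod C f) \<cdot> fa id_ftor f = fa ST f \<cdot> unit ST (Dom C f)"
    using f by (simp add: 1 T.M.A.Comp_reassoc[OF 2])
qed (simp add: hom_iff)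

theorem composite_is_monad: "is_monad C ST"
proof -
  interpret ST: is_functor C C ST by (rule composite_functor)
  interpret u: nat_trans C C id_ftor ST "unit ST" by (rule composite_unit_nat)
  have "nat_trans C C (ST \<odot> ST) ST (mult ST)"
    using composite_mult_nat
    by (intro nat_transI comp_functor[OF composite_functor composite_functor] composite_functor)
      (simp_all add: hom_iff)
  then interpret m: nat_trans C C "ST \<odot> ST" ST "mult ST" .
  show ?thesis
  proof
    fix X assume X: "X \<in> Obj C"
    let ?TX = "fo T X" and ?\<mu> = "mult S (fo T X)" and ?m = "mult T X"
    have TX: "?TX \<in> Obj C" using X by simp
    have 1: "fa S (\<delta> ?TX) \<cdot> unit S (fo T (fo S ?TX)) = unit S (fo S (fo T ?TX)) \<cdot> \<delta> ?TX"
      using S.unit.nat[of "\<delta> ?TX"] X by simp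
    have 2: "fa S (fa S ?m) \<cdot> unit S (fo S (fo T ?TX)) = unit S (fo S ?TX) \<cdot> fa S ?m"
      using S.unit.nat[of "fa S ?m"] X by simp
    have 3: "fa S ?m \<cdot> fa S (unit T ?TX) = Ident C (fo S ?TX)"
      using S.M.fa_eq[OF T.unit_left[OF X]] X by simp
    show "mult ST X \<cdot> unit ST (fo ST X) = Ident C (fo ST X)"
      using X 3 law_unit_T[OF TX] S.unit_left[OF TX]
      by (simp add: T.M.A.Comp_reassoc[OF 1] T.M.A.Comp_reassoc[OF 2]
          T.M.A.Comp_reassoc[OF S.unit_left[OF TX]])
    have 4: "fa S (\<delta> ?TX) \<cdot> fa S (fa T (unit S ?TX)) = fa S (unit S (fo T ?TX))"
      using S.M.fa_eq[OF law_unit_S[OF TX]] X by simp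
    have "fa S ?m \<cdot> unit S (fo T ?TX) = unit S ?TX \<cdot> ?m"
      using S.unit.nat[of ?m] X by simp
    from S.M.fa_eq[OF this]
    have 5: "fa S (fa S ?m) \<cdot> fa S (unit S (fo T ?TX)) = fa S (unit S ?TX) \<cdot> fa S ?m"
      using X by (simp add: S.M.fa_comp)
    have 6: "fa S ?m \<cdot> fa S (fa T (unit T X)) = Ident C (fo S ?TX)"
      using S.M.fa_eq[OF T.unit_right[OF X]] X by simp
    show "mult ST X \<cdot> fa ST (unit ST X) = Ident C (fo ST X)"
      using X 6 S.unit_right[OF TX]
      by (simp add: S.M.fa_comp T.M.fa_comp T.M.A.Comp_reassoc[OF 4]
          T.M.A.Comp_reassoc[OF 5] T.M.A.Comp_reassoc[OF S.unit_right[OF TX]])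
    let ?STX = "fo S ?TX"
    have STX: "?STX \<in> Obj C" and TTX: "fo T ?TX \<in> Obj C" using X by auto
    \<comment> \<open>Common normal form of both sides of associativity: all instances of \<delta>
      act first, then the multiplications of T, then those of S.\<close>
    let ?nf = "?\<mu> \<cdot> mult S (fo S ?TX) \<cdot> fa S (fa S (fa S ?m)) \<cdot> fa S (fa S (fa S (mult T ?TX))) \<cdot>
        fa S (fa S (\<delta> (fo T ?TX))) \<cdot> fa S (fa S (fa T (\<delta> ?TX))) \<cdot> fa S (\<delta> (fo T ?STX))"
    have 7: "fa S (\<delta> ?TX) \<cdot> mult S (fo T ?STX) = mult S (fo S (fo T ?TX)) \<cdot> fa S (fa S (\<delta> ?TX))"
      using S.mult.nat[of "\<delta> ?TX"] X by simp
    have 8: "fa S (fa S ?m) \<cdot> mult S (fo S (fo T ?TX)) = mult S (fo S ?TX) \<cdot> fa S (fa S (fa S ?m))"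
      using S.mult.nat[of "fa S ?m"] X by simp
    have 9: "fa S (fa S (\<delta> ?TX)) \<cdot> fa S (fa S (mult T ?STX)) =
        fa S (fa S (fa S (mult T ?TX))) \<cdot> fa S (fa S (\<delta> (fo T ?TX))) \<cdot> fa S (fa S (fa T (\<delta> ?TX)))"
      using S.M.fa_eq[OF S.M.fa_eq[OF law_mult_T[OF TX]]] X by (simp add: S.M.fa_comp)
    have L: "mult ST X \<cdot> mult ST (fo ST X) = ?nf"
      using X by (simp add: T.M.A.Comp_reassoc[OF 7] T.M.A.Comp_reassoc[OF 8] T.M.A.Comp_reassoc[OF 9])
    have 10: "fa S (\<delta> ?TX) \<cdot> fa S (fa T ?\<mu>) =
        fa S (mult S (fo T ?TX)) \<cdot> fa S (fa S (\<delta> ?TX)) \<cdot> fa S (\<delta> ?STX)"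
      using S.M.fa_eq[OF law_mult_S[OF TX]] X by (simp add: S.M.fa_comp)
    have "\<delta> ?STX \<cdot> fa T (fa S (fa S ?m)) = fa S (fa T (fa S ?m)) \<cdot> \<delta> (fo S (fo T ?TX))"
      using nat[of "fa S ?m"] X by simp
    from S.M.fa_eq[OF this]
    have 11: "fa S (\<delta> ?STX) \<cdot> fa S (fa T (fa S (fa S ?m))) =
        fa S (fa S (fa T (fa S ?m))) \<cdot> fa S (\<delta> (fo S (fo T ?TX)))"
      using X by (simp add: S.M.fa_comp)
    have "\<delta> (fo S (fo T ?TX)) \<cdot> fa T (fa S (\<delta> ?TX)) = fa S (fa T (\<delta> ?TX)) \<cdot> \<delta> (fo T ?STX)"
      using nat[of "\<delta> ?TX"] X by simp
    from S.M.fa_eq[OF this]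
    have 12: "fa S (\<delta> (fo S (fo T ?TX))) \<cdot> fa S (fa T (fa S (\<delta> ?TX))) =
        fa S (fa S (fa T (\<delta> ?TX))) \<cdot> fa S (\<delta> (fo T ?STX))"
      using X by (simp add: S.M.fa_comp)
    have "\<delta> ?TX \<cdot> fa T (fa S ?m) = fa S (fa T ?m) \<cdot> \<delta> (fo T ?TX)"
      using nat[of ?m] X by simp
    from S.M.fa_eq[OF S.M.fa_eq[OF this]]
    have 13: "fa S (fa S (\<delta> ?TX)) \<cdot> fa S (fa S (fa T (fa S ?m))) =
        fa S (fa S (fa S (fa T ?m))) \<cdot> fa S (fa S (\<delta> (fo T ?TX)))"
      using X by (simp add: S.M.fa_comp)
    have "fa S ?m \<cdot> mult S (fo T ?TX) = ?\<mu> \<cdot> fa S (fa S ?m)"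
      using S.mult.nat[of ?m] X by simp
    from S.M.fa_eq[OF this]
    have 14: "fa S (fa S ?m) \<cdot> fa S (mult S (fo T ?TX)) = fa S ?\<mu> \<cdot> fa S (fa S (fa S ?m))"
      using X by (simp add: S.M.fa_comp)
    have 15: "fa S (fa S (fa S ?m)) \<cdot> fa S (fa S (fa S (fa T ?m))) =
        fa S (fa S (fa S ?m)) \<cdot> fa S (fa S (fa S (mult T ?TX)))"
      using T.mult_assoc[OF X] X by (simp add: S.M.fa_comp[symmetric])
    have R: "mult ST X \<cdot> fa ST (mult ST X) = ?nf"
      using X
      by (simp add: S.M.fa_comp T.M.fa_comp T.M.A.Comp_reassoc[OF 10] T.M.A.Comp_reassoc[OF 11]
          12 T.M.A.Comp_reassoc[OF 13] T.M.A.Comp_reassoc[OF 14] T.M.A.Comp_reassoc[OF 15]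
          T.M.A.Comp_reassoc[OF S.mult_assoc[OF TX, symmetric]])
    show "mult ST X \<cdot> mult ST (fo ST X) = mult ST X \<cdot> fa ST (mult ST X)"
      unfolding L R by (rule refl)
  qed
qed

theorem composite_injection: "monad_morphism C S ST (\<lambda>X. fa S (unit T X))"
proof -
  interpret ST: is_monad C ST by (rule composite_is_monad)
  have "nat_trans C C S ST (\<lambda>X. fa S (unit T X))"
  proof (rule nat_transI[OF S.M.is_functor_axioms composite_functor])
    fix f assume f: "f \<in> Arr C"
    have "unit T (Cod C f) \<cdot> f = fa T f \<cdot> unit T (Dom C f)"
      using T.unit.nat[OF f] by simp
    from S.M.fa_eq[OF this]
    show "fa S (unit T (Cod C f)) \<cdot> fa S f = fa ST f \<cdot> fa S (unit T (Dom C f))"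
      using f by (simp add: S.M.fa_comp)
  qed (simp add: hom_iff)
  then interpret i: nat_trans C C S ST "\<lambda>X. fa S (unit T X)" .
  show ?thesis
  proof
    fix X assume X: "X \<in> Obj C"
    let ?TX = "fo T X" and ?m = "mult T X" and ?e = "unit T X"
    have TX: "?TX \<in> Obj C" using X by simp
    show "fa S ?e \<cdot> unit S X = unit ST X"
      using S.unit.nat[of ?e] X by simp
    have 1: "fa S (\<delta> ?TX) \<cdot> fa S (unit T (fo S ?TX)) = fa S (fa S (unit T ?TX))"
      using S.M.fa_eq[OF law_unit_T[OF TX]] X by simp
    have 2: "fa S (fa S ?m) \<cdot> fa S (fa S (unit T ?TX)) = Ident C (fo S (fo S ?TX))"
      using S.M.fa_eq[OF S.M.fa_eq[OF T.unit_left[OF X]]] X by simp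
    show "fa S ?e \<cdot> mult S X = mult ST X \<cdot> fa S (unit T (fo ST X)) \<cdot> fa S (fa S ?e)"
      using S.mult.nat[of ?e] X
      by (simp add: T.M.A.Comp_reassoc[OF 1] T.M.A.Comp_reassoc[OF 2])
  qed
qed

end


section \<open>Recursion along a structural law\<close>

locale coproduct_category = category C
  for C :: "('o, 'a) cat" (structure) +
  fixes K :: "('o, 'a) coprods"
  assumes coproducts: "binary_coproducts C K"
begin

lemma csum_arr_simps [simp]:
  assumes "A \<in> Obj C" "B \<in> Obj C"
  shows "csum K A B \<in> Obj C"
    "cinl K A B \<in> Arr C" "Dom C (cinl K A B) = A" "Cod C (cinl K A B) = csum K A B"
    "cinr K A B \<in> Arr C" "Dom C (cinr K A B) = B" "Cod C (cinr K A B) = csum K A B"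
  using coproducts assms unfolding binary_coproducts_def by (auto simp: hom_iff)

lemma copair_ex1:
  assumes "f \<in> Arr C" "g \<in> Arr C" "Cod C f = Cod C g"
  shows "\<exists>!h. h \<in> hom C (csum K (Dom C f) (Dom C g)) (Cod C f) \<and>
           h \<cdot> cinl K (Dom C f) (Dom C g) = f \<and> h \<cdot> cinr K (Dom C f) (Dom C g) = g"
  using coproducts assms unfolding binary_coproducts_def by (simp add: hom_iff)

lemma copair [simp]:
  assumes "f \<in> Arr C" "g \<in> Arr C" "Cod C f = Cod C g"
  shows "copair C K f g \<in> Arr C" "Dom C (copair C K f g) = csum K (Dom C f) (Dom C g)"
    "Cod C (copair C K f g) = Cod C g"
  using theI'[OF copair_ex1[OF assms]] assms(3) unfolding copair_def by (auto simp: hom_iff)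

lemma copair_inj:
  assumes "f \<in> Arr C" "g \<in> Arr C" "Cod C f = Cod C g" "Dom C f = A" "Dom C g = B"
  shows "copair C K f g \<cdot> cinl K A B = f" "copair C K f g \<cdot> cinr K A B = g"
  using theI'[OF copair_ex1[OF assms(1-3)]] assms(4,5) unfolding copair_def by auto

lemma copair_eqI:
  assumes "h \<in> Arr C" "k \<in> Arr C" "A \<in> Obj C" "B \<in> Obj C"
    and "Dom C h = csum K A B" "Dom C k = csum K A B" "Cod C h = Cod C k"
    and "h \<cdot> cinl K A B = k \<cdot> cinl K A B" "h \<cdot> cinr K A B = k \<cdot> cinr K A B"
  shows "h = k"
  using copair_ex1[of "h \<cdot> cinl K A B" "h \<cdot> cinr K A B"] assms by (auto simp: hom_iff)

lemma copair_comp: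
  assumes "f \<in> Arr C" "g \<in> Arr C" "Cod C f = Cod C g" "h \<in> Arr C" "Dom C h = Cod C g"
  shows "h \<cdot> copair C K f g = copair C K (h \<cdot> f) (h \<cdot> g)"
  by (rule copair_eqI[of _ _ "Dom C f" "Dom C g"]) (use assms in \<open>simp_all add: copair_inj\<close>)

lemma csum_arr [simp]:
  assumes "f \<in> Arr C" "g \<in> Arr C"
  shows "csum_arr C K f g \<in> Arr C" "Dom C (csum_arr C K f g) = csum K (Dom C f) (Dom C g)"
    "Cod C (csum_arr C K f g) = csum K (Cod C f) (Cod C g)"
  using assms by (simp_all add: csum_arr_def)

lemma copair_csum:
  assumes "f \<in> Arr C" "g \<in> Arr C" "Cod C f = Cod C g"
    and "h \<in> Arr C" "k \<in> Arr C" "Cod C h = Dom C f" "Cod C k = Dom C g"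
  shows "copair C K f g \<cdot> csum_arr C K h k = copair C K (f \<cdot> h) (g \<cdot> k)"
  using assms by (simp add: csum_arr_def copair_comp
      Comp_reassoc[OF copair_inj(1)] Comp_reassoc[OF copair_inj(2)])

end

lemma prod_cat_simps [simp]:
  "Obj (prod_cat A B) = Obj A \<times> Obj B"
  "Arr (prod_cat A B) = Arr A \<times> Arr B"
  "Dom (prod_cat A B) (f, g) = (Dom A f, Dom B g)"
  "Cod (prod_cat A B) (f, g) = (Cod A f, Cod B g)"
  "Ident (prod_cat A B) (X, Y) = (Ident A X, Ident B Y)"
  "Comp (prod_cat A B) (f', g') (f, g) = (f' \<cdot>\<^bsub>A\<^esub> f, g' \<cdot>\<^bsub>B\<^esub> g)"
  by (simp_all add: prod_cat_def)

lemma law_source_simps [simp]: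
  "fo (law_source \<Sigma> \<Gamma>) (X, Y) = fo \<Gamma> (fo \<Sigma> X, Y)"
  "fa (law_source \<Sigma> \<Gamma>) (f, g) = fa \<Gamma> (fa \<Sigma> f, g)"
  by (simp_all add: law_source_def)

lemma law_target_simps [simp]:
  "fo (law_target C K S T \<Gamma>) (X, Y) = fo S (fo T (csum K (fo \<Gamma> (X, fo S (fo T Y))) (csum K X Y)))"
  "fa (law_target C K S T \<Gamma>) (f, g) = fa S (fa T
     (csum_arr C K (fa \<Gamma> (f, fa S (fa T g))) (csum_arr C K f g)))"
  by (simp_all add: law_target_def)

section \<open>Free \<Sigma>-algebras and recursion out of \<Gamma>(SA, Y)\<close>

locale structural_law = lfp_category u C + coproduct_category C K +
    incremental_structural_law u C K \<Sigma> S \<eta>\<^sub>\<Sigma> T \<delta> \<Gamma> d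
  for u :: "'u itself" and C :: "('o, 'a) cat" (structure) and K :: "('o, 'a) coprods"
    and \<Sigma> :: "('o, 'a, 'o, 'a) ftor"
    and S :: "('o, 'a) monad" and \<eta>\<^sub>\<Sigma> :: "'o \<Rightarrow> 'a"
    and T :: "('o, 'a) monad" and \<delta> :: "'o \<Rightarrow> 'a"
    and \<Gamma> :: "('o \<times> 'o, 'a \<times> 'a, 'o, 'a) ftor" and d :: "'o \<times> 'o \<Rightarrow> 'a"
begin

sublocale \<eta>\<^sub>\<Sigma>: nat_trans C C \<Sigma> S \<eta>\<^sub>\<Sigma>
  using S_free unfolding free_monad_def by blast

lemma \<Gamma>_arr [simp]:
  assumes "f \<in> Arr C" "g \<in> Arr C"
  shows "fa \<Gamma> (f, g) \<in> Arr C" "Dom C (fa \<Gamma> (f, g)) = fo \<Gamma> (Dom C f, Dom C g)"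
    "Cod C (fa \<Gamma> (f, g)) = fo \<Gamma> (Cod C f, Cod C g)"
  using \<Gamma>.fa_arr[of "(f, g)"] assms by auto

lemma \<Gamma>_obj [simp]: "X \<in> Obj C \<Longrightarrow> Y \<in> Obj C \<Longrightarrow> fo \<Gamma> (X, Y) \<in> Obj C"
  using \<Gamma>.fo_Obj[of "(X, Y)"] by simp

lemma \<Gamma>_id [simp]:
  "X \<in> Obj C \<Longrightarrow> Y \<in> Obj C \<Longrightarrow> fa \<Gamma> (Ident C X, Ident C Y) = Ident C (fo \<Gamma> (X, Y))"
  using \<Gamma>.fa_Ident[of "(X, Y)"] by simp

lemma \<Gamma>_comp:
  assumes "f \<in> Arr C" "g \<in> Arr C" "f' \<in> Arr C" "g' \<in> Arr C"
    and "Dom C f' = Cod C f" "Dom C g' = Cod C g"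
  shows "fa \<Gamma> (f', g') \<cdot> fa \<Gamma> (f, g) = fa \<Gamma> (f' \<cdot> f, g' \<cdot> g)"
  using \<Gamma>.fa_comp[of "(f, g)" "(f', g')"] assms by simp

lemma \<Gamma>_comp':
  assumes "f \<in> Arr C" "g \<in> Arr C" "f' \<in> Arr C" "g' \<in> Arr C"
    and "Dom C f' = Cod C f" "Dom C g' = Cod C g" "h \<in> Arr C" "Cod C h = fo \<Gamma> (Dom C f, Dom C g)"
  shows "fa \<Gamma> (f', g') \<cdot> (fa \<Gamma> (f, g) \<cdot> h) = fa \<Gamma> (f' \<cdot> f, g' \<cdot> g) \<cdot> h"
  using assms by (intro Comp_reassoc \<Gamma>_comp) auto

lemma d_arr [simp]:
  assumes "X \<in> Obj C" "Y \<in> Obj C"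
  shows "d (X, Y) \<in> Arr C" "Dom C (d (X, Y)) = fo \<Gamma> (fo \<Sigma> X, Y)"
    "Cod C (d (X, Y)) = fo S (fo T (csum K (fo \<Gamma> (X, fo S (fo T Y))) (csum K X Y)))"
  using d.nat_arr[of "(X, Y)"] assms by auto

lemma d_nat:
  assumes "f \<in> Arr C" "g \<in> Arr C" "Cod C f = X" "Cod C g = Y"
  shows "d (X, Y) \<cdot> fa \<Gamma> (fa \<Sigma> f, g) =
    fa S (fa T (csum_arr C K (fa \<Gamma> (f, fa S (fa T g))) (csum_arr C K f g))) \<cdot> d (Dom C f, Dom C g)"
  using d.nat[of "(f, g)"] assms by simp

text \<open>The \<Sigma>-algebra structure for which \<open>fo S A\<close> is the free
  \<Sigma>-algebra on \<open>A\<close>, with \<open>unit S A\<close> as inclusion of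
  generators.\<close>

definition op :: "'o \<Rightarrow> 'a" where
  "op A = mult S A \<cdot> \<eta>\<^sub>\<Sigma> (fo S A)"

lemma op_arr [simp]:
  "A \<in> Obj C \<Longrightarrow> op A \<in> Arr C"
  "A \<in> Obj C \<Longrightarrow> Dom C (op A) = fo \<Sigma> (fo S A)"
  "A \<in> Obj C \<Longrightarrow> Cod C (op A) = fo S A"
  by (simp_all add: op_def)

lemma op_nat:
  assumes "f \<in> Arr C"
  shows "fa S f \<cdot> op (Dom C f) = op (Cod C f) \<cdot> fa \<Sigma> (fa S f)"
proof -
  have "fa S f \<cdot> op (Dom C f) = (mult S (Cod C f) \<cdot> fa S (fa S f)) \<cdot> \<eta>\<^sub>\<Sigma> (fo S (Dom C f))"
    unfolding op_def using assms \<delta>.S.mult.nat[OF assms] by (intro Comp_reassoc) auto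
  then show ?thesis
    using assms \<eta>\<^sub>\<Sigma>.nat[of "fa S f"] by (simp add: op_def)
qed

lemma op_mult:
  assumes "A \<in> Obj C"
  shows "mult S A \<cdot> op (fo S A) = op A \<cdot> fa \<Sigma> (mult S A)"
proof -
  have "mult S A \<cdot> op (fo S A) = (mult S A \<cdot> fa S (mult S A)) \<cdot> \<eta>\<^sub>\<Sigma> (fo S (fo S A))"
    unfolding op_def using assms \<delta>.S.mult_assoc[OF assms] by (intro Comp_reassoc) auto
  then show ?thesis
    using assms \<eta>\<^sub>\<Sigma>.nat[of "mult S A"] by (simp add: op_def)
qed

lemma op_unit:
  assumes "A \<in> Obj C"
  shows "op A \<cdot> fa \<Sigma> (unit S A) = \<eta>\<^sub>\<Sigma> A"
proof -
  have "op A \<cdot> fa \<Sigma> (unit S A) = mult S A \<cdot> (fa S (unit S A) \<cdot> \<eta>\<^sub>\<Sigma> A)"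
    using assms \<eta>\<^sub>\<Sigma>.nat[of "unit S A"] by (simp add: op_def)
  also have "\<dots> = Ident C (fo S A) \<cdot> \<eta>\<^sub>\<Sigma> A"
    using assms \<delta>.S.unit_right[OF assms] by (intro Comp_reassoc) auto
  finally show ?thesis using assms by simp
qed

text \<open>\<open>free_monad_alg\<close> turns \<open>w\<close> into an S-algebra \<open>m\<close>;
  the extension of \<open>k\<close> is then \<open>m \<cdot> fa S k\<close>, as for any
  Eilenberg-Moore algebra.\<close>

lemma free_algebra_extend:
  assumes w: "algebra C \<Sigma> W w" and k: "k \<in> Arr C" "Dom C k = A" "Cod C k = W"
  obtains h where "h \<in> Arr C" "Dom C h = fo S A" "Cod C h = W"
    "h \<cdot> unit S A = k" "h \<cdot> op A = w \<cdot> fa \<Sigma> h"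
proof -
  have A: "A \<in> Obj C" "W \<in> Obj C" using k by auto
  obtain m where m: "monad_algebra C S W m" and mw: "m \<cdot> \<eta>\<^sub>\<Sigma> W = w"
    using free_monad_alg[OF S_free w] by blast
  note m' = monad_algebraD[OF m]
  show thesis
  proof (rule that[of "m \<cdot> fa S k"])
    have "(m \<cdot> fa S k) \<cdot> unit S A = m \<cdot> (unit S W \<cdot> k)"
      using m' k A \<delta>.S.unit.nat[OF k(1)] by simp
    also have "\<dots> = Ident C W \<cdot> k"
      using m' k A by (intro Comp_reassoc) auto
    finally show "(m \<cdot> fa S k) \<cdot> unit S A = k" using k by simp
    have "(m \<cdot> fa S k) \<cdot> op A = m \<cdot> (op W \<cdot> fa \<Sigma> (fa S k))"
      using m' k A op_nat[OF k(1)] by simp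
    also have "\<dots> = m \<cdot> (fa S m \<cdot> (\<eta>\<^sub>\<Sigma> (fo S W) \<cdot> fa \<Sigma> (fa S k)))"
      using m' k A by (simp add: op_def Comp_reassoc[OF m'(6)])
    also have "\<dots> = m \<cdot> ((\<eta>\<^sub>\<Sigma> W \<cdot> fa \<Sigma> m) \<cdot> fa \<Sigma> (fa S k))"
      using m' k A \<eta>\<^sub>\<Sigma>.nat[OF m'(2)] Comp_reassoc[OF \<eta>\<^sub>\<Sigma>.nat[OF m'(2), symmetric]] by simp
    also have "\<dots> = (m \<cdot> \<eta>\<^sub>\<Sigma> W) \<cdot> fa \<Sigma> (m \<cdot> fa S k)"
      using m' k A by (simp add: \<eta>\<^sub>\<Sigma>.F.fa_comp)
    finally show "(m \<cdot> fa S k) \<cdot> op A = w \<cdot> fa \<Sigma> (m \<cdot> fa S k)"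
      unfolding mw .
  qed (use m' k in auto)
qed

text \<open>By \<open>free_monad_hom\<close> a \<Sigma>-homomorphism out of \<open>fo S A\<close> is
  an S-homomorphism, and such an arrow is recovered from its restriction to generators.\<close>

lemma free_algebra_unique:
  assumes w: "algebra C \<Sigma> W w" and A: "A \<in> Obj C"
    and h: "h \<in> Arr C" "Dom C h = fo S A" "Cod C h = W" "h \<cdot> op A = w \<cdot> fa \<Sigma> h"
    and k: "k \<in> Arr C" "Dom C k = fo S A" "Cod C k = W" "k \<cdot> op A = w \<cdot> fa \<Sigma> k"
    and eq: "h \<cdot> unit S A = k \<cdot> unit S A"
  shows "h = k"
proof -
  obtain m where m: "monad_algebra C S W m" and mw: "m \<cdot> \<eta>\<^sub>\<Sigma> W = w"
    using free_monad_alg[OF S_free w] by blast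
  note m' = monad_algebraD[OF m]
  have *: "g = m \<cdot> fa S (g \<cdot> unit S A)"
    if g: "g \<in> Arr C" "Dom C g = fo S A" "Cod C g = W" "g \<cdot> op A = w \<cdot> fa \<Sigma> g" for g
  proof -
    have "alg_hom C \<Sigma> (mult S A \<cdot> \<eta>\<^sub>\<Sigma> (fo S A)) (m \<cdot> \<eta>\<^sub>\<Sigma> W) g"
      using g A m' mw algebraD[OF w] by (simp add: alg_hom_def op_def)
    then have "alg_hom C S (mult S A) m g"
      by (rule free_monad_hom[OF S_free \<delta>.S.free_algebra[OF A] m])
    then have e: "g \<cdot> mult S A = m \<cdot> fa S g"
      by (rule alg_homD)
    have "g = g \<cdot> (mult S A \<cdot> fa S (unit S A))"
      using g A \<delta>.S.unit_right[OF A] by simp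
    also have "\<dots> = (m \<cdot> fa S g) \<cdot> fa S (unit S A)"
      using e g A by (intro Comp_reassoc) auto
    finally show ?thesis
      using g A m' by (simp add: \<delta>.S.M.fa_comp)
  qed
  show ?thesis
    using *[OF h] *[OF k] eq by simp
qed

definition copair3 :: "'a \<Rightarrow> 'a \<Rightarrow> 'a \<Rightarrow> 'a" where
  "copair3 p q r = copair C K p (copair C K q r)"

lemma copair3 [simp]:
  assumes "p \<in> Arr C" "q \<in> Arr C" "r \<in> Arr C" "Cod C p = Cod C r" "Cod C q = Cod C r"
  shows "copair3 p q r \<in> Arr C"
    "Dom C (copair3 p q r) = csum K (Dom C p) (csum K (Dom C q) (Dom C r))"
    "Cod C (copair3 p q r) = Cod C r"
  using assms by (simp_all add: copair3_def)

lemma copair3_comp: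
  assumes "p \<in> Arr C" "q \<in> Arr C" "r \<in> Arr C" "Cod C p = Cod C r" "Cod C q = Cod C r"
    and "h \<in> Arr C" "Dom C h = Cod C r"
  shows "h \<cdot> copair3 p q r = copair3 (h \<cdot> p) (h \<cdot> q) (h \<cdot> r)"
  using assms by (simp add: copair3_def copair_comp)

lemma copair3_csum:
  assumes "p \<in> Arr C" "q \<in> Arr C" "r \<in> Arr C" "Cod C p = Cod C r" "Cod C q = Cod C r"
    and "p' \<in> Arr C" "q' \<in> Arr C" "r' \<in> Arr C"
    and "Cod C p' = Dom C p" "Cod C q' = Dom C q" "Cod C r' = Dom C r"
  shows "copair3 p q r \<cdot> csum_arr C K p' (csum_arr C K q' r') = copair3 (p \<cdot> p') (q \<cdot> q') (r \<cdot> r')"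
  using assms by (simp add: copair3_def copair_csum)

text \<open>The right-hand side of the recursion. The object at which \<open>d\<close> is taken is
  read off from \<open>v\<close>, because the same formula is needed at SA and at the representing
  object in \<open>rec_ex1\<close>.\<close>

definition step :: "'o \<Rightarrow> 'a \<Rightarrow> 'a \<Rightarrow> 'a \<Rightarrow> 'a \<Rightarrow> 'a \<Rightarrow> 'a" where
  "step Y y \<beta> z v b = \<beta> \<cdot> fa S (fa T (copair3 (b \<cdot> fa \<Gamma> (Ident C (Dom C v), y)) v z)) \<cdot> d (Dom C v, Y)"

text \<open>Parameters of a recursion producing an arrow \<open>\<Gamma>(SA, Y) \<rightarrow> B\<close>: the recursive arguments
  \<open>\<Gamma>(X, STY)\<close> of the law are fed back through \<open>y\<close>, its terms are evaluated by \<open>\<beta>\<close>, and the two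
  other kinds of variables are interpreted by \<open>v\<close> and \<open>z\<close>.\<close>

definition rec_data :: "'o \<Rightarrow> 'o \<Rightarrow> 'o \<Rightarrow> 'a \<Rightarrow> 'a \<Rightarrow> 'a \<Rightarrow> bool" where
  "rec_data A Y B y \<beta> z \<longleftrightarrow> A \<in> Obj C \<and> Y \<in> Obj C \<and> B \<in> Obj C \<and>
     y \<in> hom C (fo S (fo T Y)) Y \<and> \<beta> \<in> hom C (fo S (fo T B)) B \<and> z \<in> hom C Y B"

definition rec_solution :: "'o \<Rightarrow> 'o \<Rightarrow> 'o \<Rightarrow> 'a \<Rightarrow> 'a \<Rightarrow> 'a \<Rightarrow> 'a \<Rightarrow> 'a \<Rightarrow> 'a \<Rightarrow> bool" where
  "rec_solution A Y B y \<beta> z v c b \<longleftrightarrow>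
     b \<in> hom C (fo \<Gamma> (fo S A, Y)) B \<and>
     b \<cdot> fa \<Gamma> (unit S A, Ident C Y) = c \<and>
     b \<cdot> fa \<Gamma> (op A, Ident C Y) = step Y y \<beta> z v b"

text \<open>Arrows out of \<Gamma>(Z, Y) are paired with arrows out of Z because \<open>d\<close>
  also returns variables from its first argument: as in primitive recursion, a step needs their
  values next to the recursive calls.\<close>

definition shape :: "'o \<Rightarrow> 'o \<Rightarrow> 'o \<Rightarrow> ('a \<times> 'a) set" where
  "shape Y B Z = hom C (fo \<Gamma> (Z, Y)) B \<times> hom C Z B"

definition shape_act :: "'o \<Rightarrow> 'a \<Rightarrow> 'a \<times> 'a \<Rightarrow> 'a \<times> 'a" where
  "shape_act Y k = (\<lambda>(p, q). (p \<cdot> fa \<Gamma> (k, Ident C Y), q \<cdot> k))"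

text \<open>The first component is continuous because \<Gamma>(_, Y) is cocontinuous, the second
  because it is representable.\<close>

lemma shape_presheaf:
  assumes Y: "Y \<in> Obj C" and B: "B \<in> Obj C"
  shows "continuous_presheaf u C (shape Y B) (shape_act Y)"
proof
  fix k k' e
  show "shape_act Y k e \<in> shape Y B (Dom C k)" if "k \<in> Arr C" "e \<in> shape Y B (Cod C k)"
    using that Y by (auto simp: shape_def shape_act_def hom_iff)
  show "shape_act Y (Ident C X) e = e" if "X \<in> Obj C" "e \<in> shape Y B X" for X
    using that Y by (auto simp: shape_def shape_act_def hom_iff)
  show "shape_act Y (k' \<cdot> k) e = shape_act Y k (shape_act Y k' e)"
    if "k \<in> Arr C" "k' \<in> Arr C" "Dom C k' = Cod C k" "e \<in> shape Y B (Cod C k')"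
    using that Y by (auto simp: shape_def shape_act_def hom_iff \<Gamma>_comp)
  show "small u (shape Y B X)" if "X \<in> Obj C" for X
    using that Y B by (auto simp: shape_def intro!: small_Times[OF universe] hom_small)
next
  fix J :: "('u, 'u) cat" and D Z c e
  assume J: "small_cat u J" and D: "is_functor J C D" and c: "colimit C J D Z c"
    and e: "compatible J D (shape Y B) (shape_act Y) e"
  interpret D: is_functor J C D by (rule D)
  have Z: "Z \<in> Obj C" using c unfolding colimit_def cocone_def by blast
  have c_hom: "c j \<in> Arr C" "Dom C (c j) = fo D j" "Cod C (c j) = Z" if "j \<in> Obj J" for j
    using c that unfolding colimit_def cocone_def by (auto simp: hom_iff)
  have e_in: "fst (e j) \<in> hom C (fo \<Gamma> (fo D j, Y)) B" "snd (e j) \<in> hom C (fo D j) B"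
    if "j \<in> Obj J" for j
    using e that unfolding compatible_def shape_def by (auto simp: mem_Times_iff)
  have e_nat: "fst (e j) \<cdot> fa \<Gamma> (fa D f, Ident C Y) = fst (e i)" "snd (e j) \<cdot> fa D f = snd (e i)"
    if "f \<in> hom J i j" for i j f
  proof -
    have "shape_act Y (fa D f) (e j) = e i"
      using e that unfolding compatible_def by blast
    then show "fst (e j) \<cdot> fa \<Gamma> (fa D f, Ident C Y) = fst (e i)" "snd (e j) \<cdot> fa D f = snd (e i)"
      by (simp_all add: shape_act_def split_beta prod_eq_iff)
  qed
  let ?G = "fix_snd C \<Gamma> Y"
  have "colimit C J (?G \<odot> D) (fo ?G Z) (\<lambda>j. fa ?G (c j))"
    using \<Gamma>_cocontinuous[OF Y] J D c unfolding cocontinuous_def preserves_colimits_def by blast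
  moreover have "cocone C J (?G \<odot> D) B (\<lambda>j. fst (e j))"
    using e_in e_nat B unfolding cocone_def by (simp add: fix_snd_def)
  ultimately have p: "\<exists>!p. p \<in> hom C (fo \<Gamma> (Z, Y)) B \<and>
      (\<forall>j \<in> Obj J. p \<cdot> fa \<Gamma> (c j, Ident C Y) = fst (e j))"
    unfolding colimit_def by (simp add: fix_snd_def)
  have "cocone C J D B (\<lambda>j. snd (e j))"
    using e_in e_nat B unfolding cocone_def by simp
  then have q: "\<exists>!q. q \<in> hom C Z B \<and> (\<forall>j \<in> Obj J. q \<cdot> c j = snd (e j))"
    using c unfolding colimit_def by blast
  have iff: "x \<in> shape Y B Z \<and> (\<forall>j \<in> Obj J. shape_act Y (c j) x = e j) \<longleftrightarrow>
      (fst x \<in> hom C (fo \<Gamma> (Z, Y)) B \<and>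
         (\<forall>j \<in> Obj J. fst x \<cdot> fa \<Gamma> (c j, Ident C Y) = fst (e j))) \<and>
      (snd x \<in> hom C Z B \<and> (\<forall>j \<in> Obj J. snd x \<cdot> c j = snd (e j)))" for x
    by (auto simp: shape_def shape_act_def prod_eq_iff mem_Times_iff split_beta)
  obtain p\<^sub>0 q\<^sub>0 where "p\<^sub>0 \<in> hom C (fo \<Gamma> (Z, Y)) B \<and>
      (\<forall>j \<in> Obj J. p\<^sub>0 \<cdot> fa \<Gamma> (c j, Ident C Y) = fst (e j))"
      "q\<^sub>0 \<in> hom C Z B \<and> (\<forall>j \<in> Obj J. q\<^sub>0 \<cdot> c j = snd (e j))"
    using p q by blast
  then show "\<exists>!x. x \<in> shape Y B Z \<and> (\<forall>j \<in> Obj J. shape_act Y (c j) x = e j)"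
    unfolding iff using p q
    by (intro ex1I[of _ "(p\<^sub>0, q\<^sub>0)"]) (simp_all add: prod_eq_iff, blast)
qed

text \<open>The object \<open>W\<close> representing the presheaf of shapes turns an arrow out of
  \<Gamma>(SA, Y), paired with one out of SA, into an arrow SA -> W. One step of the recursion
  becomes a \<Sigma>-algebra on \<open>W\<close>, and a solution becomes the \<Sigma>-homomorphism
  out of the free algebra SA whose restriction to generators is the base case. The second component
  has to stay equal to \<open>v\<close>, which is why \<open>v\<close> is assumed to be a
  homomorphism.\<close>

theorem rec_ex1:
  assumes data: "rec_data A Y B y \<beta> z"
    and c: "c \<in> hom C (fo \<Gamma> (A, Y)) B"
    and s: "algebra C \<Sigma> B s" and v: "v \<in> hom C (fo S A) B" "v \<cdot> op A = s \<cdot> fa \<Sigma> v"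
  shows "\<exists>!b. rec_solution A Y B y \<beta> z v c b"
proof -
  have obj: "A \<in> Obj C" "Y \<in> Obj C" "B \<in> Obj C"
    using data unfolding rec_data_def by auto
  have arr: "y \<in> Arr C" "Dom C y = fo S (fo T Y)" "Cod C y = Y"
    "\<beta> \<in> Arr C" "Dom C \<beta> = fo S (fo T B)" "Cod C \<beta> = B"
    "z \<in> Arr C" "Dom C z = Y" "Cod C z = B"
    "c \<in> Arr C" "Dom C c = fo \<Gamma> (A, Y)" "Cod C c = B"
    "v \<in> Arr C" "Dom C v = fo S A" "Cod C v = B"
    "s \<in> Arr C" "Dom C s = fo \<Sigma> B" "Cod C s = B"
    using data c v algebraD[OF s] unfolding rec_data_def by (auto simp: hom_iff)
  interpret pre: continuous_presheaf u C "shape Y B" "shape_act Y"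
    by (rule shape_presheaf[OF obj(2,3)])
  interpret pre: lfp_presheaf u C "shape Y B" "shape_act Y"
    by unfold_locales
  obtain W w where W: "W \<in> Obj C" and w: "w \<in> shape Y B W"
    and univ: "\<And>Z e. Z \<in> Obj C \<Longrightarrow> e \<in> shape Y B Z \<Longrightarrow> \<exists>!h. h \<in> hom C Z W \<and> shape_act Y h w = e"
    using pre.representable by blast
  obtain p q where "w = (p, q)" by force
  then have pq: "p \<in> Arr C" "Dom C p = fo \<Gamma> (W, Y)" "Cod C p = B" "q \<in> Arr C" "Dom C q = W" "Cod C q = B"
    using w by (auto simp: shape_def hom_iff)
  have tuple: "\<exists>h. h \<in> Arr C \<and> Dom C h = Z \<and> Cod C h = W \<and> p \<cdot> fa \<Gamma> (h, Ident C Y) = f \<and> q \<cdot> h = g"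
    if "Z \<in> Obj C" "f \<in> Arr C" "Dom C f = fo \<Gamma> (Z, Y)" "Cod C f = B"
      "g \<in> Arr C" "Dom C g = Z" "Cod C g = B" for Z f g
    using univ[OF that(1), of "(f, g)"] that \<open>w = (p, q)\<close>
    by (auto simp: shape_def shape_act_def hom_iff)
  have tuple_eq: "h = k"
    if "h \<in> Arr C" "k \<in> Arr C" "Dom C h = Dom C k" "Cod C h = W" "Cod C k = W"
      "p \<cdot> fa \<Gamma> (h, Ident C Y) = p \<cdot> fa \<Gamma> (k, Ident C Y)" "q \<cdot> h = q \<cdot> k" for h k
  proof -
    have "(p \<cdot> fa \<Gamma> (h, Ident C Y), q \<cdot> h) \<in> shape Y B (Dom C h)"
      using that pq obj by (auto simp: shape_def hom_iff)
    from univ[OF _ this] show ?thesis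
      using that \<open>w = (p, q)\<close> by (auto simp: shape_act_def hom_iff)
  qed
  \<comment> \<open>The \<Sigma>-algebra on \<open>W\<close>: its first component performs one step
    of the recursion on the universal pair, its second makes \<open>q\<close> a homomorphism to
    \<open>B\<close> with structure \<open>s\<close>.\<close>
  obtain \<omega> where \<omega>: "\<omega> \<in> Arr C" "Dom C \<omega> = fo \<Sigma> W" "Cod C \<omega> = W"
    and p\<omega>: "p \<cdot> fa \<Gamma> (\<omega>, Ident C Y) = step Y y \<beta> z q p" and q\<omega>: "q \<cdot> \<omega> = s \<cdot> fa \<Sigma> q"
    using tuple[of "fo \<Sigma> W" "step Y y \<beta> z q p" "s \<cdot> fa \<Sigma> q"] W pq obj arr
    by (auto simp: step_def)
  have W_alg: "algebra C \<Sigma> W \<omega>"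
    using \<omega> W by (simp add: algebra_def)
  obtain k where k: "k \<in> Arr C" "Dom C k = A" "Cod C k = W"
    and pk: "p \<cdot> fa \<Gamma> (k, Ident C Y) = c" and qk: "q \<cdot> k = v \<cdot> unit S A"
    using tuple[of A c "v \<cdot> unit S A"] obj arr by auto
  \<comment> \<open>Naturality of \<open>d\<close> in its first argument transports the universal
    step on \<open>W\<close> to the step at SA.\<close>
  have step_comp: "step Y y \<beta> z q p \<cdot> fa \<Gamma> (fa \<Sigma> h, Ident C Y) =
      step Y y \<beta> z v (p \<cdot> fa \<Gamma> (h, Ident C Y))"
    if h: "h \<in> Arr C" "Dom C h = fo S A" "Cod C h = W" "q \<cdot> h = v" for h
  proof -
    have "step Y y \<beta> z q p \<cdot> fa \<Gamma> (fa \<Sigma> h, Ident C Y) =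
       \<beta> \<cdot> (fa S (fa T (copair3 (p \<cdot> fa \<Gamma> (Ident C W, y)) q z)) \<cdot>
         (d (W, Y) \<cdot> fa \<Gamma> (fa \<Sigma> h, Ident C Y)))"
      using h pq obj arr W by (simp add: step_def)
    also have "\<dots> = \<beta> \<cdot> (fa S (fa T (copair3 (p \<cdot> fa \<Gamma> (Ident C W, y)) q z)) \<cdot>
         (fa S (fa T (csum_arr C K (fa \<Gamma> (h, Ident C (fo S (fo T Y)))) (csum_arr C K h (Ident C Y)))) \<cdot>
           d (fo S A, Y)))"
      using d_nat[of h "Ident C Y" W Y] h obj by simp
    also have "\<dots> = \<beta> \<cdot> (fa S (fa T (copair3 (p \<cdot> fa \<Gamma> (Ident C W, y)) q z \<cdot>
         csum_arr C K (fa \<Gamma> (h, Ident C (fo S (fo T Y)))) (csum_arr C K h (Ident C Y)))) \<cdot>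
           d (fo S A, Y))"
      using h pq obj arr W by (simp add: \<delta>.S.M.fa_comp \<delta>.T.M.fa_comp)
    also have "copair3 (p \<cdot> fa \<Gamma> (Ident C W, y)) q z \<cdot>
         csum_arr C K (fa \<Gamma> (h, Ident C (fo S (fo T Y)))) (csum_arr C K h (Ident C Y)) =
         copair3 (p \<cdot> fa \<Gamma> (h, Ident C Y) \<cdot> fa \<Gamma> (Ident C (fo S A), y)) v z"
      using h pq obj arr W by (simp add: copair3_csum \<Gamma>_comp)
    finally show ?thesis
      using h pq obj arr W by (simp add: step_def)
  qed
  obtain h where h: "h \<in> Arr C" "Dom C h = fo S A" "Cod C h = W"
    and hk: "h \<cdot> unit S A = k" and h_op: "h \<cdot> op A = \<omega> \<cdot> fa \<Sigma> h"
    using free_algebra_extend[OF W_alg k] by blast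
  \<comment> \<open>Both sides are \<Sigma>-homomorphisms into \<open>B\<close> with structure
    \<open>s\<close>, and they agree on generators.\<close>
  have qh: "q \<cdot> h = v"
  proof (rule free_algebra_unique[OF s obj(1)])
    have "(q \<cdot> h) \<cdot> op A = (q \<cdot> \<omega>) \<cdot> fa \<Sigma> h"
      using h pq obj \<omega> h_op by simp
    then show "(q \<cdot> h) \<cdot> op A = s \<cdot> fa \<Sigma> (q \<cdot> h)"
      unfolding q\<omega> using h pq obj arr by (simp add: \<eta>\<^sub>\<Sigma>.F.fa_comp)
  qed (use h hk qk pq obj arr v in auto)
  define b where "b = p \<cdot> fa \<Gamma> (h, Ident C Y)"
  have "rec_solution A Y B y \<beta> z v c b"
    unfolding rec_solution_def
  proof (intro conjI)
    show "b \<in> hom C (fo \<Gamma> (fo S A, Y)) B"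
      using h pq obj by (simp add: b_def hom_iff)
    show "b \<cdot> fa \<Gamma> (unit S A, Ident C Y) = c"
      using h pq obj hk pk by (simp add: b_def \<Gamma>_comp)
    have "b \<cdot> fa \<Gamma> (op A, Ident C Y) = (p \<cdot> fa \<Gamma> (\<omega>, Ident C Y)) \<cdot> fa \<Gamma> (fa \<Sigma> h, Ident C Y)"
      using h pq obj \<omega> h_op by (simp add: b_def \<Gamma>_comp)
    then show "b \<cdot> fa \<Gamma> (op A, Ident C Y) = step Y y \<beta> z v b"
      unfolding p\<omega> step_comp[OF h qh] b_def .
  qed
  moreover have "b' = b" if b': "rec_solution A Y B y \<beta> z v c b'" for b'
  proof -
    have b'_arr: "b' \<in> Arr C" "Dom C b' = fo \<Gamma> (fo S A, Y)" "Cod C b' = B"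
      and base: "b' \<cdot> fa \<Gamma> (unit S A, Ident C Y) = c"
      and rec: "b' \<cdot> fa \<Gamma> (op A, Ident C Y) = step Y y \<beta> z v b'"
      using b' unfolding rec_solution_def by (auto simp: hom_iff)
    obtain g where g: "g \<in> Arr C" "Dom C g = fo S A" "Cod C g = W"
      and pg: "p \<cdot> fa \<Gamma> (g, Ident C Y) = b'" and qg: "q \<cdot> g = v"
      using tuple[of "fo S A" b' v] b'_arr obj arr by auto
    \<comment> \<open>The transpose \<open>g\<close> of another solution, paired with
      \<open>v\<close>, is again a \<Sigma>-homomorphism with the prescribed value on generators:
      the step clause of \<open>rec_solution\<close> gives the former, the base clause the
      latter.\<close>
    have "g = h"
    proof (rule free_algebra_unique[OF W_alg obj(1) g _ h h_op])
      show "g \<cdot> op A = \<omega> \<cdot> fa \<Sigma> g"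
      proof (rule tuple_eq)
        have "p \<cdot> fa \<Gamma> (g \<cdot> op A, Ident C Y) = b' \<cdot> fa \<Gamma> (op A, Ident C Y)"
          unfolding pg[symmetric] using g pq obj by (simp add: \<Gamma>_comp)
        also have "\<dots> = (p \<cdot> fa \<Gamma> (\<omega>, Ident C Y)) \<cdot> fa \<Gamma> (fa \<Sigma> g, Ident C Y)"
          unfolding rec p\<omega> step_comp[OF g qg] pg ..
        finally show "p \<cdot> fa \<Gamma> (g \<cdot> op A, Ident C Y) = p \<cdot> fa \<Gamma> (\<omega> \<cdot> fa \<Sigma> g, Ident C Y)"
          using g pq obj \<omega> by (simp add: \<Gamma>_comp)
        have "q \<cdot> (g \<cdot> op A) = v \<cdot> op A"
          unfolding qg[symmetric] using g pq obj by simp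
        also have "\<dots> = s \<cdot> fa \<Sigma> (q \<cdot> g)"
          unfolding v(2) qg ..
        also have "\<dots> = (q \<cdot> \<omega>) \<cdot> fa \<Sigma> g"
          unfolding q\<omega> using g pq obj arr by (simp add: \<eta>\<^sub>\<Sigma>.F.fa_comp)
        finally show "q \<cdot> (g \<cdot> op A) = q \<cdot> (\<omega> \<cdot> fa \<Sigma> g)"
          using g pq \<omega> by simp
      qed (use g \<omega> obj in auto)
      show "g \<cdot> unit S A = h \<cdot> unit S A"
        unfolding hk
      proof (rule tuple_eq)
        have "p \<cdot> fa \<Gamma> (g \<cdot> unit S A, Ident C Y) = b' \<cdot> fa \<Gamma> (unit S A, Ident C Y)"
          unfolding pg[symmetric] using g pq obj by (simp add: \<Gamma>_comp)
        then show "p \<cdot> fa \<Gamma> (g \<cdot> unit S A, Ident C Y) = p \<cdot> fa \<Gamma> (k, Ident C Y)"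
          unfolding base pk .
        show "q \<cdot> (g \<cdot> unit S A) = q \<cdot> k"
          unfolding qk qg[symmetric] using g pq obj by simp
      qed (use g k obj in auto)
    qed
    then show ?thesis using pg b_def by simp
  qed
  ultimately show ?thesis by blast
qed

end


section \<open>Lifting the term monad to algebras\<close>

context distributive_law
begin

definition lift_T :: "'a \<Rightarrow> 'a" where
  "lift_T t = fa S t \<cdot> \<delta> (Cod C t)"

context
  fixes A t assumes t: "monad_algebra C T A t"
begin

lemmas t_facts [simp] = monad_algebraD(1-4)[OF t]

lemma lift_T_arr [simp]:
  "lift_T t \<in> Arr C" "Dom C (lift_T t) = fo T (fo S A)" "Cod C (lift_T t) = fo S A"
  by (simp_all add: lift_T_def)

lemma lift_T_algebra: "monad_algebra C T (fo S A) (lift_T t)"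
proof -
  note t' = monad_algebraD(5,6)[OF t]
  have 1: "fa S t \<cdot> fa S (unit T A) = Ident C (fo S A)"
    using S.M.fa_eq[OF t'(1)] by simp
  have 2: "fa S t \<cdot> fa S (mult T A) = fa S t \<cdot> fa S (fa T t)"
    using S.M.fa_eq[OF t'(2)] by (simp add: S.M.fa_comp)
  have 3: "fa S (fa T t) \<cdot> \<delta> (fo T A) = \<delta> A \<cdot> fa T (fa S t)"
    using nat[of t] by simp
  have "lift_T t \<cdot> mult T (fo S A) = fa S t \<cdot> (fa S (mult T A) \<cdot> (\<delta> (fo T A) \<cdot> fa T (\<delta> A)))"
    using law_mult_T[of A] by (simp add: lift_T_def)
  also have "\<dots> = lift_T t \<cdot> fa T (lift_T t)"
    by (simp add: lift_T_def T.M.fa_comp T.M.A.Comp_reassoc[OF 2] T.M.A.Comp_reassoc[OF 3])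
  finally show ?thesis
    using law_unit_T[of A] 1 by (simp add: monad_algebra_def algebra_def lift_T_def)
qed

lemma lift_T_unit: "alg_hom C T t (lift_T t) (unit S A)"
  using S.unit.nat[of t] law_unit_S[of A] by (simp add: alg_hom_def) (simp add: lift_T_def)

lemma lift_T_mult: "alg_hom C T (lift_T (lift_T t)) (lift_T t) (mult S A)"
proof -
  have 1: "mult S A \<cdot> fa S (fa S t) = fa S t \<cdot> mult S (fo T A)"
    using S.mult.nat[of t] by simp
  have "mult S A \<cdot> lift_T (lift_T t) = lift_T t \<cdot> fa T (mult S A)"
    using law_mult_S[of A]
    by (simp add: lift_T_def S.M.fa_comp T.M.A.Comp_reassoc[OF 1])
  then show ?thesis
    by (simp add: alg_hom_def lift_T_def)
qed

end

lemma lift_T_hom: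
  assumes t: "monad_algebra C T A t" and t': "monad_algebra C T A' t'"
    and f: "alg_hom C T t t' f"
  shows "alg_hom C T (lift_T t) (lift_T t') (fa S f)"
proof -
  note a = monad_algebraD(1-4)[OF t] monad_algebraD(1-4)[OF t'] and f' = alg_homD[OF f]
  have 1: "fa S f \<cdot> fa S t = fa S t' \<cdot> fa S (fa T f)"
    using S.M.fa_eq[OF f'(4)] a f' by (simp add: S.M.fa_comp)
  have 2: "fa S (fa T f) \<cdot> \<delta> A = \<delta> A' \<cdot> fa T (fa S f)"
    using nat[of f] a f' by simp
  show ?thesis
    using a f' 2 by (simp add: alg_hom_def lift_T_def T.M.A.Comp_reassoc[OF 1])
qed

text \<open>Evaluation of ST-terms over the carrier \<open>fo S A\<close>: T by the lifted algebra,
  S by its multiplication. In \<open>lift_rec\<close> it serves both as the feedback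
  \<open>y\<close> and as the evaluation \<beta>.\<close>

definition eval_terms :: "'a \<Rightarrow> 'a" where
  "eval_terms t = mult S (Cod C t) \<cdot> fa S (lift_T t)"

lemma eval_terms_arr [simp]:
  assumes "monad_algebra C T A t"
  shows "eval_terms t \<in> Arr C" "Dom C (eval_terms t) = fo S (fo T (fo S A))"
    "Cod C (eval_terms t) = fo S A"
  using monad_algebraD(1-4)[OF assms] lift_T_arr[OF assms] by (simp_all add: eval_terms_def)

lemma eval_terms_hom:
  assumes t: "monad_algebra C T A t" and t': "monad_algebra C T A' t'"
    and f: "alg_hom C T t t' f"
  shows "fa S f \<cdot> eval_terms t = eval_terms t' \<cdot> fa S (fa T (fa S f))"
proof -
  note a = monad_algebraD(1-4)[OF t] monad_algebraD(1-4)[OF t'] and f' = alg_homD[OF f]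
    and l = lift_T_arr[OF t] lift_T_arr[OF t']
  have 1: "fa S f \<cdot> mult S A = mult S A' \<cdot> fa S (fa S f)"
    using S.mult.nat[of f] a f' by simp
  have "fa S (fa S f) \<cdot> fa S (lift_T t) = fa S (lift_T t') \<cdot> fa S (fa T (fa S f))"
    using S.M.fa_eq[OF alg_homD(4)[OF lift_T_hom[OF t t' f]]] a f' l by (simp add: S.M.fa_comp)
  then show ?thesis
    using a f' l by (simp add: eval_terms_def T.M.A.Comp_reassoc[OF 1])
qed

lemma eval_terms_mult:
  assumes t: "monad_algebra C T A t"
  shows "mult S A \<cdot> eval_terms (lift_T t) = eval_terms t \<cdot> fa S (fa T (mult S A))"
proof -
  note a = monad_algebraD(1-4)[OF t] and l = lift_T_arr[OF t] lift_T_arr[OF lift_T_algebra[OF t]]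
  have "fa S (mult S A) \<cdot> fa S (lift_T (lift_T t)) = fa S (lift_T t) \<cdot> fa S (fa T (mult S A))"
    using S.M.fa_eq[OF alg_homD(4)[OF lift_T_mult[OF t]]] a l by (simp add: S.M.fa_comp)
  then show ?thesis
    using a l by (simp add: eval_terms_def T.M.A.Comp_reassoc[OF S.mult_assoc[OF a(1)]])
qed

lemma eval_terms_unit:
  assumes t: "monad_algebra C T A t"
  shows "eval_terms t \<cdot> fa S (fa T (unit S A)) = fa S t"
proof -
  note a = monad_algebraD(1-4)[OF t] and l = lift_T_arr[OF t]
  have "fa S (lift_T t) \<cdot> fa S (fa T (unit S A)) = fa S (unit S A) \<cdot> fa S t"
    using S.M.fa_eq[OF alg_homD(4)[OF lift_T_unit[OF t], symmetric]] a l by (simp add: S.M.fa_comp)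
  then show ?thesis
    using a l by (simp add: eval_terms_def T.M.A.Comp_reassoc[OF S.unit_right[OF a(1)]])
qed

end

section \<open>Lifting \<Gamma>-algebras by recursion\<close>

context structural_law
begin

abbreviation "G \<equiv> diagonal_ftor \<Gamma> S"

lemma G_simps [simp]: "fo G X = fo \<Gamma> (X, fo S X)" "fa G f = fa \<Gamma> (f, fa S f)"
  by (simp_all add: diagonal_ftor_def)

text \<open>A fusion law: \<open>k\<close> commutes with the evaluations and distributes over the
  copairing of recursive call and variables. Together with uniqueness in \<open>rec_ex1\<close>,
  this and \<open>rec_pre\<close> replace induction over terms.\<close>

lemma rec_post:
  assumes data: "rec_data A Y B y \<beta> z" and v: "v \<in> hom C (fo S A) B"
    and b: "rec_solution A Y B y \<beta> z v c b"
    and k: "k \<in> Arr C" "Dom C k = B" "\<beta>' \<in> Arr C" "Dom C \<beta>' = fo S (fo T (Cod C k))"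
    and hom: "k \<cdot> \<beta> = \<beta>' \<cdot> fa S (fa T k)"
  shows "rec_solution A Y (Cod C k) y \<beta>' (k \<cdot> z) (k \<cdot> v) (k \<cdot> c) (k \<cdot> b)"
proof -
  have obj: "A \<in> Obj C" "Y \<in> Obj C" "B \<in> Obj C"
    using data unfolding rec_data_def by auto
  have arr: "y \<in> Arr C" "Dom C y = fo S (fo T Y)" "Cod C y = Y"
    "\<beta> \<in> Arr C" "Dom C \<beta> = fo S (fo T B)" "Cod C \<beta> = B"
    "z \<in> Arr C" "Dom C z = Y" "Cod C z = B"
    "v \<in> Arr C" "Dom C v = fo S A" "Cod C v = B"
    using data v unfolding rec_data_def by (auto simp: hom_iff)
  have b': "b \<in> Arr C" "Dom C b = fo \<Gamma> (fo S A, Y)" "Cod C b = B"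
    and base: "b \<cdot> fa \<Gamma> (unit S A, Ident C Y) = c"
    and rec: "b \<cdot> fa \<Gamma> (op A, Ident C Y) = step Y y \<beta> z v b"
    using b unfolding rec_solution_def by (auto simp: hom_iff)
  have "k \<cdot> step Y y \<beta> z v b = step Y y \<beta>' (k \<cdot> z) (k \<cdot> v) (k \<cdot> b)"
  proof -
    let ?c = "copair3 (b \<cdot> fa \<Gamma> (Ident C (fo S A), y)) v z"
    have "k \<cdot> step Y y \<beta> z v b = (\<beta>' \<cdot> fa S (fa T k)) \<cdot> (fa S (fa T ?c) \<cdot> d (fo S A, Y))"
      unfolding step_def arr using obj arr b' k hom by (intro Comp_reassoc) auto
    also have "\<dots> = \<beta>' \<cdot> (fa S (fa T (k \<cdot> ?c)) \<cdot> d (fo S A, Y))"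
      using obj arr b' k by (simp add: \<delta>.S.M.fa_comp \<delta>.T.M.fa_comp)
    also have "k \<cdot> ?c = copair3 ((k \<cdot> b) \<cdot> fa \<Gamma> (Ident C (fo S A), y)) (k \<cdot> v) (k \<cdot> z)"
      using obj arr b' k by (simp add: copair3_comp)
    finally show ?thesis
      using obj arr b' k by (simp add: step_def)
  qed
  then show ?thesis
    using obj arr b' k base rec by (simp add: rec_solution_def hom_iff)
qed

text \<open>The companion fusion law, from naturality of \<open>d\<close> in both arguments:
  \<open>h\<close> is a \<Sigma>-homomorphism in order to meet the operations, and \<open>g\<close>
  respects the feedback in order to meet the recursive calls.\<close>

lemma rec_pre:
  assumes data: "rec_data A Y B y \<beta> z" and v: "v \<in> hom C (fo S A) B"
    and b: "rec_solution A Y B y \<beta> z v c b"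
    and h: "h \<in> Arr C" "Dom C h = fo S A'" "Cod C h = fo S A" "A' \<in> Obj C"
      "h \<cdot> op A' = op A \<cdot> fa \<Sigma> h"
    and g: "g \<in> Arr C" "Dom C g = Y'" "Cod C g = Y"
    and y': "y' \<in> Arr C" "Dom C y' = fo S (fo T Y')" "Cod C y' = Y'"
      "y \<cdot> fa S (fa T g) = g \<cdot> y'"
  shows "rec_solution A' Y' B y' \<beta> (z \<cdot> g) (v \<cdot> h) (b \<cdot> fa \<Gamma> (h \<cdot> unit S A', g)) (b \<cdot> fa \<Gamma> (h, g))"
proof -
  have obj: "A \<in> Obj C" "Y \<in> Obj C" "B \<in> Obj C" "Y' \<in> Obj C"
    using data g unfolding rec_data_def by auto
  have arr: "y \<in> Arr C" "Dom C y = fo S (fo T Y)" "Cod C y = Y"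
    "\<beta> \<in> Arr C" "Dom C \<beta> = fo S (fo T B)" "Cod C \<beta> = B"
    "z \<in> Arr C" "Dom C z = Y" "Cod C z = B"
    "v \<in> Arr C" "Dom C v = fo S A" "Cod C v = B"
    using data v unfolding rec_data_def by (auto simp: hom_iff)
  have b': "b \<in> Arr C" "Dom C b = fo \<Gamma> (fo S A, Y)" "Cod C b = B"
    and rec: "b \<cdot> fa \<Gamma> (op A, Ident C Y) = step Y y \<beta> z v b"
    using b unfolding rec_solution_def by (auto simp: hom_iff)
  let ?c = "copair3 (b \<cdot> fa \<Gamma> (Ident C (fo S A), y)) v z"
  let ?s = "csum_arr C K (fa \<Gamma> (h, fa S (fa T g))) (csum_arr C K h g)"
  have "(b \<cdot> fa \<Gamma> (h, g)) \<cdot> fa \<Gamma> (op A', Ident C Y') =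
      (b \<cdot> fa \<Gamma> (op A, Ident C Y)) \<cdot> fa \<Gamma> (fa \<Sigma> h, g)"
    using obj b' h g by (simp add: \<Gamma>_comp)
  also have "\<dots> = \<beta> \<cdot> (fa S (fa T ?c) \<cdot> (d (fo S A, Y) \<cdot> fa \<Gamma> (fa \<Sigma> h, g)))"
    unfolding rec step_def arr using obj arr b' h g by simp
  also have "\<dots> = \<beta> \<cdot> (fa S (fa T (?c \<cdot> ?s)) \<cdot> d (fo S A', Y'))"
    using d_nat[of h g "fo S A" Y] obj arr b' h g by (simp add: \<delta>.S.M.fa_comp \<delta>.T.M.fa_comp)
  also have "?c \<cdot> ?s = copair3 ((b \<cdot> fa \<Gamma> (h, g)) \<cdot> fa \<Gamma> (Ident C (fo S A'), y')) (v \<cdot> h) (z \<cdot> g)"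
    using obj arr b' h g y' by (simp add: copair3_csum \<Gamma>_comp)
  finally have "(b \<cdot> fa \<Gamma> (h, g)) \<cdot> fa \<Gamma> (op A', Ident C Y') =
      step Y' y' \<beta> (z \<cdot> g) (v \<cdot> h) (b \<cdot> fa \<Gamma> (h, g))"
    using obj arr b' h g y' by (simp add: step_def)
  then show ?thesis
    using obj arr b' h g by (simp add: rec_solution_def hom_iff \<Gamma>_comp)
qed

text \<open>Both Y and B are SA, so the variables returned by \<open>d\<close> are interpreted by
  identities. The base case is \<open>g\<close>, whose result in \<open>A\<close> is included into
  SA as a variable.\<close>

definition lift_rec :: "'a \<Rightarrow> 'a \<Rightarrow> 'a" where
  "lift_rec t g = (let A = Cod C t; I = Ident C (fo S A) in
     THE b. rec_solution A (fo S A) (fo S A) (\<delta>.eval_terms t) (\<delta>.eval_terms t) I I (unit S A \<cdot> g) b)"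

text \<open>An algebra for \<open>G\<close> on SA has domain \<Gamma>(SA, SSA), whereas the
  recursion is run on \<Gamma>(SA, SA); the second argument is flattened beforehand.\<close>

definition lift_G :: "'a \<Rightarrow> 'a \<Rightarrow> 'a" where
  "lift_G t g = lift_rec t g \<cdot> fa \<Gamma> (Ident C (fo S (Cod C t)), mult S (Cod C t))"

definition TG_algebra :: "'o \<Rightarrow> 'a \<Rightarrow> 'a \<Rightarrow> bool" where
  "TG_algebra A t g \<longleftrightarrow> monad_algebra C T A t \<and> algebra C G A g"

lemma TG_algebraD:
  assumes "TG_algebra A t g"
  shows "monad_algebra C T A t" "A \<in> Obj C" "t \<in> Arr C" "Dom C t = fo T A" "Cod C t = A"
    "g \<in> Arr C" "Dom C g = fo \<Gamma> (A, fo S A)" "Cod C g = A"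
  using assms unfolding TG_algebra_def monad_algebra_def algebra_def by auto

lemma op_algebra: "A \<in> Obj C \<Longrightarrow> algebra C \<Sigma> (fo S A) (op A)"
  by (simp add: algebra_def)

lemma TG_rec_data:
  assumes "TG_algebra A t g" "TG_algebra A' t' g'" "f \<in> Arr C" "Dom C f = fo S A" "Cod C f = fo S A'"
  shows "rec_data A (fo S A) (fo S A') (\<delta>.eval_terms t) (\<delta>.eval_terms t') f"
  using TG_algebraD[OF assms(1)] TG_algebraD[OF assms(2)] assms(3-5)
  by (simp add: rec_data_def hom_iff)

lemma lift_rec_solution:
  assumes tg: "TG_algebra A t g"
  shows "rec_solution A (fo S A) (fo S A) (\<delta>.eval_terms t) (\<delta>.eval_terms t)
           (Ident C (fo S A)) (Ident C (fo S A)) (unit S A \<cdot> g) (lift_rec t g)"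
proof -
  note a = TG_algebraD[OF tg]
  have "\<exists>!b. rec_solution A (fo S A) (fo S A) (\<delta>.eval_terms t) (\<delta>.eval_terms t)
           (Ident C (fo S A)) (Ident C (fo S A)) (unit S A \<cdot> g) b"
    using a by (intro rec_ex1[OF _ _ op_algebra] TG_rec_data[OF tg tg]) (auto simp: hom_iff)
  from theI'[OF this] show ?thesis
    using a by (simp add: lift_rec_def Let_def)
qed

lemma lift_rec_facts:
  assumes tg: "TG_algebra A t g"
  shows "lift_rec t g \<in> Arr C" "Dom C (lift_rec t g) = fo \<Gamma> (fo S A, fo S A)"
    "Cod C (lift_rec t g) = fo S A"
    "lift_rec t g \<cdot> fa \<Gamma> (unit S A, Ident C (fo S A)) = unit S A \<cdot> g"
    "lift_rec t g \<cdot> fa \<Gamma> (op A, Ident C (fo S A)) =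
       step (fo S A) (\<delta>.eval_terms t) (\<delta>.eval_terms t) (Ident C (fo S A)) (Ident C (fo S A)) (lift_rec t g)"
  using lift_rec_solution[OF tg] unfolding rec_solution_def by (auto simp: hom_iff)

lemma lift_rec_unit:
  assumes tg: "TG_algebra A t g" and k: "k \<in> Arr C" "Cod C k = A" and l: "l \<in> Arr C" "Cod C l = fo S A"
  shows "lift_rec t g \<cdot> fa \<Gamma> (unit S A \<cdot> k, l) = unit S A \<cdot> (g \<cdot> fa \<Gamma> (k, l))"
proof -
  note a = TG_algebraD[OF tg] and b = lift_rec_facts[OF tg]
  have "lift_rec t g \<cdot> (fa \<Gamma> (unit S A, Ident C (fo S A)) \<cdot> fa \<Gamma> (k, l)) =
      (unit S A \<cdot> g) \<cdot> fa \<Gamma> (k, l)"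
    using a b k l by (intro Comp_reassoc) auto
  then show ?thesis
    using a b k l by (simp add: \<Gamma>_comp)
qed

text \<open>Both sides solve one recursion in which variables are interpreted by
  \<open>fa S f\<close>: the left one by \<open>rec_post\<close>, the right one by
  \<open>rec_pre\<close>.\<close>

lemma lift_rec_hom:
  assumes tg: "TG_algebra A t g" and tg': "TG_algebra A' t' g'"
    and f: "alg_hom C T t t' f" "alg_hom C G g g' f"
  shows "fa S f \<cdot> lift_rec t g = lift_rec t' g' \<cdot> fa \<Gamma> (fa S f, fa S f)"
proof -
  note a = TG_algebraD[OF tg] and a' = TG_algebraD[OF tg'] and f' = alg_homD[OF f(1)] alg_homD(4)[OF f(2)]
    and b = lift_rec_facts[OF tg] and b' = lift_rec_facts[OF tg']
    and e = \<delta>.eval_terms_arr[OF a(1)] \<delta>.eval_terms_arr[OF a'(1)]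
  have Sf: "fa S f \<in> Arr C" "Dom C (fa S f) = fo S A" "Cod C (fa S f) = fo S A'"
    "fa S f \<cdot> op A = op A' \<cdot> fa \<Sigma> (fa S f)"
    using a a' f' op_nat[of f] by auto
  have ev: "fa S f \<cdot> \<delta>.eval_terms t = \<delta>.eval_terms t' \<cdot> fa S (fa T (fa S f))"
    by (rule \<delta>.eval_terms_hom[OF a(1) a'(1) f(1)])
  let ?c = "fa S f \<cdot> (unit S A \<cdot> g)"
  have un: "unit S A' \<cdot> f = fa S f \<cdot> unit S A"
    using \<delta>.S.unit.nat[of f] a a' f' by simp
  have "rec_solution A (fo S A) (Cod C (fa S f)) (\<delta>.eval_terms t) (\<delta>.eval_terms t')
      (fa S f \<cdot> Ident C (fo S A)) (fa S f \<cdot> Ident C (fo S A)) ?c (fa S f \<cdot> lift_rec t g)"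
    using a a' Sf ev e
    by (intro rec_post[OF TG_rec_data[OF tg tg] _ lift_rec_solution[OF tg]]) (auto simp: hom_iff)
  then have 1: "rec_solution A (fo S A) (fo S A') (\<delta>.eval_terms t) (\<delta>.eval_terms t') (fa S f) (fa S f) ?c
      (fa S f \<cdot> lift_rec t g)"
    using a Sf by simp
  have "rec_solution A (fo S A) (fo S A') (\<delta>.eval_terms t) (\<delta>.eval_terms t')
      (Ident C (fo S A') \<cdot> fa S f) (Ident C (fo S A') \<cdot> fa S f)
      (lift_rec t' g' \<cdot> fa \<Gamma> (fa S f \<cdot> unit S A, fa S f)) (lift_rec t' g' \<cdot> fa \<Gamma> (fa S f, fa S f))"
    using a a' Sf ev e
    by (intro rec_pre[OF TG_rec_data[OF tg' tg'] _ lift_rec_solution[OF tg']]) (auto simp: hom_iff)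
  moreover have "lift_rec t' g' \<cdot> fa \<Gamma> (fa S f \<cdot> unit S A, fa S f) = ?c"
  proof -
    have "lift_rec t' g' \<cdot> fa \<Gamma> (unit S A' \<cdot> f, fa S f) = unit S A' \<cdot> (g' \<cdot> fa \<Gamma> (f, fa S f))"
      using a a' f' by (intro lift_rec_unit[OF tg']) auto
    also have "\<dots> = unit S A' \<cdot> (f \<cdot> g)"
      using f'(5) by simp
    also have "\<dots> = (fa S f \<cdot> unit S A) \<cdot> g"
      using a a' f' un by (intro Comp_reassoc) auto
    finally show ?thesis
      unfolding un using a a' f' by simp
  qed
  ultimately have 2: "rec_solution A (fo S A) (fo S A') (\<delta>.eval_terms t) (\<delta>.eval_terms t') (fa S f) (fa S f) ?c
      (lift_rec t' g' \<cdot> fa \<Gamma> (fa S f, fa S f))"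
    using a Sf by simp
  have "\<exists>!b. rec_solution A (fo S A) (fo S A') (\<delta>.eval_terms t) (\<delta>.eval_terms t') (fa S f) (fa S f) ?c b"
    using a a' Sf by (intro rec_ex1[OF _ _ op_algebra] TG_rec_data[OF tg tg']) (auto simp: hom_iff)
  then show ?thesis using 1 2 by blast
qed

lemma lift_G_arr:
  assumes tg: "TG_algebra A t g"
  shows "lift_G t g \<in> Arr C" "Dom C (lift_G t g) = fo \<Gamma> (fo S A, fo S (fo S A))"
    "Cod C (lift_G t g) = fo S A"
  using lift_rec_facts[OF tg] TG_algebraD[OF tg] by (simp_all add: lift_G_def)

lemma lift_TG_algebra:
  assumes tg: "TG_algebra A t g"
  shows "TG_algebra (fo S A) (\<delta>.lift_T t) (lift_G t g)"
  using \<delta>.lift_T_algebra[OF TG_algebraD(1)[OF tg]] lift_G_arr[OF tg] TG_algebraD(2)[OF tg]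
  by (simp add: TG_algebra_def algebra_def)

text \<open>Both sides solve the recursion with variables interpreted by \<open>mult S A\<close> and
  base case \<open>lift_G t g\<close>. On the left the multiplication removes the unit of the base
  case; on the right it cancels the unit in the first argument, and what remains is the definition
  of \<open>lift_G\<close>.\<close>

lemma lift_rec_mult:
  assumes tg: "TG_algebra A t g"
  shows "mult S A \<cdot> lift_rec (\<delta>.lift_T t) (lift_G t g) = lift_rec t g \<cdot> fa \<Gamma> (mult S A, mult S A)"
proof -
  note tg' = lift_TG_algebra[OF tg]
  note a = TG_algebraD[OF tg] and a' = TG_algebraD[OF tg']
    and b = lift_rec_facts[OF tg] and b' = lift_rec_facts[OF tg']
    and e = \<delta>.eval_terms_arr[OF a(1)] \<delta>.eval_terms_arr[OF a'(1)]
  let ?\<mu> = "mult S A" and ?SA = "fo S A" and ?SSA = "fo S (fo S A)"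
  have m: "?\<mu> \<in> Arr C" "Dom C ?\<mu> = ?SSA" "Cod C ?\<mu> = ?SA" "?\<mu> \<cdot> op ?SA = op A \<cdot> fa \<Sigma> ?\<mu>"
    using a op_mult[of A] by auto
  have ev: "?\<mu> \<cdot> \<delta>.eval_terms (\<delta>.lift_T t) = \<delta>.eval_terms t \<cdot> fa S (fa T ?\<mu>)"
    by (rule \<delta>.eval_terms_mult[OF a(1)])
  have "rec_solution ?SA ?SSA (Cod C ?\<mu>) (\<delta>.eval_terms (\<delta>.lift_T t)) (\<delta>.eval_terms t)
      (?\<mu> \<cdot> Ident C ?SSA) (?\<mu> \<cdot> Ident C ?SSA) (?\<mu> \<cdot> (unit S ?SA \<cdot> lift_G t g))
      (?\<mu> \<cdot> lift_rec (\<delta>.lift_T t) (lift_G t g))"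
    using a a' m ev e
    by (intro rec_post[OF TG_rec_data[OF tg' tg'] _ lift_rec_solution[OF tg']]) (auto simp: hom_iff)
  moreover have "?\<mu> \<cdot> (unit S ?SA \<cdot> lift_G t g) = lift_G t g"
    using a a' \<delta>.S.unit_left[OF a(2)] by (simp add: Comp_reassoc[OF \<delta>.S.unit_left[OF a(2)]])
  ultimately have 1: "rec_solution ?SA ?SSA ?SA (\<delta>.eval_terms (\<delta>.lift_T t)) (\<delta>.eval_terms t) ?\<mu> ?\<mu>
      (lift_G t g) (?\<mu> \<cdot> lift_rec (\<delta>.lift_T t) (lift_G t g))"
    using a m by simp
  have "rec_solution ?SA ?SSA ?SA (\<delta>.eval_terms (\<delta>.lift_T t)) (\<delta>.eval_terms t)
      (Ident C ?SA \<cdot> ?\<mu>) (Ident C ?SA \<cdot> ?\<mu>)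
      (lift_rec t g \<cdot> fa \<Gamma> (?\<mu> \<cdot> unit S ?SA, ?\<mu>)) (lift_rec t g \<cdot> fa \<Gamma> (?\<mu>, ?\<mu>))"
    using a a' m ev e
    by (intro rec_pre[OF TG_rec_data[OF tg tg] _ lift_rec_solution[OF tg]]) (auto simp: hom_iff)
  moreover have "lift_rec t g \<cdot> fa \<Gamma> (?\<mu> \<cdot> unit S ?SA, ?\<mu>) = lift_G t g"
    using a \<delta>.S.unit_left[OF a(2)] by (simp add: lift_G_def)
  ultimately have 2: "rec_solution ?SA ?SSA ?SA (\<delta>.eval_terms (\<delta>.lift_T t)) (\<delta>.eval_terms t) ?\<mu> ?\<mu>
      (lift_G t g) (lift_rec t g \<cdot> fa \<Gamma> (?\<mu>, ?\<mu>))"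
    using a m by simp
  have "\<exists>!b. rec_solution ?SA ?SSA ?SA (\<delta>.eval_terms (\<delta>.lift_T t)) (\<delta>.eval_terms t) ?\<mu> ?\<mu> (lift_G t g) b"
    using a a' m by (intro rec_ex1[OF _ _ op_algebra] TG_rec_data[OF tg' tg]) (auto simp: hom_iff)
  then show ?thesis using 1 2 by blast
qed

lemma lift_G_hom:
  assumes tg: "TG_algebra A t g" and tg': "TG_algebra A' t' g'"
    and f: "alg_hom C T t t' f" "alg_hom C G g g' f"
  shows "alg_hom C G (lift_G t g) (lift_G t' g') (fa S f)"
proof -
  note a = TG_algebraD[OF tg] and a' = TG_algebraD[OF tg'] and f' = alg_homD[OF f(1)]
    and b = lift_rec_facts(1-3)[OF tg] and b' = lift_rec_facts(1-3)[OF tg']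
  have m: "fa S f \<cdot> mult S A = mult S A' \<cdot> fa S (fa S f)"
    using \<delta>.S.mult.nat[of f] a a' f' by simp
  have "fa S f \<cdot> lift_G t g =
      (lift_rec t' g' \<cdot> fa \<Gamma> (fa S f, fa S f)) \<cdot> fa \<Gamma> (Ident C (fo S A), mult S A)"
    unfolding lift_G_def a(5) using a a' f' b b' lift_rec_hom[OF assms] by (intro Comp_reassoc) auto
  also have "\<dots> = lift_G t' g' \<cdot> fa \<Gamma> (fa S f, fa S (fa S f))"
    using a a' f' b b' m by (simp add: lift_G_def \<Gamma>_comp)
  finally show ?thesis
    using a a' f' lift_G_arr[OF tg] lift_G_arr[OF tg'] by (simp add: alg_hom_def)
qed

lemma lift_G_unit:
  assumes tg: "TG_algebra A t g"
  shows "alg_hom C G g (lift_G t g) (unit S A)"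
proof -
  note a = TG_algebraD[OF tg] and b = lift_rec_facts[OF tg]
  have "lift_G t g \<cdot> fa \<Gamma> (unit S A, fa S (unit S A)) = unit S A \<cdot> g"
    using a b \<delta>.S.unit_right[OF a(2)] by (simp add: lift_G_def \<Gamma>_comp)
  then show ?thesis
    using a lift_G_arr[OF tg] by (simp add: alg_hom_def)
qed

lemma lift_G_mult:
  assumes tg: "TG_algebra A t g"
  shows "alg_hom C G (lift_G (\<delta>.lift_T t) (lift_G t g)) (lift_G t g) (mult S A)"
proof -
  note tg' = lift_TG_algebra[OF tg]
  note a = TG_algebraD[OF tg] and a' = TG_algebraD[OF tg']
    and b = lift_rec_facts(1-3)[OF tg] and b' = lift_rec_facts(1-3)[OF tg']
  have "mult S A \<cdot> lift_G (\<delta>.lift_T t) (lift_G t g) =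
      (lift_rec t g \<cdot> fa \<Gamma> (mult S A, mult S A)) \<cdot> fa \<Gamma> (Ident C (fo S (fo S A)), mult S (fo S A))"
    unfolding lift_G_def[of "\<delta>.lift_T t"] a'(5)
    using a b b' lift_rec_mult[OF tg] by (intro Comp_reassoc) auto
  also have "\<dots> = lift_G t g \<cdot> fa \<Gamma> (mult S A, fa S (mult S A))"
    using a b \<delta>.S.mult_assoc[OF a(2)] by (simp add: lift_G_def \<Gamma>_comp)
  finally show ?thesis
    using a a' lift_G_arr[OF tg] lift_G_arr[OF tg'] by (simp add: alg_hom_def)
qed

end


section \<open>The induced distributive law\<close>

lemma (in category) initial_eq:
  assumes "initial C Z" "f \<in> Arr C" "g \<in> Arr C" "Dom C f = Z" "Dom C g = Z" "Cod C f = Cod C g"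
  shows "f = g"
proof -
  have "\<exists>!h. h \<in> hom C Z (Cod C f)"
    using assms unfolding initial_def by auto
  then show ?thesis
    using assms by (auto simp: hom_iff)
qed

section \<open>Algebras of the coproduct monad and their lifting\<close>

locale structural_law_coproduct = structural_law u C K \<Sigma> S \<eta>\<^sub>\<Sigma> T \<delta> \<Gamma> d
  for u :: "'u itself" and C :: "('o, 'a) cat" (structure) and K :: "('o, 'a) coprods"
    and \<Sigma> :: "('o, 'a, 'o, 'a) ftor"
    and S :: "('o, 'a) monad" and \<eta>\<^sub>\<Sigma> :: "'o \<Rightarrow> 'a"
    and T :: "('o, 'a) monad" and \<delta> :: "'o \<Rightarrow> 'a"
    and \<Gamma> :: "('o \<times> 'o, 'a \<times> 'a, 'o, 'a) ftor" and d :: "'o \<times> 'o \<Rightarrow> 'a" +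
  fixes T' P :: "('o, 'a) monad" and \<eta>\<^sub>\<Gamma> in\<^sub>1 in\<^sub>2 :: "'o \<Rightarrow> 'a"
  assumes T'_free: "free_monad C G T' \<eta>\<^sub>\<Gamma>"
    and P_coproduct: "monad_coproduct C T T' P in\<^sub>1 in\<^sub>2"
begin

sublocale \<eta>\<^sub>\<Gamma>: nat_trans C C G T' \<eta>\<^sub>\<Gamma>
  using T'_free unfolding free_monad_def by blast

sublocale in\<^sub>1: monad_morphism C T P in\<^sub>1
  using P_coproduct unfolding monad_coproduct_def by blast

sublocale in\<^sub>2: monad_morphism C T' P in\<^sub>2
  using P_coproduct unfolding monad_coproduct_def by blast

abbreviation T_part :: "'a \<Rightarrow> 'a" where
  "T_part p \<equiv> p \<cdot> in\<^sub>1 (Cod C p)"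

abbreviation G_part :: "'a \<Rightarrow> 'a" where
  "G_part p \<equiv> (p \<cdot> in\<^sub>2 (Cod C p)) \<cdot> \<eta>\<^sub>\<Gamma> (Cod C p)"

lemma parts_algebra:
  assumes p: "monad_algebra C P A p"
  shows "TG_algebra A (T_part p) (G_part p)"
proof -
  have "monad_algebra C T A (p \<cdot> in\<^sub>1 A)" "monad_algebra C T' A (p \<cdot> in\<^sub>2 A)"
    using monad_morphism_algebra[OF in\<^sub>1.monad_morphism_axioms p]
      monad_morphism_algebra[OF in\<^sub>2.monad_morphism_axioms p] by auto
  then show ?thesis
    using monad_algebraD(4)[OF p] nat_trans_algebra[OF \<eta>\<^sub>\<Gamma>.nat_trans_axioms]
    by (simp add: TG_algebra_def monad_algebra_def)
qed

lemma P_algebra: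
  assumes tg: "TG_algebra A t g"
  shows "\<exists>p. monad_algebra C P A p \<and> T_part p = t \<and> G_part p = g"
proof -
  have g: "algebra C G A g" and t: "monad_algebra C T A t"
    using tg unfolding TG_algebra_def by auto
  obtain t' where t': "monad_algebra C T' A t'" "t' \<cdot> \<eta>\<^sub>\<Gamma> A = g"
    using free_monad_alg[OF T'_free g] by blast
  obtain p where p: "monad_algebra C P A p" "p \<cdot> in\<^sub>1 A = t" "p \<cdot> in\<^sub>2 A = t'"
    using monad_coproduct_alg[OF P_coproduct t t'(1)] by blast
  then show ?thesis
    using t'(2) p monad_algebraD(4)[OF p(1)] by (intro exI[of _ p]) simp
qed

text \<open>Two reductions in a row: homomorphisms for \<Gamma>(X, SX) are homomorphisms for the
  free monad T', and arrows that are homomorphisms for both T and T' are homomorphisms for their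
  coproduct.\<close>

lemma P_hom:
  assumes p: "monad_algebra C P A p" and q: "monad_algebra C P B q"
    and f: "alg_hom C T (T_part p) (T_part q) f" "alg_hom C G (G_part p) (G_part q) f"
  shows "alg_hom C P p q f"
proof -
  have c: "Cod C p = A" "Cod C q = B"
    using monad_algebraD(4)[OF p] monad_algebraD(4)[OF q] by auto
  have "alg_hom C T' (p \<cdot> in\<^sub>2 A) (q \<cdot> in\<^sub>2 B) f"
    using f(2) monad_morphism_algebra[OF in\<^sub>2.monad_morphism_axioms] p q
    unfolding c by (intro free_monad_hom[OF T'_free]) auto
  then show ?thesis
    using f(1) unfolding c by (intro monad_coproduct_hom[OF P_coproduct p q])
qed

lemma parts_hom:
  assumes p: "monad_algebra C P A p" and q: "monad_algebra C P B q" and f: "alg_hom C P p q f"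
  shows "alg_hom C T (T_part p) (T_part q) f" "alg_hom C G (G_part p) (G_part q) f"
proof -
  have c: "Cod C p = A" "Cod C q = B"
    using monad_algebraD(4)[OF p] monad_algebraD(4)[OF q] by auto
  show "alg_hom C T (T_part p) (T_part q) f"
    unfolding c
    by (rule nat_trans_alg_hom[OF in\<^sub>1.nat_trans_axioms monad_algebraD(7)[OF p]
          monad_algebraD(7)[OF q] f])
  have "alg_hom C T' (p \<cdot> in\<^sub>2 A) (q \<cdot> in\<^sub>2 B) f"
    by (rule nat_trans_alg_hom[OF in\<^sub>2.nat_trans_axioms monad_algebraD(7)[OF p]
          monad_algebraD(7)[OF q] f])
  then show "alg_hom C G (G_part p) (G_part q) f"
    unfolding c
    by (rule nat_trans_alg_hom[OF \<eta>\<^sub>\<Gamma>.nat_trans_axioms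
          nat_trans_algebra[OF in\<^sub>2.nat_trans_axioms monad_algebraD(7)[OF p]]
          nat_trans_algebra[OF in\<^sub>2.nat_trans_axioms monad_algebraD(7)[OF q]]])
qed

text \<open>The two parts are lifted separately, by \<delta> and by recursion;
  \<open>P_algebra\<close> assembles them into one structure.\<close>

definition lift_P :: "'a \<Rightarrow> 'a" where
  "lift_P p = (SOME q. monad_algebra C P (fo S (Cod C p)) q \<and>
     T_part q = \<delta>.lift_T (T_part p) \<and> G_part q = lift_G (T_part p) (G_part p))"

lemma lift_P:
  assumes p: "monad_algebra C P A p"
  shows "monad_algebra C P (fo S A) (lift_P p)" "T_part (lift_P p) = \<delta>.lift_T (T_part p)"
    "G_part (lift_P p) = lift_G (T_part p) (G_part p)"
proof -
  have "\<exists>q. monad_algebra C P (fo S (Cod C p)) q \<and>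
      T_part q = \<delta>.lift_T (T_part p) \<and> G_part q = lift_G (T_part p) (G_part p)"
    using P_algebra[OF lift_TG_algebra[OF parts_algebra[OF p]]] monad_algebraD(4)[OF p] by simp
  from someI_ex[OF this] show "monad_algebra C P (fo S A) (lift_P p)"
    "T_part (lift_P p) = \<delta>.lift_T (T_part p)" "G_part (lift_P p) = lift_G (T_part p) (G_part p)"
    unfolding lift_P_def[symmetric] using monad_algebraD(4)[OF p] by auto
qed

sublocale lifted: monad_lifting C P S lift_P
proof
  fix A p assume p: "monad_algebra C P A p"
  note tg = parts_algebra[OF p] and Lp = lift_P[OF p]
  note LLp = lift_P[OF Lp(1)]
  show "monad_algebra C P (fo S A) (lift_P p)"
    by (rule Lp(1))
  show "alg_hom C P p (lift_P p) (unit S A)"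
  proof (rule P_hom[OF p Lp(1)])
    show "alg_hom C T (T_part p) (T_part (lift_P p)) (unit S A)"
      unfolding Lp by (rule \<delta>.lift_T_unit[OF TG_algebraD(1)[OF tg]])
    show "alg_hom C G (G_part p) (G_part (lift_P p)) (unit S A)"
      unfolding Lp by (rule lift_G_unit[OF tg])
  qed
  show "alg_hom C P (lift_P (lift_P p)) (lift_P p) (mult S A)"
  proof (rule P_hom[OF LLp(1) Lp(1)])
    show "alg_hom C T (T_part (lift_P (lift_P p))) (T_part (lift_P p)) (mult S A)"
      unfolding LLp Lp by (rule \<delta>.lift_T_mult[OF TG_algebraD(1)[OF tg]])
    show "alg_hom C G (G_part (lift_P (lift_P p))) (G_part (lift_P p)) (mult S A)"
      unfolding LLp Lp by (rule lift_G_mult[OF tg])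
  qed
  fix B q f assume q: "monad_algebra C P B q" and f: "alg_hom C P p q f"
  note tg' = parts_algebra[OF q] and Lq = lift_P[OF q] and f' = parts_hom[OF p q f]
  show "alg_hom C P (lift_P p) (lift_P q) (fa S f)"
  proof (rule P_hom[OF Lp(1) Lq(1)])
    show "alg_hom C T (T_part (lift_P p)) (T_part (lift_P q)) (fa S f)"
      unfolding Lp Lq by (rule \<delta>.lift_T_hom[OF TG_algebraD(1)[OF tg] TG_algebraD(1)[OF tg'] f'(1)])
    show "alg_hom C G (G_part (lift_P p)) (G_part (lift_P q)) (fa S f)"
      unfolding Lp Lq by (rule lift_G_hom[OF tg tg' f'])
  qed
qed

section \<open>The equation satisfied by the induced law\<close>

abbreviation induced_law :: "'o \<Rightarrow> 'a" where
  "induced_law \<equiv> lifted.law"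

text \<open>Unfolds the recursion on one operation applied to variables. The recursive call meets
  the base case by \<open>lift_rec_unit\<close>, and \<open>eval_terms_unit\<close> reduces the
  outer evaluation to \<open>fa S t\<close>. At a free P-algebra this becomes the right-hand side of
  the theorem.\<close>

lemma step_unit:
  assumes tg: "TG_algebra A t g" and e: "e \<in> Arr C" "Dom C e = X" "Cod C e = A"
  shows "lift_rec t g \<cdot> fa \<Gamma> (op A, Ident C (fo S A)) \<cdot> fa \<Gamma> (fa \<Sigma> (unit S A \<cdot> e), unit S A \<cdot> e) =
    fa S t \<cdot> fa S (fa T (copair3 (g \<cdot> fa \<Gamma> (e, fa S (t \<cdot> fa T e))) e e)) \<cdot> d (X, X)"
proof -
  note a = TG_algebraD[OF tg] and b = lift_rec_facts[OF tg]
  note ev = \<delta>.eval_terms_arr[OF a(1)]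
  let ?I = "Ident C (fo S A)" and ?ev = "\<delta>.eval_terms t"
  define k where "k = unit S A \<cdot> e"
  have X: "X \<in> Obj C" using e by auto
  have k: "k \<in> Arr C" "Dom C k = X" "Cod C k = fo S A"
    using a e by (auto simp: k_def)
  let ?c = "copair3 (lift_rec t g \<cdot> fa \<Gamma> (?I, ?ev)) ?I ?I"
  let ?s = "csum_arr C K (fa \<Gamma> (k, fa S (fa T k))) (csum_arr C K k k)"
  define c' where "c' = copair3 (g \<cdot> fa \<Gamma> (e, fa S (t \<cdot> fa T e))) e e"
  have c': "c' \<in> Arr C" "Dom C c' = csum K (fo \<Gamma> (X, fo S (fo T X))) (csum K X X)" "Cod C c' = A"
    using a e by (simp_all add: c'_def)
  have evu: "?ev \<cdot> (fa S (fa T (unit S A)) \<cdot> h) = fa S t \<cdot> h"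
    if "h \<in> Arr C" "Cod C h = fo S (fo T A)" for h
    using that a ev by (intro Comp_reassoc[OF \<delta>.eval_terms_unit[OF a(1)]]) auto
  have evk: "?ev \<cdot> fa S (fa T k) = fa S (t \<cdot> fa T e)"
    using a e evu[of "fa S (fa T e)"] by (simp add: k_def \<delta>.S.M.fa_comp \<delta>.T.M.fa_comp)
  have d_k: "d (fo S A, fo S A) \<cdot> fa \<Gamma> (fa \<Sigma> k, k) = fa S (fa T ?s) \<cdot> d (X, X)"
    using d_nat[OF k(1) k(1) k(3) k(3)] k(2) by simp
  \<comment> \<open>All three branches end in a variable of SA, so \<open>unit S A\<close> can be
    pulled out of the copairing.\<close>
  have cs: "?c \<cdot> ?s = unit S A \<cdot> c'"
  proof -
    have "?c \<cdot> ?s = copair3 ((lift_rec t g \<cdot> fa \<Gamma> (?I, ?ev)) \<cdot> fa \<Gamma> (k, fa S (fa T k))) (?I \<cdot> k) (?I \<cdot> k)"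
      using a b k ev by (intro copair3_csum) auto
    also have "(lift_rec t g \<cdot> fa \<Gamma> (?I, ?ev)) \<cdot> fa \<Gamma> (k, fa S (fa T k)) =
        lift_rec t g \<cdot> fa \<Gamma> (k, fa S (t \<cdot> fa T e))"
      using a b k ev evk by (simp add: \<Gamma>_comp)
    also have "\<dots> = unit S A \<cdot> (g \<cdot> fa \<Gamma> (e, fa S (t \<cdot> fa T e)))"
      unfolding k_def using a e by (intro lift_rec_unit[OF tg]) auto
    finally show ?thesis
      using a e k by (simp add: copair3_comp c'_def k_def[symmetric])
  qed
  have "lift_rec t g \<cdot> (fa \<Gamma> (op A, ?I) \<cdot> fa \<Gamma> (fa \<Sigma> k, k)) =
      step (fo S A) ?ev ?ev ?I ?I (lift_rec t g) \<cdot> fa \<Gamma> (fa \<Sigma> k, k)"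
    using a b k by (intro Comp_reassoc) auto
  also have "\<dots> = ?ev \<cdot> (fa S (fa T ?c) \<cdot> (d (fo S A, fo S A) \<cdot> fa \<Gamma> (fa \<Sigma> k, k)))"
    using a b(1-3) k ev by (simp add: step_def)
  also have "\<dots> = ?ev \<cdot> (fa S (fa T ?c) \<cdot> (fa S (fa T ?s) \<cdot> d (X, X)))"
    unfolding d_k ..
  also have "\<dots> = ?ev \<cdot> (fa S (fa T (?c \<cdot> ?s)) \<cdot> d (X, X))"
    using a b(1-3) k ev X by (simp add: \<delta>.S.M.fa_comp \<delta>.T.M.fa_comp)
  also have "\<dots> = fa S t \<cdot> (fa S (fa T c') \<cdot> d (X, X))"
    unfolding cs using a c' X evu by (simp add: \<delta>.S.M.fa_comp \<delta>.T.M.fa_comp)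
  finally show ?thesis
    unfolding k_def c'_def .
qed

text \<open>The law is computed at the free P-algebra on \<open>X\<close>, so
  \<open>step_unit\<close> is used with \<open>fo P X\<close> as carrier, the two parts of
  \<open>mult P X\<close> as structure, and \<open>unit P X\<close> as \<open>e\<close>. Both copies
  of \<open>X\<close> in the target of \<open>d\<close> are interpreted by \<open>e\<close>, whence
  the codiagonal on the right-hand side.\<close>

theorem induced_law_equation:
  assumes X: "X \<in> Obj C"
  shows "induced_law X \<cdot> in\<^sub>2 (fo S X) \<cdot> \<eta>\<^sub>\<Gamma> (fo S X)
         \<cdot> fa \<Gamma> (Ident C (fo S X), unit S (fo S X)) \<cdot> fa \<Gamma> (\<eta>\<^sub>\<Sigma> X, unit S X)
       = fa S (mult P X)
         \<cdot> fa S (in\<^sub>1 (fo P X) \<cdot> fa T (copair C K (mult P X) (unit P X)))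
         \<cdot> fa S (fa T (csum_arr C K (in\<^sub>2 (fo P X) \<cdot> fa T' (in\<^sub>1 X)) (Ident C X)))
         \<cdot> fa S (fa T (csum_arr C K (\<eta>\<^sub>\<Gamma> (fo T X)) (Ident C X)))
         \<cdot> fa S (fa T (csum_arr C K (fa \<Gamma> (unit T X, Ident C (fo S (fo T X))))
                                     (copair C K (Ident C X) (Ident C X))))
         \<cdot> d (X, X)"
proof -
  let ?A = "fo P X" and ?p = "mult P X" and ?e = "unit P X" and ?SX = "fo S X"
  have A: "?A \<in> Obj C" and SX: "?SX \<in> Obj C" using X by auto
  have p: "monad_algebra C P ?A ?p"
    by (rule in\<^sub>1.N.free_algebra[OF X])
  define t where "t = ?p \<cdot> in\<^sub>1 ?A"
  define g where "g = (?p \<cdot> in\<^sub>2 ?A) \<cdot> \<eta>\<^sub>\<Gamma> ?A"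
  have parts: "T_part ?p = t" "G_part ?p = g"
    using X by (simp_all add: t_def g_def)
  have tg: "TG_algebra ?A t g"
    using parts_algebra[OF p] unfolding parts .
  note a = TG_algebraD[OF tg] and b = lift_rec_facts[OF tg] and L = lift_P[OF p, unfolded parts]
  have Lp: "lift_P ?p \<in> Arr C" "Dom C (lift_P ?p) = fo P (fo S ?A)" "Cod C (lift_P ?p) = fo S ?A"
    using monad_algebraD(2-4)[OF L(1)] by auto
  \<comment> \<open>The T-part of a free P-algebra, restricted to generators, is the coproduct
    injection; this is the origin of \<open>in\<^sub>1 X\<close> under \<open>fa T'\<close>.\<close>
  have te: "t \<cdot> fa T ?e = in\<^sub>1 X"
  proof -
    have "t \<cdot> fa T ?e = ?p \<cdot> (fa P ?e \<cdot> in\<^sub>1 X)"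
      using X in\<^sub>1.nat[of ?e] by (simp add: t_def)
    then show ?thesis
      using X by (simp add: Comp_reassoc[OF in\<^sub>1.N.unit_right[OF X]])
  qed
  have unit_e: "in\<^sub>1 X \<cdot> unit T X = ?e"
    by (rule in\<^sub>1.pres_unit[OF X])
  let ?Se = "fa S ?e"
  have 1: "fa P ?Se \<cdot> in\<^sub>2 ?SX = in\<^sub>2 (fo S ?A) \<cdot> fa T' ?Se"
    using in\<^sub>2.nat[of ?Se] X by simp
  have 2: "fa T' ?Se \<cdot> \<eta>\<^sub>\<Gamma> ?SX = \<eta>\<^sub>\<Gamma> (fo S ?A) \<cdot> fa \<Gamma> (?Se, fa S ?Se)"
    using \<eta>\<^sub>\<Gamma>.nat[of ?Se] X by simp
  have 3: "lift_P ?p \<cdot> (in\<^sub>2 (fo S ?A) \<cdot> \<eta>\<^sub>\<Gamma> (fo S ?A)) =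
      lift_rec t g \<cdot> fa \<Gamma> (Ident C (fo S ?A), mult S ?A)"
    using L(3) X Lp a by (simp add: lift_G_def)
  have Seu: "?Se \<cdot> unit S X = unit S ?A \<cdot> ?e"
    using \<delta>.S.unit.nat[of ?e] X by simp
  have 4: "?Se \<cdot> \<eta>\<^sub>\<Sigma> X = op ?A \<cdot> fa \<Sigma> (unit S ?A \<cdot> ?e)"
  proof -
    have "?Se \<cdot> \<eta>\<^sub>\<Sigma> X = (op ?A \<cdot> fa \<Sigma> (unit S ?A)) \<cdot> fa \<Sigma> ?e"
      unfolding op_unit[OF A] using \<eta>\<^sub>\<Sigma>.nat[of ?e] X by simp
    then show ?thesis
      using X by (simp add: \<eta>\<^sub>\<Sigma>.F.fa_comp)
  qed
  \<comment> \<open>Of the two units of S inserted in the second argument, one is absorbed by the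
    flattening in \<open>lift_G\<close>.\<close>
  have 5: "mult S ?A \<cdot> fa S ?Se \<cdot> unit S ?SX \<cdot> unit S X = unit S ?A \<cdot> ?e"
  proof -
    have 6: "fa S ?Se \<cdot> unit S ?SX = unit S (fo S ?A) \<cdot> ?Se"
      using \<delta>.S.unit.nat[of ?Se] X by simp
    show ?thesis
      using X Seu by (simp add: Comp_reassoc[OF 6] Comp_reassoc[OF \<delta>.S.unit_left[OF A]])
  qed
  have "induced_law X \<cdot> in\<^sub>2 ?SX \<cdot> \<eta>\<^sub>\<Gamma> ?SX \<cdot> fa \<Gamma> (Ident C ?SX, unit S ?SX) \<cdot> fa \<Gamma> (\<eta>\<^sub>\<Sigma> X, unit S X) =
      lift_P ?p \<cdot> in\<^sub>2 (fo S ?A) \<cdot> \<eta>\<^sub>\<Gamma> (fo S ?A) \<cdot> fa \<Gamma> (?Se, fa S ?Se) \<cdot>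
        fa \<Gamma> (Ident C ?SX, unit S ?SX) \<cdot> fa \<Gamma> (\<eta>\<^sub>\<Sigma> X, unit S X)"
    using X Lp by (simp add: lifted.law_def Comp_reassoc[OF 1] Comp_reassoc[OF 2])
  also have "\<dots> = (lift_P ?p \<cdot> (in\<^sub>2 (fo S ?A) \<cdot> \<eta>\<^sub>\<Gamma> (fo S ?A))) \<cdot> fa \<Gamma> (?Se, fa S ?Se) \<cdot>
        fa \<Gamma> (Ident C ?SX, unit S ?SX) \<cdot> fa \<Gamma> (\<eta>\<^sub>\<Sigma> X, unit S X)"
    using X Lp by simp
  also have "\<dots> = lift_rec t g \<cdot> fa \<Gamma> (?Se \<cdot> \<eta>\<^sub>\<Sigma> X, mult S ?A \<cdot> fa S ?Se \<cdot> unit S ?SX \<cdot> unit S X)"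
    unfolding 3 using X a b by (simp add: \<Gamma>_comp \<Gamma>_comp')
  also have "\<dots> = lift_rec t g \<cdot> fa \<Gamma> (op ?A, Ident C (fo S ?A)) \<cdot>
      fa \<Gamma> (fa \<Sigma> (unit S ?A \<cdot> ?e), unit S ?A \<cdot> ?e)"
    unfolding 4 5 using X a b by (simp add: \<Gamma>_comp)
  also have "\<dots> = fa S t \<cdot> fa S (fa T (copair3 (g \<cdot> fa \<Gamma> (?e, fa S (t \<cdot> fa T ?e))) ?e ?e)) \<cdot> d (X, X)"
    using X by (intro step_unit[OF tg]) auto
  \<comment> \<open>The branch of the recursive arguments is factored through
    \<open>\<eta>\<^sub>\<Gamma>\<close>, \<open>fa T' (in\<^sub>1 X)\<close> and
    \<open>in\<^sub>2\<close> before it is multiplied in P; the two variable branches are merged at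
    the first stage.\<close>
  also have "copair3 (g \<cdot> fa \<Gamma> (?e, fa S (t \<cdot> fa T ?e))) ?e ?e =
      copair C K ?p ?e
      \<cdot> csum_arr C K (in\<^sub>2 ?A \<cdot> fa T' (in\<^sub>1 X)) (Ident C X)
      \<cdot> csum_arr C K (\<eta>\<^sub>\<Gamma> (fo T X)) (Ident C X)
      \<cdot> csum_arr C K (fa \<Gamma> (unit T X, Ident C (fo S (fo T X)))) (copair C K (Ident C X) (Ident C X))"
    (is "_ = ?rhs")
  proof -
    have "fa T' (in\<^sub>1 X) \<cdot> \<eta>\<^sub>\<Gamma> (fo T X) = \<eta>\<^sub>\<Gamma> ?A \<cdot> fa \<Gamma> (in\<^sub>1 X, fa S (in\<^sub>1 X))"
      using \<eta>\<^sub>\<Gamma>.nat[of "in\<^sub>1 X"] X by simp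
    from Comp_reassoc[OF this] have "?p \<cdot> in\<^sub>2 ?A \<cdot> fa T' (in\<^sub>1 X) \<cdot> \<eta>\<^sub>\<Gamma> (fo T X) \<cdot>
        fa \<Gamma> (unit T X, Ident C (fo S (fo T X))) = g \<cdot> fa \<Gamma> (?e, fa S (in\<^sub>1 X))"
      using X unit_e by (simp add: g_def \<Gamma>_comp)
    then show ?thesis
      unfolding te using X a by (simp add: copair3_def copair_comp copair_csum
          Comp_reassoc[OF copair_csum])
  qed
  also have "fa S t \<cdot> fa S (fa T ?rhs) \<cdot> d (X, X) = fa S (mult P X)
         \<cdot> fa S (in\<^sub>1 (fo P X) \<cdot> fa T (copair C K (mult P X) (unit P X)))
         \<cdot> fa S (fa T (csum_arr C K (in\<^sub>2 (fo P X) \<cdot> fa T' (in\<^sub>1 X)) (Ident C X)))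
         \<cdot> fa S (fa T (csum_arr C K (\<eta>\<^sub>\<Gamma> (fo T X)) (Ident C X)))
         \<cdot> fa S (fa T (csum_arr C K (fa \<Gamma> (unit T X, Ident C (fo S (fo T X))))
                                     (copair C K (Ident C X) (Ident C X))))
         \<cdot> d (X, X)"
    using X by (simp add: t_def \<delta>.S.M.fa_comp \<delta>.T.M.fa_comp)
  finally show ?thesis .
qed

section \<open>Constant-freeness and admissibility\<close>

lemma initial_\<Gamma>:
  assumes Z: "initial C Z" and Y: "Y \<in> Obj C"
  shows "initial C (fo \<Gamma> (Z, Y))"
proof -
  \<comment> \<open>An initial object is a colimit of the empty diagram, and cocontinuity preserves
    it. Without objects or arrows the unspecified fields are never consulted.\<close>
  define J :: "('u, 'u) cat" where
    "J = \<lparr>Obj = {}, Arr = {}, Dom = undefined, Cod = undefined, Ident = undefined, Comp = undefined\<rparr>"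
  interpret J: category J
    by unfold_locales (auto simp: J_def hom_def)
  have J: "small_cat u J"
    using J.category_axioms by (simp add: small_cat_def J_def small_finite[OF universe])
  have D: "is_functor J C F" for F :: "('u, 'u, 'o, 'a) ftor"
    by unfold_locales (auto simp: J_def hom_def)
  have colim: "colimit C J F W c \<longleftrightarrow> initial C W" for F :: "('u, 'u, 'o, 'a) ftor" and W c
    by (auto simp: colimit_def cocone_def initial_def J_def hom_def)
  have "colimit C J (fix_snd C \<Gamma> Y \<odot> D) (fo (fix_snd C \<Gamma> Y) Z) (\<lambda>j. fa (fix_snd C \<Gamma> Y) undefined)"
    using \<Gamma>_cocontinuous[OF Y] J D colim Z
    unfolding cocontinuous_def preserves_colimits_def by blast
  then show ?thesis
    unfolding colim by (simp add: fix_snd_def)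
qed

text \<open>An initial object Z carries a P-algebra, made of the inverse of \<open>unit T Z\<close>
  and the unique arrow out of \<Gamma>(Z, SZ), itself initial. Initiality makes
  \<open>unit P Z\<close> a homomorphism from it to the free algebra; hence the structure arrow,
  always a retraction of the unit, is a two-sided inverse, as
  \<open>mult P Z \<cdot> fa P (unit P Z)\<close> is the identity.\<close>

theorem coproduct_constant_free: "constant_free C P"
  unfolding constant_free_def
proof (intro allI impI)
  fix Z assume Z: "initial C Z"
  then have obj: "Z \<in> Obj C" by (simp add: initial_def)
  have "iso C (unit T Z)"
    using T_constant_free Z unfolding constant_free_def by blast
  then obtain t where t: "t \<in> Arr C" "Dom C t = fo T Z" "Cod C t = Z"
    and tu: "t \<cdot> unit T Z = Ident C Z" and ut: "unit T Z \<cdot> t = Ident C (fo T Z)"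
    using obj unfolding iso_def by (auto simp: hom_iff)
  \<comment> \<open>\<open>mult T Z\<close> and \<open>fa T t\<close> are both inverse to the
    isomorphism \<open>fa T (unit T Z)\<close>, so they agree, and the associativity law of
    \<open>t\<close> follows.\<close>
  have "mult T Z = mult T Z \<cdot> fa T (unit T Z \<cdot> t)"
    using ut obj by simp
  also have "\<dots> = (mult T Z \<cdot> fa T (unit T Z)) \<cdot> fa T t"
    using obj t by (simp add: \<delta>.T.M.fa_comp)
  also have "\<dots> = fa T t"
    using \<delta>.T.unit_right[OF obj] obj t by simp
  finally have "t \<cdot> mult T Z = t \<cdot> fa T t"
    by (rule arg_cong)
  then have t_alg: "monad_algebra C T Z t"
    using t tu obj unfolding monad_algebra_def algebra_def by blast
  note init = initial_\<Gamma>[OF Z \<delta>.S.M.fo_Obj[OF obj]]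
  then obtain g where "g \<in> hom C (fo \<Gamma> (Z, fo S Z)) Z"
    using obj unfolding initial_def by blast
  then have tg: "TG_algebra Z t g"
    using t_alg obj by (auto simp: TG_algebra_def algebra_def hom_iff)
  obtain p where p: "monad_algebra C P Z p" and parts: "T_part p = t" "G_part p = g"
    using P_algebra[OF tg] by blast
  note p' = monad_algebraD[OF p] and q = in\<^sub>1.N.free_algebra[OF obj]
  note a = TG_algebraD[OF tg] and a' = TG_algebraD[OF parts_algebra[OF q]]
  have "alg_hom C P p (mult P Z) (unit P Z)"
  proof (rule P_hom[OF p q])
    let ?t = "T_part (mult P Z)"
    \<comment> \<open>Since \<open>unit T Z\<close> is invertible, arrows out of TZ may be compared
      after precomposing with it, which leaves arrows out of an initial object.\<close>
    have T_epi: "f = f'" if "f \<in> Arr C" "Dom C f = fo T Z" "f' \<in> Arr C" "Dom C f' = fo T Z"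
      "f \<cdot> unit T Z = f' \<cdot> unit T Z" for f f'
    proof -
      have "f = (f \<cdot> unit T Z) \<cdot> t" "f' = (f' \<cdot> unit T Z) \<cdot> t"
        using that(1-4) ut t obj by simp_all
      then show ?thesis using that(5) by simp
    qed
    have "unit P Z \<cdot> t = ?t \<cdot> fa T (unit P Z)"
    proof (rule T_epi)
      show "(unit P Z \<cdot> t) \<cdot> unit T Z = (?t \<cdot> fa T (unit P Z)) \<cdot> unit T Z"
        by (rule initial_eq[OF Z]) (use obj t a' in auto)
    qed (use obj t a' in auto)
    then show "alg_hom C T (T_part p) ?t (unit P Z)"
      unfolding parts using obj t a' by (simp add: alg_hom_def)
    let ?g = "G_part (mult P Z)"
    have "unit P Z \<cdot> g = ?g \<cdot> fa G (unit P Z)"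
      by (rule initial_eq[OF init]) (use obj a a' in auto)
    then show "alg_hom C G (G_part p) ?g (unit P Z)"
      unfolding parts using obj a a' by (simp add: alg_hom_def)
  qed
  from alg_homD(4)[OF this] have "unit P Z \<cdot> p = Ident C (fo P Z)"
    using in\<^sub>1.N.unit_right[OF obj] by simp
  then show "iso C (unit P Z)"
    using p' obj unfolding iso_def by (auto simp: hom_iff intro!: bexI[of _ p])
qed

lemma S_unit_admissible: "admissible C (\<lambda>X. fa S (unit P X))"
  unfolding admissible_def
proof (intro allI impI)
  fix Z assume Z: "initial C Z"
  then have obj: "Z \<in> Obj C" by (simp add: initial_def)
  have "iso C (unit P Z)"
    using coproduct_constant_free Z unfolding constant_free_def by blast
  then obtain p where p: "p \<in> Arr C" "Dom C p = fo P Z" "Cod C p = Z"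
    and pu: "p \<cdot> unit P Z = Ident C Z" and up: "unit P Z \<cdot> p = Ident C (fo P Z)"
    using obj unfolding iso_def by (auto simp: hom_iff)
  have "fa S p \<cdot> fa S (unit P Z) = Ident C (fo S Z)"
    "fa S (unit P Z) \<cdot> fa S p = Ident C (fo S (fo P Z))"
    using \<delta>.S.M.fa_eq[OF pu] \<delta>.S.M.fa_eq[OF up] p obj by simp_all
  then show "iso C (fa S (unit P Z))"
    using p obj unfolding iso_def by (auto simp: hom_iff intro!: bexI[of _ "fa S p"])
qed

end

theorem theorem4p2:
  fixes C :: "('o, 'a) cat" and K :: "('o, 'a) coprods"
    and \<Sigma> :: "('o, 'a, 'o, 'a) ftor"
    and \<Gamma> :: "('o \<times> 'o, 'a \<times> 'a, 'o, 'a) ftor"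
    and S T T' P :: "('o, 'a) monad"
    and \<eta>\<^sub>\<Sigma> \<eta>\<^sub>\<Gamma> \<delta> in\<^sub>1 in\<^sub>2 :: "'o \<Rightarrow> 'a"
    and d :: "'o \<times> 'o \<Rightarrow> 'a"
  assumes "universe_type TYPE('u)"
    and "locally_finitely_presentable TYPE('u) C"
    and "binary_coproducts C K"
    and "incremental_structural_law TYPE('u) C K \<Sigma> S \<eta>\<^sub>\<Sigma> T \<delta> \<Gamma> d"
    and "free_monad C (diagonal_ftor \<Gamma> S) T' \<eta>\<^sub>\<Gamma>"
    and "monad_coproduct C T T' P in\<^sub>1 in\<^sub>2"
  shows "(\<exists>\<delta>'. distributive_law C P S \<delta>' \<and>
      (\<forall>X \<in> Obj C.
         \<delta>' X
         \<cdot>\<^bsub>C\<^esub> in\<^sub>2 (fo S X)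
         \<cdot>\<^bsub>C\<^esub> \<eta>\<^sub>\<Gamma> (fo S X)
         \<cdot>\<^bsub>C\<^esub> fa \<Gamma> (Ident C (fo S X), unit S (fo S X))
         \<cdot>\<^bsub>C\<^esub> fa \<Gamma> (\<eta>\<^sub>\<Sigma> X, unit S X)
       = fa S (mult P X)
         \<cdot>\<^bsub>C\<^esub> fa S (in\<^sub>1 (fo P X) \<cdot>\<^bsub>C\<^esub> fa T (copair C K (mult P X) (unit P X)))
         \<cdot>\<^bsub>C\<^esub> fa S (fa T (csum_arr C K (in\<^sub>2 (fo P X) \<cdot>\<^bsub>C\<^esub> fa T' (in\<^sub>1 X)) (Ident C X)))
         \<cdot>\<^bsub>C\<^esub> fa S (fa T (csum_arr C K (\<eta>\<^sub>\<Gamma> (fo T X)) (Ident C X)))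
         \<cdot>\<^bsub>C\<^esub> fa S (fa T (csum_arr C K (fa \<Gamma> (unit T X, Ident C (fo S (fo T X))))
                                     (copair C K (Ident C X) (Ident C X))))
         \<cdot>\<^bsub>C\<^esub> d (X, X)) \<and>
      constant_free C P \<and>
      monad_morphism C S (composite_monad C S P \<delta>') (\<lambda>X. fa S (unit P X)) \<and>
      admissible C (\<lambda>X. fa S (unit P X)))"
proof -
  have cat: "category C"
    using assms(2) unfolding locally_finitely_presentable_def by blast
  interpret lfp_category "TYPE('u)" C
    using cat assms(1,2) by (simp add: lfp_category_def lfp_category_axioms_def)
  interpret coproduct_category C K
    using cat assms(3) by (simp add: coproduct_category_def coproduct_category_axioms_def)
  interpret incremental_structural_law "TYPE('u)" C K \<Sigma> S \<eta>\<^sub>\<Sigma> T \<delta> \<Gamma> d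
    by (rule assms(4))
  interpret structural_law_coproduct "TYPE('u)" C K \<Sigma> S \<eta>\<^sub>\<Sigma> T \<delta> \<Gamma> d T' P \<eta>\<^sub>\<Gamma> in\<^sub>1 in\<^sub>2
    using assms(5,6) by unfold_locales
  have law: "distributive_law C P S induced_law"
    by (rule lifted.lifting_distributive_law)
  show ?thesis
    using law induced_law_equation coproduct_constant_free
      distributive_law.composite_injection[OF law] S_unit_admissible
    by blast
qed

end
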